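(* For any integers $r$ and $t\ge1$, if there is at least one integer $M\equiv r\pmod{t}$ for which $\frac{\overline{c\phi_2}(M)}{4}$ is odd, then there are infinitely many such integers $M\equiv r\pmod t$. Furthermore, if such an $M$ exists, then the smallest such $M$ is less than \[C_{r,t}:=\frac{2^{18+j}\cdot 3^7t^6}{d^2}\prod_{p\mid 6t}\left(1-\frac{1}{p^2}\right)-2^j,\] where $d:=\gcd(12r-1,t)$, $j$ is any integer satisfying $2^j>\frac{t}{12}$, and the product is over primes $p$ dividing $6t$.
   Context: Let $c\phi_2(n)$ be defined by $\sum_{n\ge0}c\phi_2(n)q^n=\prod_{n\ge1}\frac{1-q^{4n-2}}{(1-q^{2n-1})^4(1-q^{4n})}$, and let $p(n)$ be the partition function, with the convention $p(x)=0$ if $x$ is not a nonnegative integer. Define $\overline{c\phi_2}(n):=c\phi_2(n)-p(n/2)$; this is always divisible by $4$ (equivalently, $\sum_{n\ge0}\overline{c\phi_2}(n)q^n=4q\prod_{n\ge1}\frac{(1-q^{16n})^2}{(1-q^n)^2(1-q^{8n})}$). *)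

theory Defs
  imports
    "HOL-Analysis.Analysis"
    "HOL-Number_Theory.Number_Theory"
    "HOL-Library.Multiset"
begin

(* Integral power series have no inverse operation in the library because int is not of class
   inverse.  The term fps_right_inverse f 1 is the reciprocal over int of a series f with constant
   term 1.  The index n starts at 0, so n here is n - 1 in the usual product over n >= 1. *)
definition cphi2_numer :: "nat \<Rightarrow> int fps" where
  "cphi2_numer n = 1 - fps_X ^ (4 * n + 2)"

definition cphi2_denom :: "nat \<Rightarrow> int fps" where
  "cphi2_denom n = (1 - fps_X ^ (2 * n + 1)) ^ 4 * (1 - fps_X ^ (4 * n + 4))"

definition cphi2_factor :: "nat \<Rightarrow> int fps" where
  "cphi2_factor n = cphi2_numer n * fps_right_inverse (cphi2_denom n) 1"

definition cphi2 :: "nat \<Rightarrow> int" where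
  "cphi2 n = fps_nth (prodinf cphi2_factor) n"

(* A partition is encoded as the multiset of its parts. *)
definition partition_number :: "nat \<Rightarrow> nat" where
  "partition_number n = card {P :: nat multiset. 0 \<notin># P \<and> sum_mset P = n}"

(* The conditional expression is p(n/2) with p = 0 off the nonnegative integers.  Every value is
   divisible by 4 (modulo 4 the n-th factor is (1 - q^(4n-2))^(-1) (1 - q^(4n))^(-1), whose product
   over n is the series of p(n/2)), so cphi2_bar n div 4 is the exact quotient. *)
definition cphi2_bar :: "nat \<Rightarrow> int" where
  "cphi2_bar n = cphi2 n - (if even n then int (partition_number (n div 2)) else 0)"

definition parity_bound :: "int \<Rightarrow> int \<Rightarrow> int \<Rightarrow> real" where
  "parity_bound r t j =
     2 powi (18 + j) * 3 ^ 7 * real_of_int t ^ 6 / real_of_int (gcd (12 * r - 1) t) ^ 2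
       * (\<Prod>p | prime p \<and> p dvd 6 * t. 1 - 1 / real_of_int p ^ 2)
     - 2 powi j"

(* The remaining lemmas show that the definitions are not degenerate: each factor is the intended
   quotient, the infinite product converges coefficientwise to the series of cphi2, and the
   cardinality in partition_number is that of a finite set. *)

lemma cphi2_denom_nth_0: "fps_nth (cphi2_denom n) 0 = 1"
  by (simp add: cphi2_denom_def fps_power_zeroth)

lemma cphi2_factor_mult_denom: "cphi2_factor n * cphi2_denom n = cphi2_numer n"
proof -
  have "cphi2_denom n * fps_right_inverse (cphi2_denom n) 1 = 1"
    by (rule fps_right_inverse) (simp add: cphi2_denom_nth_0)
  then show ?thesis
    by (simp add: cphi2_factor_def ac_simps)
qed

lemma fps_has_prod_stable:
  fixes f :: "nat \<Rightarrow> int fps"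
  assumes f: "\<And>n k. k \<le> n \<Longrightarrow> fps_nth (f n) k = (if k = 0 then 1 else 0)"
  shows "f has_prod Abs_fps (\<lambda>k. fps_nth (\<Prod>i\<le>k. f i) k)" (is "_ has_prod ?p")
proof -
  have step: "fps_nth (\<Prod>i\<le>Suc n. f i) k = fps_nth (\<Prod>i\<le>n. f i) k" if "k \<le> n" for n k
  proof -
    have "fps_nth (\<Prod>i\<le>Suc n. f i) k
        = (\<Sum>i=0..k. fps_nth (\<Prod>i\<le>n. f i) i * fps_nth (f (Suc n)) (k - i))"
      by (simp add: fps_mult_nth)
    also have "\<dots> = (\<Sum>i=0..k. if i = k then fps_nth (\<Prod>i\<le>n. f i) i else 0)"
      using that by (intro sum.cong) (auto simp: f)
    also have "\<dots> = fps_nth (\<Prod>i\<le>n. f i) k"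
      by simp
    finally show ?thesis .
  qed
  have stable: "fps_nth (\<Prod>i\<le>n. f i) k = fps_nth ?p k" if "k \<le> n" for n k
    using that by (induction n rule: dec_induct) (auto simp: step simp del: prod.atMost_Suc)
  have "(\<lambda>n. \<Prod>i\<le>n. f i) \<longlonglongrightarrow> ?p"
  proof (rule tendsto_fpsI)
    fix k
    show "\<forall>\<^sub>F n in sequentially. fps_nth (\<Prod>i\<le>n. f i) k = fps_nth ?p k"
      unfolding eventually_sequentially using stable by blast
  qed
  moreover have "?p \<noteq> 0"
  proof
    assume "?p = 0"
    then have "fps_nth ?p 0 = 0"
      by (simp only: fps_zero_nth)
    then show False
      by (simp add: f)
  qed
  ultimately show ?thesis
    unfolding has_prod_def raw_has_prod_def add_0_right by blast
qed

lemma cphi2_factor_nth: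
  assumes "k \<le> n"
  shows "fps_nth (cphi2_factor n) k = (if k = 0 then 1 else 0)"
proof -
  let ?x = "fps_X ^ (2 * n + 1) :: int fps"
  have N: "?x dvd cphi2_numer n - 1"
  proof -
    have "?x dvd fps_X ^ (4 * n + 2)"
      by (rule le_imp_power_dvd) simp
    then show ?thesis
      by (simp add: cphi2_numer_def del: power_Suc)
  qed
  have "?x dvd (1 - ?x) ^ 4 - 1"
  proof -
    have "?x dvd - ?x * (\<Sum>i<4. (1 - ?x) ^ i)"
      by simp
    also have "- ?x * (\<Sum>i<4. (1 - ?x) ^ i) = (1 - ?x) ^ 4 - 1"
      using power_diff_1_eq[of "1 - ?x" 4] by simp
    finally show ?thesis .
  qed
  moreover have "?x dvd fps_X ^ (4 * n + 4)"
    by (rule le_imp_power_dvd) simp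
  moreover have "cphi2_denom n - 1 = ((1 - ?x) ^ 4 - 1) - (1 - ?x) ^ 4 * fps_X ^ (4 * n + 4)"
    by (simp add: cphi2_denom_def algebra_simps)
  ultimately have D: "?x dvd cphi2_denom n - 1"
    by (metis dvd_diff dvd_mult)
  have "cphi2_factor n - 1 = (cphi2_factor n - 1) *
      (cphi2_denom n * fps_right_inverse (cphi2_denom n) 1)"
    by (subst fps_right_inverse) (simp_all add: cphi2_denom_nth_0)
  also have "\<dots> = ((cphi2_numer n - 1) - (cphi2_denom n - 1)) * fps_right_inverse (cphi2_denom n) 1"
    by (simp add: cphi2_factor_mult_denom left_diff_distrib flip: mult.assoc)
  finally have "?x dvd cphi2_factor n - 1"
    using N D by (metis dvd_diff dvd_mult2)
  then obtain g where "cphi2_factor n - 1 = ?x * g"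
    by (elim dvdE)
  then have "cphi2_factor n = 1 + ?x * g"
    by (simp add: algebra_simps)
  then show ?thesis
    using assms by (simp add: fps_X_power_mult_nth del: power_Suc)
qed

lemma cphi2_factor_has_prod: "cphi2_factor has_prod Abs_fps cphi2"
proof -
  have "cphi2_factor has_prod prodinf cphi2_factor"
    using fps_has_prod_stable[of cphi2_factor] cphi2_factor_nth has_prod_unique by metis
  moreover have "Abs_fps cphi2 = prodinf cphi2_factor"
    by (simp add: fps_eq_iff cphi2_def)
  ultimately show ?thesis
    by simp
qed

lemma finite_partitions: "finite {P :: nat multiset. 0 \<notin># P \<and> sum_mset P = n}"
proof (rule finite_subset)
  show "{P :: nat multiset. 0 \<notin># P \<and> sum_mset P = n}
      \<subseteq> mset ` {xs. set xs \<subseteq> {..n} \<and> length xs \<le> n}"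
  proof
    fix P :: "nat multiset"
    assume "P \<in> {P. 0 \<notin># P \<and> sum_mset P = n}"
    then have P: "0 \<notin># P" "sum_mset P = n" by auto
    have "size P \<le> sum_mset P"
      using P(1) by (induction P) auto
    moreover have "x \<le> n" if "x \<in># P" for x
      using that P(2) by (metis le_add1 multi_member_split sum_mset.add_mset)
    moreover obtain xs where "mset xs = P"
      by (metis ex_mset)
    ultimately show "P \<in> mset ` {xs. set xs \<subseteq> {..n} \<and> length xs \<le> n}"
      using P(2) by (intro image_eqI[of _ _ xs]) auto
  qed
  show "finite (mset ` {xs. set xs \<subseteq> {..n} \<and> length xs \<le> n})"
    by (intro finite_imageI finite_lists_length_le) simp
qed

end

theory Submission
  imports
    Defs
    "HOL-Complex_Analysis.Complex_Analysis"
    "HOL-Probability.Probability"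
    "HOL-Real_Asymp.Real_Asymp"
    "HOL-Library.Z2"
begin

text \<open>Modulo 2 the generating function of \<open>cphi2_bar M div 4\<close> is a theta series: the quotient is odd iff
  \<open>12 * M - 1\<close> has an odd number of representations \<open>3 * x\<^sup>2 + 8 * y\<^sup>2\<close> with \<open>x\<close> congruent to 1 modulo 4
  and \<open>y\<close> congruent to 1 modulo 6.  Some prime \<open>l\<close> is inert for this form, so multiplying \<open>12 * M - 1\<close> by
  suitable even powers of \<open>l\<close> preserves the number of representations and the class of \<open>M\<close>; this gives
  infinitely many odd values.

  For the bound, restricting to \<open>M\<close> in the residue class gives a series \<open>F\<close> of the same shape, with
  periodic coefficients.  The modular group permutes such theta series through finitely many classes, so
  by counting coefficients some nontrivial form of degree \<open>2 * A\<close> in \<open>F\<close>, the unrestricted series \<open>G\<close> and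
  the theta series \<open>H\<close> of a sublattice, of degree at most \<open>A\<close> in \<open>F\<close> and in \<open>G\<close>, vanishes to high order
  at all cusps, hence vanishes identically by the maximum principle.  Modulo 2 the series \<open>H\<close> is 1, so
  \<open>F\<close> and \<open>G\<close> satisfy an algebraic relation, which forces the order of \<open>F\<close> to be at most \<open>A\<close> times the
  order of \<open>G\<close>.  Here \<open>A\<close> is of size \<open>t\<^sup>3\<close>, while the claimed bound is at least of size \<open>t\<^sup>5\<close>.\<close>

subsection \<open>Series permuted by the modular group\<close>

text \<open>Write \<open>e\<close> for the Euler product. Modulo 2 the quotient has generating
  function q times the 22nd power of \<open>e\<close>. The cube of \<open>e\<close> is modulo 2 the
  series of triangular numbers and \<open>e\<close> itself that of pentagonal numbers, so 22 = 6 +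
  16 exhibits a triangular series in q^2 times a pentagonal series in q^16: a binary theta series of
  weight 1, whose modular behaviour is explicit. Passing to \<open>12 * M - 1\<close> completes both
  squares. The obstacle is that parity needs integral coefficients, while the expansions at the
  other cusps are only complex. The relation is therefore found over the complex numbers and made
  integral afterwards: a rational linear functional sends its coefficients to rationals for all
  degrees at once, and division by the gcd leaves an odd coefficient. The third series makes the
  relation homogeneous, as modularity requires, and disappears modulo 2. The size of A is a count:
  (A + 1)^2 monomials against 4 * E^2 first rows of matrices with 2 * A * E coefficients each,
  whence A = 8 * E^3, with level E = 48 * t. The order of G is 11.\<close>

definition nome :: "nat \<Rightarrow> complex \<Rightarrow> complex" where
  "nome E z = exp (\<i> * pi * z / E)"

lemma norm_nome: "norm (nome E z) = exp (- (pi * Im z / E))"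
  by (simp add: nome_def norm_exp_eq_Re)

lemma norm_nome_less_1: "E > 0 \<Longrightarrow> Im z > 0 \<Longrightarrow> norm (nome E z) < 1"
  by (simp add: norm_nome)

lemma nome_periodic:
  assumes "E > 0"
  shows "nome E (z + of_int (2 * int E * k)) = nome E z"
proof -
  have "\<i> * pi * (z + of_int (2 * int E * k)) / E = \<i> * pi * z / E + (2 * of_int k * of_real pi) * \<i>"
    using assms by (simp add: field_simps)
  then show ?thesis
    using exp_integer_2pi[of "of_int k"] unfolding nome_def by (simp add: exp_add)
qed

lemma nome_surj:
  assumes "E > 0" "norm q < 1" "q \<noteq> 0"
  obtains z where "nome E z = q" "Im z = - (E * ln (norm q) / pi)" "Im z > 0"
proof -
  define z where "z = - (\<i> * E * Ln q / pi)"
  have "nome E z = q"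
    using assms by (simp add: nome_def z_def field_simps)
  moreover have "Im z = - (E * ln (norm q) / pi)"
    using assms by (simp add: z_def)
  moreover have "ln (norm q) < 0"
    using assms by simp
  then have "- (E * ln (norm q) / pi) > 0"
    using assms(1) by (simp add: divide_less_0_iff mult_pos_neg)
  ultimately show ?thesis using that by metis
qed

text \<open>Schwarz's lemma of order \<open>n0\<close>: dividing by \<open>q ^ n0\<close> keeps the
  series holomorphic near the closed disc of radius \<open>r\<close>, and the maximum modulus
  principle applies to the quotient.\<close>

lemma norm_eval_fps_le_vanishing_order:
  fixes F :: "complex fps"
  assumes rad: "fps_conv_radius F \<ge> 1"
    and van: "\<And>n. n < n0 \<Longrightarrow> fps_nth F n = 0"
    and r: "norm q \<le> r" "0 < r" "r < 1"
    and bound: "\<And>x. norm x = r \<Longrightarrow> norm (eval_fps F x) \<le> C"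
  shows "norm (eval_fps F q) \<le> (norm q / r) ^ n0 * C"
proof -
  define H where "H = fps_shift n0 F"
  have Hrad: "fps_conv_radius H \<ge> 1" using rad by (simp add: H_def)
  have FH: "eval_fps F x = x ^ n0 * eval_fps H x" if "norm x < 1" for x
  proof -
    have "F = H * fps_X ^ n0"
      by (rule fps_ext) (auto simp: H_def fps_X_power_mult_right_nth van)
    moreover have "ereal (norm x) < fps_conv_radius H" "ereal (norm x) < \<infinity>"
      using that Hrad by (auto intro: less_le_trans[of _ 1])
    ultimately show ?thesis
      by (simp add: eval_fps_mult mult.commute)
  qed
  have sub: "cball (0::complex) r \<subseteq> eball 0 (fps_conv_radius H)"
  proof
    fix x :: complex assume "x \<in> cball 0 r"
    then have "norm x < 1" using r by (simp add: )
    then show "x \<in> eball 0 (fps_conv_radius H)"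
      using Hrad by (auto simp: in_eball_iff intro: less_le_trans[of _ 1])
  qed
  have Hr: "norm (eval_fps H x) \<le> C / r ^ n0" if "norm x = r" for x
  proof -
    have "r ^ n0 * norm (eval_fps H x) \<le> C"
      using bound[OF that] FH[of x] that r by (simp add: norm_mult norm_power)
    then show ?thesis using r by (simp add: field_simps)
  qed
  have "norm (eval_fps H q) \<le> C / r ^ n0"
  proof (rule maximum_modulus_frontier[of "eval_fps H" "cball 0 r" "C / r ^ n0" q])
    show "eval_fps H holomorphic_on interior (cball 0 r)"
      using sub by (intro holomorphic_intros) (auto)
    show "continuous_on (closure (cball 0 r)) (eval_fps H)"
      using sub by (intro continuous_intros) (auto)
    show "norm (eval_fps H z) \<le> C / r ^ n0" if "z \<in> frontier (cball 0 r)" for z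
      using that r Hr by (auto simp: frontier_cball)
  qed (use r in auto)
  then have "norm q ^ n0 * norm (eval_fps H q) \<le> norm q ^ n0 * (C / r ^ n0)"
    by (intro mult_left_mono) auto
  then show ?thesis
    using FH[of q] r by (simp add: norm_mult norm_power power_divide field_simps)
qed

text \<open>A weak form of the valence formula: the quantity \<open>|F|\<^sup>2 (Im z)\<^sup>K\<close> is carried around by the
  modular group, and vanishing at the cusps makes its supremum contract.\<close>

theorem modular_family_vanishes:
  fixes F :: "bool list \<Rightarrow> complex fps"
  assumes E: "E > 0"
    and rad: "\<And>w. fps_conv_radius (F w) \<ge> 1"
    and T: "\<And>w z. Im z > 0 \<Longrightarrow> eval_fps (F w) (nome E (z + 1)) = eval_fps (F (True # w)) (nome E z)"
    and S: "\<And>w z. Im z > 0 \<Longrightarrow>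
      eval_fps (F w) (nome E (- 1 / z)) = (- \<i> * z) ^ K * eval_fps (F (False # w)) (nome E z)"
    and bdd: "\<And>w z. Im z \<ge> 1 / 2 \<Longrightarrow> norm (eval_fps (F w) (nome E z)) \<le> C"
    and van: "\<And>w n. n < E * K \<Longrightarrow> fps_nth (F w) n = 0"
    and K: "K > 0"
    and q: "norm q < 1" "q \<noteq> 0"
  shows "eval_fps (F w) q = 0"
proof -
  define \<Psi> where "\<Psi> w z = (norm (eval_fps (F w) (nome E z)))\<^sup>2 * Im z ^ K" for w z
  have \<Psi>0: "\<Psi> w z \<ge> 0" if "Im z > 0" for w z using that by (simp add: \<Psi>_def)
  \<comment> \<open>Height \<open>y\<close> corresponds to a nome of norm
    \<open>exp (- (pi * y / E))\<close>, so a zero of order \<open>E * K\<close> gains exactly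
    \<open>exp (- pi * K * (Im z - y))\<close> before squaring; the level cancels.\<close>
  have contract: "(norm (eval_fps (F w) (nome E z)))\<^sup>2 \<le> exp (- 2 * pi * K * (Im z - y)) * B"
    if z: "0 < y" "y \<le> Im z" and B: "\<And>x. Im x = y \<Longrightarrow> (norm (eval_fps (F w) (nome E x)))\<^sup>2 \<le> B" for w z y B
  proof -
    define r where "r = exp (- (pi * y / E))"
    have "norm (eval_fps (F w) (nome E z)) \<le> (norm (nome E z) / r) ^ (E * K) * sqrt B"
    proof (rule norm_eval_fps_le_vanishing_order[OF rad van])
      show "norm (nome E z) \<le> r" unfolding norm_nome r_def using z E by (simp add: divide_right_mono)
      show "norm (eval_fps (F w) x) \<le> sqrt B" if x: "norm x = r" for x
      proof -
        have "norm x < 1" "x \<noteq> 0" using x z E by (auto simp: r_def)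
        then obtain v where v: "nome E v = x" "Im v = - (E * ln (norm x) / pi)" using nome_surj[OF E] by metis
        have "Im v = y" using v(2) x E by (simp add: r_def)
        with B[of v] v(1) show ?thesis by (metis real_le_rsqrt)
      qed
    qed (use z E in \<open>auto simp: r_def\<close>)
    then have "(norm (eval_fps (F w) (nome E z)))\<^sup>2 \<le> ((norm (nome E z) / r) ^ (E * K) * sqrt B)\<^sup>2"
      by (rule power_mono) auto
    also have "\<dots> = ((norm (nome E z) / r) ^ (E * K))\<^sup>2 * B"
    proof -
      have "B \<ge> 0" using B[of "Complex 0 y"] by (simp add: order_trans[OF zero_le_power2])
      then show ?thesis by (simp add: power_mult_distrib)
    qed
    also have "((norm (nome E z) / r) ^ (E * K))\<^sup>2 = exp (- 2 * pi * K * (Im z - y))"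
      unfolding norm_nome r_def exp_diff[symmetric] power_mult[symmetric] exp_of_nat_mult[symmetric]
      using E by (simp add: field_simps)
    finally show ?thesis .
  qed
  have shift: "eval_fps (F w) (nome E (z + of_nat n)) = eval_fps (F (replicate n True @ w)) (nome E z)"
    if "Im z > 0" for w z n
    using that
  proof (induction n arbitrary: w)
    case (Suc n)
    have "eval_fps (F w) (nome E (z + of_nat (Suc n))) = eval_fps (F w) (nome E ((z + of_nat n) + 1))"
      by (simp add: algebra_simps)
    also have "\<dots> = eval_fps (F (True # w)) (nome E (z + of_nat n))"
      using T[of "z + of_nat n" w] Suc.prems by simp
    also have "\<dots> = eval_fps (F (replicate n True @ True # w)) (nome E z)"
      using Suc.IH[OF Suc.prems] by simp
    finally show ?case by (simp add: replicate_app_Cons_same)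
  qed simp
  \<comment> \<open>Each round translates into the strip around the imaginary axis and inverts.
    Below height 1/2 both coordinates are at most 1/2, the squared norm is at most 1/2, and
    inversion at least doubles the height; hence the induction over powers of 2.\<close>
  have move: "\<exists>w' z'. Im z' \<ge> 1 / 2 \<and> \<Psi> w z = \<Psi> w' z'" if "Im z > 0" "Im z \<ge> 1 / 2 / 2 ^ m" for w z m
    using that
  proof (induction m arbitrary: w z)
    case 0
    then show ?case by auto
  next
    case (Suc m)
    show ?case
    proof (cases "Im z \<ge> 1 / 2")
      case False
      define k where "k = \<lfloor>Re z + 1 / 2\<rfloor>"
      \<comment> \<open>Words contain only translations by \<open>+ 1\<close>, so a negative
        \<open>k\<close> is made nonnegative modulo the period \<open>2 * E\<close>.\<close>
      obtain n :: nat where n: "\<exists>l. int n = k + 2 * int E * l"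
      proof -
        have "0 \<le> k + 2 * int E * \<bar>k\<bar>"
        proof -
          have "\<bar>k\<bar> * 1 \<le> \<bar>k\<bar> * (2 * int E)" using E by (intro mult_left_mono) auto
          then show ?thesis by (simp add: algebra_simps)
        qed
        then show ?thesis using that[of "nat (k + 2 * int E * \<bar>k\<bar>)"] by auto
      qed
      then obtain l where l: "int n = k + 2 * int E * l" by blast
      define z1 where "z1 = z - of_int k"
      have "of_int k \<le> Re z + 1 / 2" "Re z + 1 / 2 < of_int k + 1"
        unfolding k_def by linarith+
      then have "\<bar>Re z - of_int k\<bar> \<le> 1 / 2" by arith
      then have z1: "Im z1 = Im z" "\<bar>Re z1\<bar> \<le> 1 / 2"
        by (simp_all add: z1_def)
      have "eval_fps (F w) (nome E z) = eval_fps (F w) (nome E (z + of_int (2 * int E * l)))"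
        by (rule arg_cong[where f = "eval_fps (F w)", OF nome_periodic[OF E, of z l, symmetric]])
      also have "z + of_int (2 * int E * l) = z1 + of_nat n"
      proof -
        have "(of_nat n :: complex) = of_int (k + 2 * int E * l)" unfolding l[symmetric] by simp
        then show ?thesis by (simp add: z1_def)
      qed
      also have "eval_fps (F w) (nome E (z1 + of_nat n)) = eval_fps (F (replicate n True @ w)) (nome E z1)"
        using shift Suc.prems z1 by simp
      finally have eq1: "\<Psi> w z = \<Psi> (replicate n True @ w) z1" by (simp add: \<Psi>_def z1)
      define z2 where "z2 = - 1 / z1"
      have z1n: "z1 \<noteq> 0" using z1 Suc.prems by auto
      have norm1: "(norm z1)\<^sup>2 \<le> 1 / 2"
      proof -
        have "(Re z1)\<^sup>2 \<le> (1/2)\<^sup>2" using z1 by (simp add: abs_le_square_iff[symmetric])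
        moreover have "(Im z1)\<^sup>2 \<le> (1/2)\<^sup>2" using z1 False Suc.prems by (intro power_mono) auto
        ultimately show ?thesis unfolding cmod_power2 by (simp add: power_divide)
      qed
      have Im2: "Im z2 = Im z1 / (norm z1)\<^sup>2"
        unfolding z2_def by (simp add: Im_divide cmod_power2)
      have pos1: "(norm z1)\<^sup>2 > 0" using z1n by simp
      have Im2ge: "Im z2 \<ge> 2 * Im z1"
      proof -
        have "2 * Im z1 * (norm z1)\<^sup>2 \<le> 2 * Im z1 * (1 / 2)"
          using norm1 z1 Suc.prems by (intro mult_left_mono) auto
        then show ?thesis unfolding Im2 using pos1 by (simp add: field_simps)
      qed
      have zz: "z1 = - 1 / z2" using z1n by (simp add: z2_def)
      have Im2p: "Im z2 > 0" using Im2ge z1 Suc.prems by linarith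
      have "\<Psi> (replicate n True @ w) z1 = \<Psi> (False # replicate n True @ w) z2"
      proof -
        have "norm (eval_fps (F (replicate n True @ w)) (nome E z1))
            = norm z2 ^ K * norm (eval_fps (F (False # replicate n True @ w)) (nome E z2))"
          using S[OF Im2p, of "replicate n True @ w"] zz by (simp add: norm_mult norm_power)
        moreover have "Im z1 = Im z2 / (norm z2)\<^sup>2"
          unfolding Im2 using z1n by (simp add: z2_def norm_divide power_divide)
        moreover have "norm z2 \<noteq> 0" using Im2p by auto
        ultimately show ?thesis unfolding \<Psi>_def
          by (simp add: power_mult_distrib power_divide power_mult[symmetric] mult.commute)
      qed
      moreover have "1 / 2 / 2 ^ m \<le> Im z2"
      proof -
        have "1 / 2 / 2 ^ m = 2 * (1 / 2 / 2 ^ Suc m :: real)" by simp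
        then show ?thesis using Suc.prems(2) Im2ge z1 by linarith
      qed
      ultimately show ?thesis using Suc.IH[OF Im2p, of "False # replicate n True @ w"] eq1 by metis
    qed auto
  qed
  have move': "\<exists>w' z'. Im z' \<ge> 1 / 2 \<and> \<Psi> w z = \<Psi> w' z'" if Im: "Im z > 0" for w z
  proof -
    obtain m where "(1 / 2) ^ m < Im z" using real_arch_pow_inv[OF Im, of "1/2"] by auto
    moreover have "1 / 2 / 2 ^ m \<le> (1 / 2 :: real) ^ m" by (simp add: power_divide frac_le)
    ultimately show ?thesis using move[OF Im] by (meson less_imp_le order_trans)
  qed
  \<comment> \<open>Compares the heights \<open>Im z\<close> and \<open>Im z / 2\<close>: the factor
    \<open>Im z ^ K\<close> costs \<open>2 ^ K\<close>, and the zero at the cusp gains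
    \<open>exp (- pi * K * Im z)\<close>, which is at most \<open>exp (- pi * K / 2)\<close>
    here.\<close>
  have step: "\<Psi> w z \<le> (2 ^ K * exp (- pi * K / 2)) * B"
    if B: "\<And>w z. Im z > 0 \<Longrightarrow> \<Psi> w z \<le> B" and z: "Im z \<ge> 1 / 2" for w z B
  proof -
    define y where "y = Im z / 2"
    have y: "y > 0" "y \<le> Im z" using z by (auto simp: y_def)
    have B0: "B \<ge> 0" using B[of z w] \<Psi>0[of z w] z by simp
    have "(norm (eval_fps (F w) (nome E z)))\<^sup>2 \<le> exp (- 2 * pi * K * (Im z - y)) * (B / y ^ K)"
    proof (rule contract[OF y])
      show "(norm (eval_fps (F w) (nome E x)))\<^sup>2 \<le> B / y ^ K" if "Im x = y" for x
        using B[of x w] that y by (simp add: \<Psi>_def field_simps)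
    qed
    then have "\<Psi> w z \<le> exp (- 2 * pi * K * (Im z - y)) * (B / y ^ K) * Im z ^ K"
      unfolding \<Psi>_def using z by (intro mult_right_mono) auto
    also have "\<dots> = 2 ^ K * exp (- 2 * pi * K * (Im z - y)) * B"
      using z by (simp add: y_def power_divide field_simps)
    also have "\<dots> \<le> 2 ^ K * exp (- pi * K / 2) * B"
    proof -
      have "pi * K * (1/2) \<le> pi * K * Im z" using z by (intro mult_left_mono) auto
      then have "- 2 * pi * K * (Im z - y) \<le> - pi * K / 2" by (simp add: y_def algebra_simps)
      then show ?thesis using B0 by (intro mult_right_mono mult_left_mono) auto
    qed
    finally show ?thesis .
  qed
  \<comment> \<open>A first crude bound, so that the supremum below is finite: above height 1/2 the
    exponential decay beats \<open>Im z ^ K\<close>.\<close>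
  have bound0: "\<exists>B. \<forall>w z. Im z > 0 \<longrightarrow> \<Psi> w z \<le> B"
  proof -
    have C0: "C \<ge> 0" using bdd[of "\<i>" "[]"] by (auto intro: order_trans[OF norm_ge_zero])
    have "\<Psi> w z \<le> (exp (pi * K) * C\<^sup>2)" if z: "Im z \<ge> 1 / 2" for w z
    proof -
      have "(norm (eval_fps (F w) (nome E z)))\<^sup>2 \<le> exp (- 2 * pi * K * (Im z - 1 / 2)) * C\<^sup>2"
        by (rule contract) (use z in \<open>auto intro!: power_mono bdd\<close>)
      then have "\<Psi> w z \<le> exp (- 2 * pi * K * (Im z - 1 / 2)) * C\<^sup>2 * Im z ^ K"
        unfolding \<Psi>_def using z by (intro mult_right_mono) auto
      also have "\<dots> \<le> exp (- 2 * pi * K * (Im z - 1 / 2)) * C\<^sup>2 * exp (Im z) ^ K"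
      proof -
        have "Im z \<le> exp (Im z)" using exp_ge_add_one_self[of "Im z"] by linarith
        then show ?thesis using z by (intro mult_left_mono power_mono) auto
      qed
      also have "\<dots> = exp (pi * K + (1 - 2 * pi) * (K * Im z)) * C\<^sup>2"
        by (simp add: exp_of_nat_mult[symmetric] exp_add[symmetric] algebra_simps)
      also have "\<dots> \<le> exp (pi * K) * C\<^sup>2"
      proof -
        have "1 - 2 * pi \<le> 0" using pi_gt3 by simp
        then have "(1 - 2 * pi) * (K * Im z) \<le> 0" using z by (intro mult_nonpos_nonneg) auto
        then show ?thesis by (intro mult_right_mono) auto
      qed
      finally show ?thesis .
    qed
    then show ?thesis using move' by metis
  qed
  define M where "M = (SUP p\<in>{p. Im (snd p) > 0}. \<Psi> (fst p) (snd p))"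
  have ne: "{p. Im (snd p) > 0} \<noteq> ({} :: (bool list \<times> complex) set)"
    by (auto intro!: exI[of _ "\<i>"])
  have bdda: "bdd_above ((\<lambda>p. \<Psi> (fst p) (snd p)) ` {p. Im (snd p) > 0})"
    using bound0 by (auto simp: bdd_above_def)
  have le_M: "\<Psi> w z \<le> M" if "Im z > 0" for w z
    unfolding M_def using cSUP_upper[OF _ bdda, of "(w, z)"] that by simp
  define \<kappa> where "\<kappa> = 2 ^ K * exp (- pi * K / 2)"
  have "\<Psi> w z \<le> \<kappa> * M" if "Im z > 0" for w z
    using move'[OF that, of w] step[of M] le_M unfolding \<kappa>_def by metis
  then have "M \<le> \<kappa> * M"
    unfolding M_def by (intro cSUP_least[OF ne]) auto
  \<comment> \<open>The number is the \<open>K\<close>-th power of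
    \<open>2 * exp (- pi / 2)\<close>, which is about 0.42. So \<open>E * K\<close> zeros suffice
    for a strict contraction.\<close>
  moreover have "\<kappa> < 1"
  proof -
    have "(2::real) < exp 1 powr (3/2)"
    proof -
      have "(2::real) < 1 + 1 + 1/2" by simp
      also have "\<dots> \<le> exp 1" using exp_lower_Taylor_quadratic[of 1] by simp
      also have "\<dots> \<le> exp 1 powr (3/2)" by (simp add: powr_def)
      finally show ?thesis .
    qed
    also have "exp 1 powr (3/2) \<le> exp (pi / 2)" using pi_gt3 by (simp add: powr_def)
    finally have "0 \<le> 2 * exp (- pi / 2)" "2 * exp (- pi / 2) < (1::real)" by (simp_all add: exp_minus field_simps)
    then have "(2 * exp (- pi / 2)) ^ K < (1::real)"
      using K power_less_one_iff by blast
    also have "(2 * exp (- pi / 2)) ^ K = \<kappa>"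
      unfolding \<kappa>_def by (simp add: power_mult_distrib exp_of_nat_mult[symmetric] field_simps)
    finally show ?thesis .
  qed
  ultimately have "M \<le> 0"
    by (smt (verit) mult_le_cancel_right1 mult.commute)
  obtain z where z: "nome E z = q" "Im z > 0" using nome_surj[OF E q] by metis
  have "\<Psi> w z = 0" using le_M[OF z(2), of w] \<open>M \<le> 0\<close> \<Psi>0[OF z(2), of w] by linarith
  then show ?thesis using z by (simp add: \<Psi>_def)
qed

subsection \<open>The Weil representation\<close>

definition unity :: "real \<Rightarrow> complex" where
  "unity x = cis (2 * pi * x)"

lemma unity_add: "unity (x + y) = unity x * unity y"
  by (simp add: unity_def cis_mult distrib_left)

lemma unity_0 [simp]: "unity 0 = 1"
  by (simp add: unity_def)

lemma norm_unity [simp]: "norm (unity x) = 1"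
  by (simp add: unity_def)

lemma cnj_unity: "cnj (unity x) = unity (- x)"
  by (simp add: unity_def cis_cnj)

lemma unity_of_int [simp]: "unity (of_int n) = 1"
  using cis_multiple_2pi[of "of_int n"] by (simp add: unity_def mult.commute mult.left_commute)

lemma unity_eq_1_iff: "unity x = 1 \<longleftrightarrow> x \<in> \<int>"
proof
  assume "unity x = 1"
  then have "cos (2 * pi * x) = 1" by (simp add: unity_def complex_eq_iff)
  then obtain n :: int where "2 * pi * x = of_int n * 2 * pi" using cos_one_2pi_int by auto
  then have "x = of_int n" by simp
  then show "x \<in> \<int>" by simp
qed (auto elim!: Ints_cases)

lemma unity_eq: "x - y \<in> \<int> \<Longrightarrow> unity x = unity y"
  using unity_add[of "x - y" y] unity_eq_1_iff[of "x - y"] by simp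

lemma unity_power: "unity x ^ n = unity (of_nat n * x)"
  by (induction n) (simp_all add: unity_add distrib_right)

lemma periodic_add_mult:
  fixes f :: "int \<Rightarrow> 'a"
  assumes "\<And>x. f (x + n) = f x"
  shows "f (x + n * k) = f x"
proof -
  have nat: "f (x + n * int k) = f x" for x k
    by (induction k) (simp_all add: algebra_simps, metis assms add.assoc add.commute)
  show ?thesis
  proof (cases "k \<ge> 0")
    case True
    then show ?thesis using nat[of x "nat k"] by simp
  next
    case False
    then show ?thesis using nat[of "x + n * k" "nat (- k)"] by (simp add: algebra_simps)
  qed
qed

lemma periodic_mod:
  fixes f :: "int \<Rightarrow> 'a"
  assumes "\<And>x. f (x + n) = f x"
  shows "f (x mod n) = f x"
  using periodic_add_mult[of f n "x mod n" "x div n"] assms by simp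

lemma sum_periodic_shift:
  fixes f :: "int \<Rightarrow> 'a :: comm_monoid_add"
  assumes "n > 0" "\<And>x. f (x + n) = f x"
  shows "(\<Sum>x\<in>{0..<n}. f (x + a)) = (\<Sum>x\<in>{0..<n}. f x)"
proof (rule sum.reindex_bij_witness[of _ "\<lambda>x. (x - a) mod n" "\<lambda>x. (x + a) mod n"])
  fix x assume "x \<in> {0..<n}"
  then show "((x + a) mod n - a) mod n = x" "((x - a) mod n + a) mod n = x"
    by (simp_all add: mod_simps)
qed (use assms(1) periodic_mod[of f n, OF assms(2)] in auto)

lemma sum_unity_eq:
  fixes n k :: int
  assumes "n > 0"
  shows "(\<Sum>x\<in>{0..<n}. unity (of_int x * of_int k / of_int n)) = (if n dvd k then of_int n else 0)"
proof (cases "n dvd k")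
  case True
  then obtain l where "k = n * l" by blast
  then have "unity (of_int x * of_int k / of_int n) = 1" for x
    using assms unity_of_int[of "x * l"] by simp
  then show ?thesis using True assms by simp
next
  case False
  let ?f = "\<lambda>x :: int. unity (of_int x * of_int k / of_int n)"
  have per: "?f (x + n) = ?f x" for x
    by (rule unity_eq) (use assms in \<open>simp add: field_simps\<close>)
  have "(\<Sum>x\<in>{0..<n}. ?f x) = (\<Sum>x\<in>{0..<n}. ?f (x + 1))"
    using sum_periodic_shift[of n ?f 1, OF assms per] by simp
  also have "\<dots> = (\<Sum>x\<in>{0..<n}. ?f x) * unity (of_int k / of_int n)"
    unfolding sum_distrib_right
    by (intro sum.cong) (simp_all add: unity_add[symmetric] add_divide_distrib distrib_right)
  finally have "(\<Sum>x\<in>{0..<n}. ?f x) * (unity (of_int k / of_int n) - 1) = 0"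
    by (simp add: algebra_simps)
  moreover have "unity (of_int k / of_int n) \<noteq> 1"
  proof
    assume "unity (of_int k / of_int n) = 1"
    then obtain l where "of_int k / of_int n = (of_int l :: real)"
      unfolding unity_eq_1_iff by (auto elim: Ints_cases)
    then have "of_int k = (of_int (n * l) :: real)" using assms by (simp add: field_simps)
    then show False using False by (simp only: of_int_eq_iff) simp
  qed
  ultimately show ?thesis using False by simp
qed

text \<open>With q the nome of \<open>z\<close>, the level conditions say that the power of q with
  exponent \<alpha> x^2 + \<beta> y^2 is exp (pi i z (x^2 / L1 + y^2 / L2)). Evenness makes x^2 / (2
  L1) and y^2 / (2 L2) well defined modulo 1 on residue classes, so that translation by 1 acts on
  periodic coefficients.\<close>

locale binary_theta =
  fixes \<alpha> \<beta> L1 L2 E :: nat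
  assumes L1_pos: "L1 > 0" and L2_pos: "L2 > 0" and \<alpha>_pos: "\<alpha> > 0" and \<beta>_pos: "\<beta> > 0"
    and level1: "\<alpha> * L1 = E" and level2: "\<beta> * L2 = E"
    and L1_even: "even L1" and L2_even: "even L2"
begin

definition per :: "(int \<Rightarrow> int \<Rightarrow> complex) \<Rightarrow> bool" where
  "per \<phi> \<longleftrightarrow> (\<forall>x y. \<phi> (x + int L1) y = \<phi> x y) \<and> (\<forall>x y. \<phi> x (y + int L2) = \<phi> x y)"

text \<open>The Weil representation on coefficient functions: \<open>opT\<close> and \<open>opS\<close> describe the theta series at
  \<open>z + 1\<close> and \<open>- 1 / z\<close>, and conjugating the Heisenberg operators \<open>heis\<close> by a word in them (\<open>True\<close> for
  \<open>opT\<close>, \<open>False\<close> for \<open>opS\<close>) is the matrix action \<open>mat_word\<close>.\<close>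

definition opT :: "(int \<Rightarrow> int \<Rightarrow> complex) \<Rightarrow> int \<Rightarrow> int \<Rightarrow> complex" where
  "opT \<phi> x y = unity (of_int x ^ 2 / (2 * L1) + of_int y ^ 2 / (2 * L2)) * \<phi> x y"

definition opS :: "(int \<Rightarrow> int \<Rightarrow> complex) \<Rightarrow> int \<Rightarrow> int \<Rightarrow> complex" where
  "opS \<phi> u v = (\<Sum>x\<in>{0..<int L1}. \<Sum>y\<in>{0..<int L2}.
     \<phi> x y * unity (- (of_int x * of_int u / L1) - of_int y * of_int v / L2)) / of_real (sqrt (L1 * L2))"

definition heis :: "int \<times> int \<Rightarrow> int \<times> int \<Rightarrow> (int \<Rightarrow> int \<Rightarrow> complex) \<Rightarrow> int \<Rightarrow> int \<Rightarrow> complex" where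
  "heis v1 v2 \<phi> x y =
     unity (of_int (fst v1 * snd v1) / (2 * L1) + of_int (fst v2 * snd v2) / (2 * L2)
       + of_int (snd v1 * x) / L1 + of_int (snd v2 * y) / L2) * \<phi> (x + fst v1) (y + fst v2)"

fun op_word :: "bool list \<Rightarrow> (int \<Rightarrow> int \<Rightarrow> complex) \<Rightarrow> int \<Rightarrow> int \<Rightarrow> complex" where
  "op_word [] \<phi> = \<phi>"
| "op_word (True # w) \<phi> = opT (op_word w \<phi>)"
| "op_word (False # w) \<phi> = opS (op_word w \<phi>)"

fun mat_word :: "bool list \<Rightarrow> int \<times> int \<Rightarrow> int \<times> int" where
  "mat_word [] v = v"
| "mat_word (True # w) v = (fst (mat_word w v), snd (mat_word w v) - fst (mat_word w v))"
| "mat_word (False # w) v = (- snd (mat_word w v), fst (mat_word w v))"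

lemma op_word_append: "op_word (w1 @ w2) \<phi> = op_word w1 (op_word w2 \<phi>)"
  by (induction w1 \<phi> rule: op_word.induct) auto

lemma mat_word_append: "mat_word (w1 @ w2) v = mat_word w1 (mat_word w2 v)"
  by (induction w1 v rule: mat_word.induct) auto

lemma perD: "per \<phi> \<Longrightarrow> \<phi> (x + int L1 * k) (y + int L2 * l) = \<phi> x y"
  using periodic_add_mult[of "\<lambda>x. \<phi> x (y + int L2 * l)" "int L1" x k]
    periodic_add_mult[of "\<lambda>y. \<phi> x y" "int L2" y l]
  by (simp add: per_def)

lemma per_opT: assumes "per \<phi>" shows "per (opT \<phi>)"
proof -
  obtain m1 m2 where m: "L1 = 2 * m1" "L2 = 2 * m2" using L1_even L2_even by (auto elim!: evenE)
  have 1: "unity (of_int (x + int L1) ^ 2 / (2 * L1) + of_int y ^ 2 / (2 * L2))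
      = unity (of_int x ^ 2 / (2 * L1) + of_int y ^ 2 / (2 * L2))" for x y
  proof (rule unity_eq)
    have "of_int (x + int L1) ^ 2 / (2 * L1) + of_int y ^ 2 / (2 * L2) -
      (of_int x ^ 2 / (2 * L1) + of_int y ^ 2 / (2 * L2)) = real_of_int (x + int m1)"
      using L1_pos by (simp add: m power2_eq_square field_simps)
    then show "of_int (x + int L1) ^ 2 / (2 * L1) + of_int y ^ 2 / (2 * L2) -
      (of_int x ^ 2 / (2 * L1) + of_int y ^ 2 / (2 * L2)) \<in> (\<int> :: real set)"
      by (metis Ints_of_int)
  qed
  have 2: "unity (of_int x ^ 2 / (2 * L1) + of_int (y + int L2) ^ 2 / (2 * L2))
      = unity (of_int x ^ 2 / (2 * L1) + of_int y ^ 2 / (2 * L2))" for x y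
  proof (rule unity_eq)
    have "of_int x ^ 2 / (2 * L1) + of_int (y + int L2) ^ 2 / (2 * L2) -
      (of_int x ^ 2 / (2 * L1) + of_int y ^ 2 / (2 * L2)) = real_of_int (y + int m2)"
      using L2_pos by (simp add: m power2_eq_square field_simps)
    then show "of_int x ^ 2 / (2 * L1) + of_int (y + int L2) ^ 2 / (2 * L2) -
      (of_int x ^ 2 / (2 * L1) + of_int y ^ 2 / (2 * L2)) \<in> (\<int> :: real set)"
      by (metis Ints_of_int)
  qed
  show ?thesis using assms 1 2 by (simp add: per_def opT_def)
qed

lemma per_opS: "per (opS \<phi>)"
proof -
  have 1: "unity (- (of_int x * of_int (u + int L1) / L1) - of_int y * of_int v / L2)
      = unity (- (of_int x * of_int u / L1) - of_int y * of_int v / L2)" for x y u v :: int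
    by (rule unity_eq) (use L1_pos in \<open>simp add: field_simps\<close>)
  have 2: "unity (- (of_int x * of_int u / L1) - of_int y * of_int (v + int L2) / L2)
      = unity (- (of_int x * of_int u / L1) - of_int y * of_int v / L2)" for x y u v :: int
    by (rule unity_eq) (use L2_pos in \<open>simp add: field_simps\<close>)
  show ?thesis unfolding per_def opS_def 1 2 by simp
qed

lemma per_op_word: "per \<phi> \<Longrightarrow> per (op_word w \<phi>)"
  by (induction w \<phi> rule: op_word.induct) (auto intro: per_opT per_opS)

text \<open>Completing the square. The symmetric phase \<open>a * b / (2 * L)\<close> built into
  \<open>heis\<close> absorbs the constant term, so that no scalar is left over; the same happens
  for \<open>opS\<close>.\<close>

lemma opT_heis:
  "opT (heis (a1, b1) (a2, b2) \<phi>) = heis (a1, b1 - a1) (a2, b2 - a2) (opT \<phi>)"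
proof (intro ext)
  fix x y
  have "of_int x ^ 2 / (2 * L1) + of_int y ^ 2 / (2 * L2) +
      (of_int (a1 * b1) / (2 * L1) + of_int (a2 * b2) / (2 * L2) + of_int (b1 * x) / L1 + of_int (b2 * y) / L2)
    = (of_int (a1 * (b1 - a1)) / (2 * L1) + of_int (a2 * (b2 - a2)) / (2 * L2)
      + of_int ((b1 - a1) * x) / L1 + of_int ((b2 - a2) * y) / L2)
      + (real_of_int (x + a1) ^ 2 / (2 * L1) + real_of_int (y + a2) ^ 2 / (2 * L2))"
    using L1_pos L2_pos by (simp add: power2_eq_square field_simps)
  then show "opT (heis (a1, b1) (a2, b2) \<phi>) x y = heis (a1, b1 - a1) (a2, b2 - a2) (opT \<phi>) x y"
    unfolding opT_def heis_def fst_conv snd_conv mult.assoc[symmetric] unity_add[symmetric] by simp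
qed

text \<open>The Fourier transform exchanges translations and modulations: the summation variables
  are shifted by \<open>a1\<close> and \<open>a2\<close>, and the shift reappears as a
  phase.\<close>

lemma opS_heis:
  assumes "per \<phi>"
  shows "opS (heis (a1, b1) (a2, b2) \<phi>) = heis (- b1, a1) (- b2, a2) (opS \<phi>)"
proof (intro ext)
  fix u v
  define f where "f x y = unity (of_int (a1 * b1) / (2 * L1) + of_int (a2 * b2) / (2 * L2)
      + of_int ((b1 - u) * (x - a1)) / L1 + of_int ((b2 - v) * (y - a2)) / L2) * \<phi> x y" for x y
  have f1: "f (x + int L1) y = f x y" for x y
  proof (unfold f_def, intro arg_cong2[of _ _ _ _ "(*)"] unity_eq)
    have "of_int (a1 * b1) / (2 * L1) + of_int (a2 * b2) / (2 * L2)
        + of_int ((b1 - u) * (x + int L1 - a1)) / L1 + of_int ((b2 - v) * (y - a2)) / L2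
      - (of_int (a1 * b1) / (2 * L1) + of_int (a2 * b2) / (2 * L2)
        + of_int ((b1 - u) * (x - a1)) / L1 + of_int ((b2 - v) * (y - a2)) / L2) = real_of_int (b1 - u)"
      using L1_pos by (simp add: add_divide_distrib diff_divide_distrib ring_distribs)
    then show "of_int (a1 * b1) / (2 * L1) + of_int (a2 * b2) / (2 * L2)
        + of_int ((b1 - u) * (x + int L1 - a1)) / L1 + of_int ((b2 - v) * (y - a2)) / L2
      - (of_int (a1 * b1) / (2 * L1) + of_int (a2 * b2) / (2 * L2)
        + of_int ((b1 - u) * (x - a1)) / L1 + of_int ((b2 - v) * (y - a2)) / L2) \<in> (\<int> :: real set)"
      by (metis Ints_of_int)
  qed (use assms in \<open>simp_all add: per_def\<close>)
  have f2: "f x (y + int L2) = f x y" for x y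
  proof (unfold f_def, intro arg_cong2[of _ _ _ _ "(*)"] unity_eq)
    have "of_int (a1 * b1) / (2 * L1) + of_int (a2 * b2) / (2 * L2)
        + of_int ((b1 - u) * (x - a1)) / L1 + of_int ((b2 - v) * (y + int L2 - a2)) / L2
      - (of_int (a1 * b1) / (2 * L1) + of_int (a2 * b2) / (2 * L2)
        + of_int ((b1 - u) * (x - a1)) / L1 + of_int ((b2 - v) * (y - a2)) / L2) = real_of_int (b2 - v)"
      using L2_pos by (simp add: add_divide_distrib diff_divide_distrib ring_distribs)
    then show "of_int (a1 * b1) / (2 * L1) + of_int (a2 * b2) / (2 * L2)
        + of_int ((b1 - u) * (x - a1)) / L1 + of_int ((b2 - v) * (y + int L2 - a2)) / L2
      - (of_int (a1 * b1) / (2 * L1) + of_int (a2 * b2) / (2 * L2)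
        + of_int ((b1 - u) * (x - a1)) / L1 + of_int ((b2 - v) * (y - a2)) / L2) \<in> (\<int> :: real set)"
      by (metis Ints_of_int)
  qed (use assms in \<open>simp_all add: per_def\<close>)
  have "opS (heis (a1, b1) (a2, b2) \<phi>) u v =
      (\<Sum>x\<in>{0..<int L1}. \<Sum>y\<in>{0..<int L2}. f (x + a1) (y + a2)) / of_real (sqrt (L1 * L2))"
  proof -
    have "heis (a1, b1) (a2, b2) \<phi> x y * unity (- (of_int x * of_int u / L1) - of_int y * of_int v / L2)
      = f (x + a1) (y + a2)" for x y
    proof -
      have "(of_int (a1 * b1) / (2 * L1) + of_int (a2 * b2) / (2 * L2) + of_int (b1 * x) / L1 + of_int (b2 * y) / L2)
        + (- (of_int x * of_int u / L1) - of_int y * of_int v / L2) =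
        of_int (a1 * b1) / (2 * L1) + of_int (a2 * b2) / (2 * L2)
      + of_int ((b1 - u) * (x + a1 - a1)) / L1 + real_of_int ((b2 - v) * (y + a2 - a2)) / L2"
        using L1_pos L2_pos by (simp add: field_simps)
      then show ?thesis
        unfolding heis_def f_def fst_conv snd_conv mult.commute[of _ "\<phi> _ _"] mult.assoc unity_add[symmetric] by (simp only:)
    qed
    then show ?thesis unfolding opS_def by simp
  qed
  also have "(\<Sum>x\<in>{0..<int L1}. \<Sum>y\<in>{0..<int L2}. f (x + a1) (y + a2))
      = (\<Sum>x\<in>{0..<int L1}. \<Sum>y\<in>{0..<int L2}. f (x + a1) y)"
    using L2_pos f2 by (intro sum.cong refl sum_periodic_shift) auto
  also have "\<dots> = (\<Sum>x\<in>{0..<int L1}. \<Sum>y\<in>{0..<int L2}. f x y)"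
    using L1_pos f1 by (intro sum_periodic_shift[of "int L1" "\<lambda>x. \<Sum>y\<in>{0..<int L2}. f x y"]) auto
  also have "\<dots> = unity (of_int (- b1 * a1) / (2 * L1) + of_int (- b2 * a2) / (2 * L2)
       + of_int (a1 * u) / L1 + of_int (a2 * v) / L2) * (\<Sum>x\<in>{0..<int L1}. \<Sum>y\<in>{0..<int L2}.
     \<phi> x y * unity (- (of_int x * of_int (u - b1) / L1) - of_int y * of_int (v - b2) / L2))"
    unfolding sum_distrib_left
  proof (intro sum.cong refl)
    fix x y
    have "of_int (a1 * b1) / (2 * L1) + of_int (a2 * b2) / (2 * L2)
      + of_int ((b1 - u) * (x - a1)) / L1 + of_int ((b2 - v) * (y - a2)) / L2
      = (of_int (- b1 * a1) / (2 * L1) + of_int (- b2 * a2) / (2 * L2)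
       + of_int (a1 * u) / L1 + of_int (a2 * v) / L2)
       + (- (of_int x * of_int (u - b1) / L1) - real_of_int y * of_int (v - b2) / L2)"
      using L1_pos L2_pos by (simp add: field_simps)
    then show "f x y = unity (of_int (- b1 * a1) / (2 * L1) + of_int (- b2 * a2) / (2 * L2)
       + of_int (a1 * u) / L1 + of_int (a2 * v) / L2) *
     (\<phi> x y * unity (- (of_int x * of_int (u - b1) / L1) - of_int y * of_int (v - b2) / L2))"
      unfolding f_def mult.left_commute[of _ "\<phi> x y"] unity_add[symmetric] by (simp only: mult.commute[of _ "\<phi> x y"])
  qed
  finally show "opS (heis (a1, b1) (a2, b2) \<phi>) u v = heis (- b1, a1) (- b2, a2) (opS \<phi>) u v"
    by (simp add: heis_def opS_def)
qed

text \<open>This intertwining is how the integer matrix of a word controls its operator, up to a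
  scalar.\<close>

lemma op_word_heis:
  assumes "per \<phi>"
  shows "op_word w (heis v1 v2 \<phi>) = heis (mat_word w v1) (mat_word w v2) (op_word w \<phi>)"
  using assms
proof (induction w \<phi> rule: op_word.induct)
  case (2 w \<phi>)
  then show ?case
    using opT_heis[of "fst (mat_word w v1)" "snd (mat_word w v1)" "fst (mat_word w v2)" "snd (mat_word w v2)"] by simp
next
  case (3 w \<phi>)
  then show ?case
    using opS_heis[of "op_word w \<phi>" "fst (mat_word w v1)" "snd (mat_word w v1)" "fst (mat_word w v2)" "snd (mat_word w v2)"]
    by (simp add: per_op_word)
qed simp

end

section \<open>The action of words up to scalars: inverses, Schur's lemma, unitarity\<close>

context binary_theta
begin

abbreviation "P \<equiv> 2 * int E"

lemma E_pos: "E > 0"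
  using level1 \<alpha>_pos L1_pos by auto

lemma P_pos: "P > 0"
  using E_pos by simp

lemma op_word_linear:
  "op_word w (\<lambda>x y. \<Sum>i\<in>I. k i * f i x y) = (\<lambda>x y. \<Sum>i\<in>I. k i * op_word w (f i) x y)"
proof (induction w)
  case (Cons b w)
  show ?case
  proof (cases b)
    case True
    then show ?thesis using Cons
      by (auto simp: opT_def sum_distrib_left mult.left_commute fun_eq_iff)
  next
    case False
    have "opS (\<lambda>x y. \<Sum>i\<in>I. k i * g i x y) u v = (\<Sum>i\<in>I. k i * opS (g i) u v)" for g u v
      unfolding opS_def sum_divide_distrib[symmetric] times_divide_eq_right
      by (simp add: sum_distrib_left sum_distrib_right sum.swap[of _ I] mult.assoc)
    then show ?thesis using Cons False by simp
  qed
qed simp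

lemma op_word_scale: "op_word w (\<lambda>x y. c * \<phi> x y) = (\<lambda>x y. c * op_word w \<phi> x y)"
  using op_word_linear[of w "\<lambda>_. c" "\<lambda>_. \<phi>" "{()}"] by simp

lemma sum_unity_minus:
  assumes "L > 0"
  shows "(\<Sum>u\<in>{0..<int L}. unity (- (of_int x * of_int u / real L) - of_int u * of_int p / real L))
    = (if int L dvd x + p then of_nat L else 0)"
proof -
  have "(\<Sum>u\<in>{0..<int L}. unity (- (of_int x * of_int u / real L) - of_int u * of_int p / real L))
      = (\<Sum>u\<in>{0..<int L}. unity (of_int u * of_int (- (x + p)) / of_int (int L)))"
    using assms by (intro sum.cong refl arg_cong[of _ _ unity]) (simp add: field_simps)
  also have "\<dots> = (if int L dvd x + p then of_nat L else 0)"
  proof -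
    have "int L > 0" using assms by simp
    then show ?thesis unfolding sum_unity_eq[OF \<open>int L > 0\<close>] dvd_minus_iff by simp
  qed
  finally show ?thesis .
qed

text \<open>Fourier inversion on the product of the two cyclic groups. Consequently
  \<open>opS\<close> applied four times is the identity on periodic functions, which later supplies
  its inverse as a word.\<close>

lemma opS_opS:
  assumes "per \<phi>"
  shows "opS (opS \<phi>) p q = \<phi> (- p) (- q)"
proof -
  let ?A = "{0..<int L1}" and ?B = "{0..<int L2}"
  have "(\<Sum>u\<in>?A. \<Sum>v\<in>?B. (\<Sum>x\<in>?A. \<Sum>y\<in>?B.
      \<phi> x y * unity (- (of_int x * of_int u / L1) - of_int y * of_int v / L2)) *
      unity (- (of_int u * of_int p / L1) - of_int v * of_int q / L2))
    = (\<Sum>u\<in>?A. \<Sum>v\<in>?B. \<Sum>x\<in>?A. \<Sum>y\<in>?B. \<phi> x y *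
       (unity (- (of_int x * of_int u / L1) - of_int u * of_int p / L1) *
        unity (- (of_int y * of_int v / L2) - of_int v * of_int q / L2)))"
    unfolding sum_distrib_right
    by (intro sum.cong refl) (simp add: mult.assoc unity_add[symmetric] algebra_simps)
  also have "\<dots> = (\<Sum>x\<in>?A. \<Sum>y\<in>?B. \<Sum>u\<in>?A. \<Sum>v\<in>?B. \<phi> x y *
       (unity (- (of_int x * of_int u / L1) - of_int u * of_int p / L1) *
        unity (- (of_int y * of_int v / L2) - of_int v * of_int q / L2)))"
  proof -
    have sw: "(\<Sum>u\<in>?A. \<Sum>v\<in>?B. \<Sum>x\<in>?A. \<Sum>y\<in>?B. f u v x y) = (\<Sum>x\<in>?A. \<Sum>y\<in>?B. \<Sum>u\<in>?A. \<Sum>v\<in>?B. f u v x y)"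
      for f :: "int \<Rightarrow> int \<Rightarrow> int \<Rightarrow> int \<Rightarrow> complex"
    proof -
      have cart: "(\<Sum>u\<in>?A. \<Sum>v\<in>?B. g u v) = (\<Sum>i\<in>?A\<times>?B. g (fst i) (snd i))" for g :: "int \<Rightarrow> int \<Rightarrow> complex"
        by (simp add: sum.cartesian_product split_def)
      show ?thesis unfolding cart by (rule sum.swap)
    qed
    show ?thesis by (rule sw)
  qed
  also have "\<dots> = (\<Sum>x\<in>?A. \<Sum>y\<in>?B. \<phi> x y *
       ((\<Sum>u\<in>?A. unity (- (of_int x * of_int u / L1) - of_int u * of_int p / L1)) *
        (\<Sum>v\<in>?B. unity (- (of_int y * of_int v / L2) - of_int v * of_int q / L2))))"
    unfolding sum_product unfolding sum_distrib_left ..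
  also have "\<dots> = (\<Sum>x\<in>?A. \<Sum>y\<in>?B. \<phi> x y *
       ((if int L1 dvd x + p then of_nat L1 else 0) * (if int L2 dvd y + q then of_nat L2 else 0)))"
    using L1_pos L2_pos by (simp only: sum_unity_minus)
  also have "\<dots> = (\<Sum>x\<in>?A. \<Sum>y\<in>?B. if x = (- p) mod int L1 then if y = (- q) mod int L2
      then \<phi> x y * (of_nat L1 * of_nat L2) else 0 else 0)"
  proof (intro sum.cong refl)
    fix x y assume xy: "x \<in> ?A" "y \<in> ?B"
    have dv: "int L dvd x + p \<longleftrightarrow> x = (- p) mod int L" if "x \<in> {0..<int L}" for L x p
    proof -
      have "int L dvd x + p \<longleftrightarrow> x mod int L = (- p) mod int L"
        by (simp add: mod_eq_dvd_iff)
      then show ?thesis using that by simp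
    qed
    show "\<phi> x y * ((if int L1 dvd x + p then of_nat L1 else 0) * (if int L2 dvd y + q then of_nat L2 else 0))
      = (if x = (- p) mod int L1 then if y = (- q) mod int L2
      then \<phi> x y * (of_nat L1 * of_nat L2) else 0 else 0)"
      using dv[OF xy(1)] dv[OF xy(2)] by simp
  qed
  also have "\<dots> = \<phi> ((- p) mod int L1) ((- q) mod int L2) * (of_nat L1 * of_nat L2)"
  proof -
    have "(\<Sum>x\<in>?A. \<Sum>y\<in>?B. if x = (- p) mod int L1 then if y = (- q) mod int L2
      then \<phi> x y * (of_nat L1 * of_nat L2) else 0 else 0)
      = (\<Sum>x\<in>?A. if x = (- p) mod int L1 then \<Sum>y\<in>?B. if y = (- q) mod int L2
      then \<phi> x y * (of_nat L1 * of_nat L2) else 0 else 0)"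
      by (intro sum.cong) auto
    then show ?thesis using L1_pos L2_pos by (simp add: sum.delta)
  qed
  also have "\<phi> ((- p) mod int L1) ((- q) mod int L2) = \<phi> (- p) (- q)"
    using perD[OF assms, of "(- p) mod int L1" "(- p) div int L1" "(- q) mod int L2" "(- q) div int L2"]
    by simp
  finally have eq: "(\<Sum>u\<in>?A. \<Sum>v\<in>?B. (\<Sum>x\<in>?A. \<Sum>y\<in>?B.
      \<phi> x y * unity (- (of_int x * of_int u / L1) - of_int y * of_int v / L2)) *
      unity (- (of_int u * of_int p / L1) - of_int v * of_int q / L2))
      = \<phi> (- p) (- q) * (of_nat L1 * of_nat L2)" .
  have sq: "complex_of_real (sqrt (L1 * L2)) * of_real (sqrt (L1 * L2)) = of_nat L1 * of_nat L2"
  proof -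
    have "sqrt (L1 * L2) * sqrt (L1 * L2) = real L1 * real L2" by simp
    then show ?thesis by (simp only: of_real_mult[symmetric]) simp
  qed
  have "opS (opS \<phi>) p q = (\<Sum>u\<in>?A. \<Sum>v\<in>?B. (\<Sum>x\<in>?A. \<Sum>y\<in>?B.
      \<phi> x y * unity (- (of_int x * of_int u / L1) - of_int y * of_int v / L2)) *
      unity (- (of_int u * of_int p / L1) - of_int v * of_int q / L2))
      / (of_real (sqrt (L1 * L2)) * of_real (sqrt (L1 * L2)))"
    unfolding opS_def times_divide_eq_left sum_divide_distrib[symmetric] divide_divide_eq_left ..
  also have "\<dots> = \<phi> (- p) (- q)"
    unfolding eq sq using L1_pos L2_pos by simp
  finally show ?thesis .
qed

lemma mat_word_cong:
  assumes "[fst u = fst v] (mod P)" "[snd u = snd v] (mod P)"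
  shows "[fst (mat_word w u) = fst (mat_word w v)] (mod P)" "[snd (mat_word w u) = snd (mat_word w v)] (mod P)"
proof -
  have "[fst (mat_word w u) = fst (mat_word w v)] (mod P) \<and> [snd (mat_word w u) = snd (mat_word w v)] (mod P)"
  proof (induction w)
    case (Cons b w)
    then show ?case by (cases b) (simp_all add: cong_diff cong_minus_minus_iff)
  qed (simp add: assms)
  then show "[fst (mat_word w u) = fst (mat_word w v)] (mod P)" "[snd (mat_word w u) = snd (mat_word w v)] (mod P)"
    by auto
qed

text \<open>Words only form a monoid, so inverses come from finite order: three letters
  \<open>False\<close> invert one, and \<open>2 * E - 1\<close> letters \<open>True\<close> invert
  one. The operator of \<open>2 * E\<close> letters \<open>True\<close> is the identity, whereas its
  matrix is the identity only modulo \<open>P\<close>; hence the congruences for matrices beside the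
  equations for operators.\<close>

lemma word_inverse:
  "\<exists>w'. (\<forall>\<phi>. per \<phi> \<longrightarrow> op_word (w' @ w) \<phi> = \<phi> \<and> op_word (w @ w') \<phi> = \<phi>) \<and>
     (\<forall>v. [fst (mat_word (w' @ w) v) = fst v] (mod P) \<and> [snd (mat_word (w' @ w) v) = snd v] (mod P))"
proof (induction w)
  case (Cons b w)
  then obtain w' where w': "\<And>\<phi>. per \<phi> \<Longrightarrow> op_word w' (op_word w \<phi>) = \<phi>"
      "\<And>\<phi>. per \<phi> \<Longrightarrow> op_word w (op_word w' \<phi>) = \<phi>"
      "\<And>v. [fst (mat_word w' (mat_word w v)) = fst v] (mod P)"
      "\<And>v. [snd (mat_word w' (mat_word w v)) = snd v] (mod P)"
    unfolding op_word_append mat_word_append by blast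
  show ?case
  proof (cases b)
    case False
    define S' where "S' = [False, False, False]"
    have opc: "op_word S' (opS \<phi>) = \<phi>" "opS (op_word S' \<phi>) = \<phi>" if "per \<phi>" for \<phi>
      using that by (auto simp: S'_def fun_eq_iff opS_opS per_opS)
    have mat: "mat_word S' (mat_word [False] v) = v" for v
      by (simp add: S'_def)
    have "op_word ((w' @ S') @ False # w) \<phi> = \<phi> \<and> op_word ((False # w) @ w' @ S') \<phi> = \<phi>" if "per \<phi>" for \<phi>
    proof -
      have "per (op_word S' \<phi>)" "per (op_word w \<phi>)" using that by (auto intro: per_op_word)
      then show ?thesis using w'(1,2) opc that by (simp add: op_word_append)
    qed
    moreover have "[fst (mat_word ((w' @ S') @ False # w) v) = fst v] (mod P) \<and>
        [snd (mat_word ((w' @ S') @ False # w) v) = snd v] (mod P)" for v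
    proof -
      have "mat_word ((w' @ S') @ False # w) v = mat_word w' (mat_word S' (mat_word [False] (mat_word w v)))"
        by (simp add: mat_word_append)
      then show ?thesis unfolding mat using w'(3,4)[of v] by simp
    qed
    moreover have "b = False" using False by simp
    ultimately show ?thesis by (intro exI[of _ "w' @ S'"]) (simp only: simp_thms, blast)
  next
    case True
    define T' where "T' = replicate (2 * E - 1) True"
    have opT_pow: "op_word (replicate n True) \<phi> x y
        = unity (n * (of_int x ^ 2 / (2 * L1) + of_int y ^ 2 / (2 * L2))) * \<phi> x y" for n \<phi> x y
    proof (induction n)
      case (Suc n)
      let ?c = "of_int x ^ 2 / (2 * L1) + of_int y ^ 2 / (2 * L2) :: real"
      have "op_word (replicate (Suc n) True) \<phi> x y = unity ?c * (unity (n * ?c) * \<phi> x y)"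
        unfolding Suc[symmetric] by (simp add: opT_def)
      also have "\<dots> = unity (?c + n * ?c) * \<phi> x y" unfolding unity_add by (simp only: mult.assoc)
      also have "?c + n * ?c = real (Suc n) * ?c" unfolding of_nat_Suc distrib_right by simp
      finally show ?case .
    qed simp
    have full: "op_word (replicate (2 * E) True) \<phi> = \<phi>" for \<phi>
    proof (intro ext)
      fix x y
      have "real (2 * E) * (of_int x ^ 2 / (2 * L1) + of_int y ^ 2 / (2 * L2)) = of_int (int \<alpha> * x ^ 2 + int \<beta> * y ^ 2)"
      proof -
        have "real (2 * E) * (of_int x ^ 2 / (2 * L1)) = \<alpha> * real_of_int x ^ 2"
          using L1_pos unfolding level1[symmetric] by simp
        moreover have "real (2 * E) * (of_int y ^ 2 / (2 * L2)) = \<beta> * real_of_int y ^ 2"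
          using L2_pos unfolding level2[symmetric] by simp
        ultimately show ?thesis by (simp add: distrib_left)
      qed
      then show "op_word (replicate (2 * E) True) \<phi> x y = \<phi> x y"
        unfolding opT_pow by (simp only: unity_of_int) simp
    qed
    have rep: "replicate (2 * E) True = True # T'" "replicate (2 * E) True = T' @ [True]"
      using E_pos unfolding T'_def replicate_append_same by (simp_all flip: replicate_Suc)
    have mat: "mat_word (replicate n True) v = (fst v, snd v - int n * fst v)" for n v
      by (induction n) (auto simp: algebra_simps)
    have matc: "mat_word T' (mat_word [True] v) = (fst v, snd v - P * fst v)" for v
      unfolding mat_word_append[symmetric] rep(2)[symmetric] mat by simp
    have opc: "op_word T' (opT \<phi>) = \<phi>" "opT (op_word T' \<phi>) = \<phi>" for \<phi>
      using full[of \<phi>] unfolding rep(2) op_word_append apply simp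
      using full[of \<phi>] unfolding rep(1) by simp
    have mu: "[fst (mat_word T' (mat_word [True] v)) = fst v] (mod P)"
        "[snd (mat_word T' (mat_word [True] v)) = snd v] (mod P)" for v
      unfolding matc by (simp_all add: cong_iff_dvd_diff)
    have "op_word ((w' @ T') @ True # w) \<phi> = \<phi> \<and> op_word ((True # w) @ w' @ T') \<phi> = \<phi>" if "per \<phi>" for \<phi>
    proof -
      have "per (op_word T' \<phi>)" using that by (rule per_op_word)
      then show ?thesis using w'(1,2) opc that by (simp add: op_word_append)
    qed
    moreover have "[fst (mat_word ((w' @ T') @ True # w) v) = fst v] (mod P) \<and>
        [snd (mat_word ((w' @ T') @ True # w) v) = snd v] (mod P)" for v
    proof -
      have "mat_word ((w' @ T') @ True # w) v = mat_word w' (mat_word T' (mat_word [True] (mat_word w v)))"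
        by (simp add: mat_word_append)
      then show ?thesis
        using mat_word_cong[OF mu(1,2), of w' "mat_word w v"] w'(3,4)[of v] by (metis cong_trans)
    qed
    moreover have "b = True" using True by simp
    ultimately show ?thesis by (intro exI[of _ "w' @ T'"]) (simp only: simp_thms, blast)
  qed
qed (auto intro!: exI[of _ "[]"])

text \<open>\<open>P\<close> is a multiple of \<open>2 * L1\<close> and of \<open>2 * L2\<close>.
  Changing the vectors by multiples of \<open>P\<close> therefore translates by full periods and
  alters every phase by an integer, including those with denominators \<open>2 * L1\<close> and
  \<open>2 * L2\<close>.\<close>

lemma heis_cong:
  assumes "per \<phi>"
    and "[fst u1 = fst v1] (mod P)" "[snd u1 = snd v1] (mod P)"
    and "[fst u2 = fst v2] (mod P)" "[snd u2 = snd v2] (mod P)"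
  shows "heis u1 u2 \<phi> = heis v1 v2 \<phi>"
proof (intro ext)
  fix x y
  obtain k1 where k1: "fst u1 = fst v1 + P * k1" using assms(2) by (metis cong_iff_lin cong_sym)
  obtain l1 where l1: "snd u1 = snd v1 + P * l1" using assms(3) by (metis cong_iff_lin cong_sym)
  obtain k2 where k2: "fst u2 = fst v2 + P * k2" using assms(4) by (metis cong_iff_lin cong_sym)
  obtain l2 where l2: "snd u2 = snd v2 + P * l2" using assms(5) by (metis cong_iff_lin cong_sym)
  have P1: "P = 2 * int L1 * int \<alpha>" and P2: "P = 2 * int L2 * int \<beta>"
    using level1 level2 by (simp_all flip: of_nat_mult add: mult.commute)
  have "\<phi> (x + fst u1) (y + fst u2) = \<phi> (x + fst v1) (y + fst v2)"
  proof -
    have "x + fst u1 = x + fst v1 + int L1 * (2 * int \<alpha> * k1)"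
      unfolding k1 P1 by (simp add: algebra_simps)
    moreover have "y + fst u2 = y + fst v2 + int L2 * (2 * int \<beta> * k2)"
      unfolding k2 P2 by (simp add: algebra_simps)
    ultimately show ?thesis using perD[OF assms(1)] by (simp only:)
  qed
  moreover have q: "of_int (a' * b') / (2 * L) - of_int (a * b) / (2 * L) = real_of_int (\<gamma> * (a * l + b * k + P * k * l))"
      "of_int (b' * z) / L - of_int (b * z) / L = real_of_int (2 * \<gamma> * l * z)"
    if "a' = a + P * k" "b' = b + P * l" "P = 2 * int L * \<gamma>" "L > 0" for a' b' a b k l z :: int and L :: nat and \<gamma>
    unfolding that(1,2) using that(3,4) by (simp_all add: field_simps)
  have "unity (of_int (fst u1 * snd u1) / (2 * L1) + of_int (fst u2 * snd u2) / (2 * L2)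
       + of_int (snd u1 * x) / L1 + of_int (snd u2 * y) / L2) =
     unity (of_int (fst v1 * snd v1) / (2 * L1) + of_int (fst v2 * snd v2) / (2 * L2)
       + of_int (snd v1 * x) / L1 + of_int (snd v2 * y) / L2)" (is "unity (?a1 + ?a2 + ?a3 + ?a4) = unity (?b1 + ?b2 + ?b3 + ?b4)")
  proof (rule unity_eq)
    have "?a1 - ?b1 \<in> \<int>" "?a2 - ?b2 \<in> \<int>" "?a3 - ?b3 \<in> \<int>" "?a4 - ?b4 \<in> \<int>"
      by (simp_all only: q(1)[OF k1 l1 P1 L1_pos] q(1)[OF k2 l2 P2 L2_pos] q(2)[OF k1 l1 P1 L1_pos] q(2)[OF k2 l2 P2 L2_pos] Ints_of_int)
    then have "(?a1 - ?b1) + (?a2 - ?b2) + (?a3 - ?b3) + (?a4 - ?b4) \<in> \<int>" by (intro Ints_add)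
    then show "(?a1 + ?a2 + ?a3 + ?a4) - (?b1 + ?b2 + ?b3 + ?b4) \<in> \<int>" by (simp add: algebra_simps)
  qed
  ultimately show "heis u1 u2 \<phi> x y = heis v1 v2 \<phi> x y" by (simp add: heis_def)
qed

definition delta :: "int \<Rightarrow> int \<Rightarrow> complex" where
  "delta x y = of_bool (int L1 dvd x \<and> int L2 dvd y)"

lemma per_delta: "per delta"
  by (simp add: per_def delta_def)

lemma per_expand:
  assumes "per \<phi>"
  shows "\<phi> = (\<lambda>x y. \<Sum>i\<in>{0..<int L1}\<times>{0..<int L2}. \<phi> (fst i) (snd i) * heis (- fst i, 0) (- snd i, 0) delta x y)"
proof (intro ext)
  fix x y
  have "(\<Sum>i\<in>{0..<int L1}\<times>{0..<int L2}. \<phi> (fst i) (snd i) * heis (- fst i, 0) (- snd i, 0) delta x y)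
     = (\<Sum>i\<in>{0..<int L1}\<times>{0..<int L2}. if i = (x mod int L1, y mod int L2) then \<phi> (fst i) (snd i) else 0)"
  proof (intro sum.cong refl)
    fix i assume "i \<in> {0..<int L1}\<times>{0..<int L2}"
    then obtain a b where i: "i = (a, b)" "0 \<le> a" "a < int L1" "0 \<le> b" "b < int L2" by auto
    then have "int L1 dvd x - a \<longleftrightarrow> a = x mod int L1" "int L2 dvd y - b \<longleftrightarrow> b = y mod int L2"
      by (auto simp: mod_eq_dvd_iff[symmetric])
    then show "\<phi> (fst i) (snd i) * heis (- fst i, 0) (- snd i, 0) delta x y =
        (if i = (x mod int L1, y mod int L2) then \<phi> (fst i) (snd i) else 0)"
      by (simp add: i(1) heis_def delta_def)
  qed
  also have "\<dots> = \<phi> (x mod int L1) (y mod int L2)"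
    using L1_pos L2_pos by (simp add: sum.delta)
  also have "\<dots> = \<phi> x y"
    using perD[OF assms, of "x mod int L1" "x div int L1" "y mod int L2" "y div int L2"] by simp
  finally show "\<phi> x y = (\<Sum>i\<in>{0..<int L1}\<times>{0..<int L2}. \<phi> (fst i) (snd i) * heis (- fst i, 0) (- snd i, 0) delta x y)"
    by simp
qed

text \<open>Schur's lemma for the irreducible action of the Heisenberg group: an operator commuting with
  it is determined by the image of the delta function, which is itself a joint eigenvector.\<close>

lemma op_word_scalar:
  assumes "\<And>v. [fst (mat_word w v) = fst v] (mod P)" "\<And>v. [snd (mat_word w v) = snd v] (mod P)"
  shows "\<exists>c. \<forall>\<phi>. per \<phi> \<longrightarrow> op_word w \<phi> = (\<lambda>x y. c * \<phi> x y)"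
proof -
  have comm: "op_word w (heis v1 v2 \<phi>) = heis v1 v2 (op_word w \<phi>)" if "per \<phi>" for v1 v2 \<phi>
    unfolding op_word_heis[OF that] by (intro heis_cong per_op_word that assms)
  define c where "c = op_word w delta 0 0"
  have per: "per (op_word w delta)" by (intro per_op_word per_delta)
  have "op_word w delta x y = c * delta x y" for x y
  proof (cases "int L1 dvd x \<and> int L2 dvd y")
    case True
    then obtain k l where kl: "x = int L1 * k" "y = int L2 * l" unfolding dvd_def by blast
    then show ?thesis using perD[OF per, of 0 k 0 l] True by (simp add: c_def delta_def)
  next
    case False
    \<comment> \<open>The delta function is fixed by both basic modulations, hence so is its image.
      Off the support of \<open>delta\<close> one of the two phases differs from 1 and forces the
      value 0.\<close>
    have 1: "op_word w delta x y * unity (of_int x / L1) = op_word w delta x y"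
    proof -
      have "heis (0, 1) (0, 0) delta = delta"
      proof (intro ext)
        fix x y
        have "unity (of_int x / L1) = 1" if "int L1 dvd x" for x
          using that L1_pos by (auto simp: unity_eq_1_iff elim!: dvdE)
        then show "heis (0, 1) (0, 0) delta x y = delta x y" by (simp add: heis_def delta_def)
      qed
      then have "heis (0, 1) (0, 0) (op_word w delta) = op_word w delta"
        using comm[OF per_delta, of "(0, 1)" "(0, 0)"] by simp
      then have "heis (0, 1) (0, 0) (op_word w delta) x y = op_word w delta x y" by simp
      then show ?thesis by (simp add: heis_def mult.commute)
    qed
    have 2: "op_word w delta x y * unity (of_int y / L2) = op_word w delta x y"
    proof -
      have "heis (0, 0) (0, 1) delta = delta"
      proof (intro ext)
        fix x y
        have "unity (of_int y / L2) = 1" if "int L2 dvd y" for y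
          using that L2_pos by (auto simp: unity_eq_1_iff elim!: dvdE)
        then show "heis (0, 0) (0, 1) delta x y = delta x y" by (simp add: heis_def delta_def)
      qed
      then have "heis (0, 0) (0, 1) (op_word w delta) = op_word w delta"
        using comm[OF per_delta, of "(0, 0)" "(0, 1)"] by simp
      then have "heis (0, 0) (0, 1) (op_word w delta) x y = op_word w delta x y" by simp
      then show ?thesis by (simp add: heis_def mult.commute)
    qed
    have nd: "unity (of_int z / L) \<noteq> 1" if "\<not> int L dvd z" "L > 0" for z L
    proof
      assume "unity (of_int z / L) = 1"
      then obtain n where "of_int z / real L = of_int n" unfolding unity_eq_1_iff by (auto elim: Ints_cases)
      then have "real_of_int z = of_int (int L * n)" using that(2) by (simp add: field_simps)
      then show False using that(1) by (simp only: of_int_eq_iff) simp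
    qed
    have "op_word w delta x y = 0"
      using False nd[OF _ L1_pos] nd[OF _ L2_pos] 1 2 by (metis mult_cancel_left2)
    then show ?thesis using False by (simp add: delta_def)
  qed
  then have \<delta>: "op_word w delta = (\<lambda>x y. c * delta x y)" by (intro ext)
  \<comment> \<open>The translates of \<open>delta\<close> span the periodic functions, and
    \<open>op_word w\<close> commutes with translations, so the scalar found for
    \<open>delta\<close> serves all of them.\<close>
  have "op_word w \<phi> = (\<lambda>x y. c * \<phi> x y)" if "per \<phi>" for \<phi>
  proof (intro ext)
    fix x y
    let ?I = "{0..<int L1}\<times>{0..<int L2}"
    have "op_word w \<phi> x y = op_word w (\<lambda>x y. \<Sum>i\<in>?I. \<phi> (fst i) (snd i) * heis (- fst i, 0) (- snd i, 0) delta x y) x y"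
      using per_expand[OF that] by simp
    also have "\<dots> = (\<Sum>i\<in>?I. \<phi> (fst i) (snd i) * heis (- fst i, 0) (- snd i, 0) (op_word w delta) x y)"
      unfolding op_word_linear comm[OF per_delta] by simp
    also have "\<dots> = c * (\<Sum>i\<in>?I. \<phi> (fst i) (snd i) * heis (- fst i, 0) (- snd i, 0) delta x y)"
      unfolding \<delta> by (simp add: heis_def sum_distrib_left mult_ac)
    also have "\<dots> = c * \<phi> x y" using per_expand[OF that] by metis
    finally show "op_word w \<phi> x y = c * \<phi> x y" .
  qed
  then show ?thesis by blast
qed

text \<open>An inverse word of \<open>w2\<close> followed after \<open>w1\<close> has a matrix
  trivial modulo \<open>P\<close>, so Schur's lemma applies. The scalar is independent of \<phi>,
  which matters when three series are transformed together.\<close>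

lemma op_word_proportional:
  assumes "\<And>v. [fst (mat_word w1 v) = fst (mat_word w2 v)] (mod P)"
    and "\<And>v. [snd (mat_word w1 v) = snd (mat_word w2 v)] (mod P)"
  shows "\<exists>c. \<forall>\<phi>. per \<phi> \<longrightarrow> op_word w1 \<phi> = (\<lambda>x y. c * op_word w2 \<phi> x y)"
proof -
  obtain w' where w': "\<And>\<phi>. per \<phi> \<Longrightarrow> op_word w' (op_word w2 \<phi>) = \<phi>"
      "\<And>\<phi>. per \<phi> \<Longrightarrow> op_word w2 (op_word w' \<phi>) = \<phi>"
      "\<And>v. [fst (mat_word w' (mat_word w2 v)) = fst v] (mod P)"
      "\<And>v. [snd (mat_word w' (mat_word w2 v)) = snd v] (mod P)"
    using word_inverse[of w2] unfolding op_word_append mat_word_append by blast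
  have "[fst (mat_word (w' @ w1) v) = fst v] (mod P)" "[snd (mat_word (w' @ w1) v) = snd v] (mod P)" for v
    using mat_word_cong[OF assms(1)[of v] assms(2)[of v], of w'] w'(3,4)[of v] unfolding mat_word_append
    by (blast intro: cong_trans)+
  then obtain c where c: "\<And>\<phi>. per \<phi> \<Longrightarrow> op_word w' (op_word w1 \<phi>) = (\<lambda>x y. c * \<phi> x y)"
    using op_word_scalar[of "w' @ w1"] unfolding op_word_append by blast
  have "op_word w1 \<phi> = (\<lambda>x y. c * op_word w2 \<phi> x y)" if "per \<phi>" for \<phi>
    using w'(2)[OF per_op_word[OF that], of w1] unfolding c[OF that] op_word_scale by simp
  then show ?thesis by blast
qed

lemma mat_word_linear:
  "fst (mat_word w (a, b)) = a * fst (mat_word w (1, 0)) + b * fst (mat_word w (0, 1))"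
  "snd (mat_word w (a, b)) = a * snd (mat_word w (1, 0)) + b * snd (mat_word w (0, 1))"
proof -
  have "fst (mat_word w (a, b)) = a * fst (mat_word w (1, 0)) + b * fst (mat_word w (0, 1)) \<and>
    snd (mat_word w (a, b)) = a * snd (mat_word w (1, 0)) + b * snd (mat_word w (0, 1))"
  proof (induction w)
    case (Cons b w)
    then show ?case by (cases b) (auto simp: algebra_simps)
  qed auto
  then show "fst (mat_word w (a, b)) = a * fst (mat_word w (1, 0)) + b * fst (mat_word w (0, 1))"
    "snd (mat_word w (a, b)) = a * snd (mat_word w (1, 0)) + b * snd (mat_word w (0, 1))" by auto
qed

lemma mat_word_det:
  "fst (mat_word w (1, 0)) * snd (mat_word w (0, 1)) - snd (mat_word w (1, 0)) * fst (mat_word w (0, 1)) = 1"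
proof (induction w)
  case (Cons b w)
  then show ?case by (cases b) (auto simp: algebra_simps)
qed auto

lemma mat_word_replicate_True: "mat_word (replicate n True) v = (fst v, snd v - int n * fst v)"
  by (induction n) (auto simp: algebra_simps)

text \<open>Two matrices of determinant 1 with equal first rows differ by subtracting a multiple of
  the first row from the second. That is a string of letters \<open>True\<close>, which only
  rescales the coefficients of a theta series, so vanishing of coefficients is decided by the first
  row.\<close>

lemma same_first_row:
  assumes "[fst (mat_word w1 (1, 0)) = fst (mat_word w2 (1, 0))] (mod P)"
    and "[fst (mat_word w1 (0, 1)) = fst (mat_word w2 (0, 1))] (mod P)"
  shows "\<exists>n c. \<forall>\<phi>. per \<phi> \<longrightarrow> op_word w2 \<phi> = (\<lambda>x y. c * op_word (replicate n True @ w1) \<phi> x y)"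
proof -
  define a b c d where "a = fst (mat_word w1 (1, 0))" "b = snd (mat_word w1 (1, 0))"
    "c = fst (mat_word w1 (0, 1))" "d = snd (mat_word w1 (0, 1))"
  define a' b' c' d' where "a' = fst (mat_word w2 (1, 0))" "b' = snd (mat_word w2 (1, 0))"
    "c' = fst (mat_word w2 (0, 1))" "d' = snd (mat_word w2 (0, 1))"
  note defs = a_b_c_d_def a'_b'_c'_d'_def
  have det: "a * d - b * c = 1" "a' * d' - b' * c' = 1"
    using mat_word_det[of w1] mat_word_det[of w2] by (simp_all add: defs)
  have aa: "[a = a'] (mod P)" "[c = c'] (mod P)" using assms by (simp_all add: defs)
  have det': "[a * d' - b' * c = 1] (mod P)"
    using aa det(2) by (metis cong_diff cong_mult cong_refl)
  \<comment> \<open>Solving \<open>b' = b - k * a\<close> and \<open>d' = d - k * c\<close> by means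
    of \<open>a * d - b * c = 1\<close> gives \<open>k = b * d' - d * b'\<close>. The residue modulo
    \<open>P\<close> is taken because a number of letters must be nonnegative.\<close>
  define k where "k = (b * d' - d * b') mod P"
  define n where "n = nat k"
  have n: "int n = k" using P_pos by (simp add: n_def k_def)
  have kc: "[k = b * d' - d * b'] (mod P)" by (simp add: k_def)
  have b': "[b' = b - k * a] (mod P)"
  proof -
    have "[b - k * a = b - (b * d' - d * b') * a] (mod P)"
      using kc by (intro cong_diff cong_mult) auto
    also have "b - (b * d' - d * b') * a = b + a * d * b' - b * (a * d')" by (simp add: algebra_simps)
    also have "[\<dots> = b + a * d * b' - b * (1 + b' * c)] (mod P)"
      using cong_add[OF det' cong_refl[of "b' * c"]] by (intro cong_diff cong_mult cong_refl) (simp add: algebra_simps)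
    also have "b + a * d * b' - b * (1 + b' * c) = b' * (a * d - b * c)" by (simp add: algebra_simps)
    finally show ?thesis using det by (simp add: cong_sym)
  qed
  have d': "[d' = d - k * c] (mod P)"
  proof -
    have "[d - k * c = d - (b * d' - d * b') * c] (mod P)"
      using kc by (intro cong_diff cong_mult) auto
    also have "d - (b * d' - d * b') * c = d - b * c * d' + d * (b' * c)" by (simp add: algebra_simps)
    also have "[\<dots> = d - b * c * d' + d * (a * d' - 1)] (mod P)"
      using cong_diff[OF cong_refl[of "a * d'"] det'] by (intro cong_add cong_mult cong_refl) (simp add: algebra_simps)
    also have "d - b * c * d' + d * (a * d' - 1) = d' * (a * d - b * c)" by (simp add: algebra_simps)
    finally show ?thesis using det by (simp add: cong_sym)
  qed
  have "[fst (mat_word w2 v) = fst (mat_word (replicate n True @ w1) v)] (mod P) \<and>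
      [snd (mat_word w2 v) = snd (mat_word (replicate n True @ w1) v)] (mod P)" for v
  proof -
    obtain x y where v: "v = (x, y)" by (cases v)
    have "[x * a' + y * c' = x * a + y * c] (mod P)"
      using aa by (intro cong_add cong_mult) (auto simp: cong_sym)
    moreover have "[x * b' + y * d' = x * (b - k * a) + y * (d - k * c)] (mod P)"
      using b' d' by (intro cong_add cong_mult) auto
    moreover have "x * (b - k * a) + y * (d - k * c) = x * b + y * d - k * (x * a + y * c)"
      by (simp add: algebra_simps)
    ultimately show ?thesis
      unfolding mat_word_append mat_word_replicate_True n v
      by (simp add: mat_word_linear(1)[of _ x y] mat_word_linear(2)[of _ x y] flip: defs)
  qed
  then show ?thesis using op_word_proportional[of w2 "replicate n True @ w1"] by blast
qed

text \<open>Plancherel's identity. The conjugate kernel is the kernel of a second transform at the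
  reflected argument, so the sum collapses by \<open>opS_opS\<close>.\<close>

lemma opS_norm:
  assumes "per \<phi>"
  shows "(\<Sum>x\<in>{0..<int L1}. \<Sum>y\<in>{0..<int L2}. (norm (opS \<phi> x y))\<^sup>2)
    = (\<Sum>x\<in>{0..<int L1}. \<Sum>y\<in>{0..<int L2}. (norm (\<phi> x y))\<^sup>2)"
proof -
  let ?A = "{0..<int L1}" and ?B = "{0..<int L2}"
  let ?I = "?A \<times> ?B"
  define r where "r = complex_of_real (sqrt (L1 * L2))"
  define k where "k x y u v = unity (- (of_int x * of_int u / L1) - of_int y * of_int v / L2)" for x y u v :: int
  have S: "opS f u v = (\<Sum>i\<in>?I. f (fst i) (snd i) * k (fst i) (snd i) u v) / r" for f u v
    by (simp add: opS_def k_def r_def sum.cartesian_product split_def)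
  have kc: "cnj (k x y u v) = k u v (- x) (- y)" for x y u v
    unfolding k_def cnj_unity by (rule arg_cong[of _ _ unity]) (simp add: mult.commute)
  have "(\<Sum>j\<in>?I. opS \<phi> (fst j) (snd j) * cnj (opS \<phi> (fst j) (snd j)))
     = (\<Sum>j\<in>?I. \<Sum>i\<in>?I. opS \<phi> (fst j) (snd j) * (cnj (\<phi> (fst i) (snd i)) * k (fst j) (snd j) (- fst i) (- snd i)) / r)"
    unfolding S[of \<phi> "fst _" "snd _"] by (simp add: sum_divide_distrib sum_distrib_left kc r_def)
  also have "\<dots> = (\<Sum>i\<in>?I. \<Sum>j\<in>?I. opS \<phi> (fst j) (snd j) * (cnj (\<phi> (fst i) (snd i)) * k (fst j) (snd j) (- fst i) (- snd i)) / r)"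
    by (rule sum.swap)
  also have "\<dots> = (\<Sum>i\<in>?I. cnj (\<phi> (fst i) (snd i)) * opS (opS \<phi>) (- fst i) (- snd i))"
    unfolding S[of "opS \<phi>"] by (simp add: sum_divide_distrib sum_distrib_left mult_ac)
  also have "\<dots> = (\<Sum>i\<in>?I. \<phi> (fst i) (snd i) * cnj (\<phi> (fst i) (snd i)))"
    by (simp add: opS_opS[OF assms] mult.commute)
  finally have "complex_of_real (\<Sum>j\<in>?I. (norm (opS \<phi> (fst j) (snd j)))\<^sup>2)
      = complex_of_real (\<Sum>i\<in>?I. (norm (\<phi> (fst i) (snd i)))\<^sup>2)"
    by (simp only: of_real_sum complex_norm_square)
  then have "(\<Sum>j\<in>?I. (norm (opS \<phi> (fst j) (snd j)))\<^sup>2) = (\<Sum>i\<in>?I. (norm (\<phi> (fst i) (snd i)))\<^sup>2)"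
    by (simp only: of_real_eq_iff)
  then show ?thesis by (simp add: sum.cartesian_product split_def)
qed

lemma op_word_norm:
  assumes "per \<phi>"
  shows "(\<Sum>x\<in>{0..<int L1}. \<Sum>y\<in>{0..<int L2}. (norm (op_word w \<phi> x y))\<^sup>2)
    = (\<Sum>x\<in>{0..<int L1}. \<Sum>y\<in>{0..<int L2}. (norm (\<phi> x y))\<^sup>2)"
proof (induction w)
  case (Cons b w)
  show ?case
  proof (cases b)
    case True
    then show ?thesis using Cons by (simp add: opT_def norm_mult)
  next
    case False
    then show ?thesis using Cons by (simp add: opS_norm per_op_word assms)
  qed
qed simp

text \<open>Unitarity gives one bound for the infinitely many words; the maximum principle is
  applied to all of them simultaneously and needs this uniformity.\<close>

lemma op_word_bounded:
  assumes "per \<phi>"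
  shows "\<exists>B. \<forall>w x y. norm (op_word w \<phi> x y) \<le> B"
proof -
  define N where "N = (\<Sum>x\<in>{0..<int L1}. \<Sum>y\<in>{0..<int L2}. (norm (\<phi> x y))\<^sup>2)"
  have "norm (op_word w \<phi> x y) \<le> sqrt N" for w x y
  proof -
    have "op_word w \<phi> x y = op_word w \<phi> (x mod int L1) (y mod int L2)"
      using perD[OF per_op_word[OF assms], where x = "x mod int L1" and k = "x div int L1" and y = "y mod int L2" and l = "y div int L2"] by simp
    moreover have "(norm (op_word w \<phi> (x mod int L1) (y mod int L2)))\<^sup>2 \<le> N"
    proof -
      have "(norm (op_word w \<phi> (x mod int L1) (y mod int L2)))\<^sup>2
          \<le> (\<Sum>y\<in>{0..<int L2}. (norm (op_word w \<phi> (x mod int L1) y))\<^sup>2)"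
        using L2_pos by (intro member_le_sum) auto
      also have "\<dots> \<le> (\<Sum>x\<in>{0..<int L1}. \<Sum>y\<in>{0..<int L2}. (norm (op_word w \<phi> x y))\<^sup>2)"
        using L1_pos by (intro member_le_sum[of "x mod int L1" _ "\<lambda>x. \<Sum>y\<in>{0..<int L2}. (norm (op_word w \<phi> x y))\<^sup>2"] sum_nonneg) auto
      finally show ?thesis unfolding op_word_norm[OF assms] N_def .
    qed
    ultimately show ?thesis by (simp add: real_le_rsqrt)
  qed
  then show ?thesis by blast
qed

end

subsection \<open>Poisson summation\<close>

text \<open>Tannery's theorem: the majorant makes the partial sums converge uniformly in
  \<open>n\<close>, which allows the two limits to be exchanged.\<close>

lemma tannery_infsum:
  fixes f :: "nat \<Rightarrow> 'a \<Rightarrow> 'b :: banach"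
  assumes le: "\<And>n j. norm (f n j) \<le> M j" and M: "M summable_on UNIV"
    and lim: "\<And>j. (\<lambda>n. f n j) \<longlonglongrightarrow> b j"
  shows "(\<lambda>n. infsum (f n) UNIV) \<longlonglongrightarrow> infsum b UNIV"
proof -
  have "norm (b j) \<le> M j" for j
    by (rule LIMSEQ_le_const2[OF tendsto_norm[OF lim]]) (use le in auto)
  then have "(\<lambda>j. norm (b j)) summable_on UNIV"
    by (intro Infinite_Sum.abs_summable_on_comparison_test'[OF M]) auto
  then have "b summable_on UNIV" by (rule abs_summable_summable)
  then have b: "(sum b \<longlongrightarrow> infsum b UNIV) (finite_subsets_at_top UNIV)"
    using has_sum_def has_sum_infsum by blast
  have ul: "uniform_limit UNIV (\<lambda>X n. \<Sum>j\<in>X. f n j) (\<lambda>n. infsum (f n) UNIV) (finite_subsets_at_top UNIV)"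
    by (rule Weierstrass_m_test_general[of UNIV UNIV "\<lambda>j n. f n j", OF _ M]) (rule le)
  show ?thesis
    by (rule swap_uniform_limit'[OF _ b ul]) (auto intro!: tendsto_sum lim)
qed

lemma summable_on_power_abs_int:
  fixes r :: real
  assumes "0 \<le> r" "r < 1"
  shows "(\<lambda>n :: int. r ^ nat \<bar>n\<bar>) summable_on UNIV"
proof -
  have geo: "(\<lambda>n :: nat. r ^ n) summable_on UNIV"
    using assms by (intro norm_summable_imp_summable_on) (simp add: summable_geometric)
  have "(\<lambda>n :: int. r ^ nat \<bar>n\<bar>) summable_on range int"
    using geo by (subst summable_on_reindex) (auto simp: o_def)
  moreover have "(\<lambda>n :: int. r ^ nat \<bar>n\<bar>) summable_on range (\<lambda>n. - int n)"
    using geo by (subst summable_on_reindex) (auto simp: o_def inj_on_def)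
  ultimately have "(\<lambda>n :: int. r ^ nat \<bar>n\<bar>) summable_on (range int \<union> range (\<lambda>n. - int n))"
    by (rule summable_on_union)
  moreover have "x \<in> range int \<union> range (\<lambda>n. - int n)" for x :: int
  proof -
    have "x = int (nat x) \<or> x = - int (nat (- x))" by auto
    then show ?thesis by blast
  qed
  then have "range int \<union> range (\<lambda>n. - int n) = UNIV" by blast
  ultimately show ?thesis by simp
qed

definition gauss :: "real \<Rightarrow> real \<Rightarrow> real" where
  "gauss s x = exp (- (pi * s * x\<^sup>2))"

lemma gauss_pos: "gauss s x > 0"
  by (simp add: gauss_def)

text \<open>The majorant depends on \<open>v\<close> only through \<open>Y\<close>, as uniform
  convergence over a whole period requires. It comes from n^2 \<le> 2 (n + v)^2 + 2 v^2 and from n^2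
  being at least the absolute value of n.\<close>

lemma gauss_le_geometric:
  assumes "s > 0" "\<bar>v\<bar> \<le> Y"
  shows "gauss s (of_int n + v) \<le> exp (pi * s * Y\<^sup>2) * exp (- (pi * s / 2)) ^ nat \<bar>n\<bar>"
proof -
  have "(real_of_int n)\<^sup>2 \<le> 2 * (of_int n + v)\<^sup>2 + 2 * v\<^sup>2"
  proof -
    have "0 \<le> (of_int n + 2 * v)\<^sup>2" by simp
    then show ?thesis by (simp add: power2_eq_square algebra_simps)
  qed
  moreover have "v\<^sup>2 \<le> Y\<^sup>2" using assms(2) by (metis abs_ge_zero power2_abs power_mono)
  moreover have "\<bar>real_of_int n\<bar> \<le> (real_of_int n)\<^sup>2"
  proof (cases "n = 0")
    case False
    then have "\<bar>real_of_int n\<bar> * 1 \<le> \<bar>real_of_int n\<bar> * \<bar>real_of_int n\<bar>"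
      by (intro mult_left_mono) auto
    then show ?thesis by (simp add: power2_eq_square)
  qed simp
  ultimately have "\<bar>real_of_int n\<bar> / 2 - Y\<^sup>2 \<le> (of_int n + v)\<^sup>2" by linarith
  then have "pi * s * (\<bar>real_of_int n\<bar> / 2 - Y\<^sup>2) \<le> pi * s * (of_int n + v)\<^sup>2"
    using assms by (intro mult_left_mono) auto
  then have "gauss s (of_int n + v) \<le> exp (pi * s * Y\<^sup>2 + real (nat \<bar>n\<bar>) * (- (pi * s / 2)))"
    unfolding gauss_def by (simp add: algebra_simps)
  also have "\<dots> = exp (pi * s * Y\<^sup>2) * exp (- (pi * s / 2)) ^ nat \<bar>n\<bar>"
    by (simp only: exp_add exp_of_nat_mult)
  finally show ?thesis .
qed

lemma gauss_majorant_summable: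
  assumes "s > 0"
  shows "(\<lambda>n :: int. exp (pi * s * Y\<^sup>2) * exp (- (pi * s / 2)) ^ nat \<bar>n\<bar>) summable_on UNIV"
  using assms by (intro summable_on_cmult_right summable_on_power_abs_int) auto

lemma gauss_summable:
  assumes "s > 0"
  shows "(\<lambda>n :: int. gauss s (of_int n + v)) summable_on UNIV"
  by (rule summable_on_comparison_test[OF gauss_majorant_summable[OF assms, of "\<bar>v\<bar>"]])
    (use gauss_le_geometric[OF assms, of v "\<bar>v\<bar>"] gauss_pos in \<open>auto intro: less_imp_le\<close>)

lemma continuous_gauss [continuous_intros]:
  "continuous_on A f \<Longrightarrow> continuous_on A (\<lambda>x. gauss s (f x))"
  unfolding gauss_def by (intro continuous_intros)

lemma continuous_unity [continuous_intros]:
  "continuous_on A f \<Longrightarrow> continuous_on A (\<lambda>x. unity (f x))"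
  unfolding unity_def cis_conv_exp by (intro continuous_intros)

lemma unity_measurable [measurable]: "unity \<in> borel_measurable borel"
  by (intro borel_measurable_continuous_onI continuous_unity continuous_on_id)

lemma gauss_measurable [measurable]: "gauss s \<in> borel_measurable borel"
  by (intro borel_measurable_continuous_onI continuous_gauss continuous_on_id)

lemma gauss_normal:
  assumes "s > 0"
  shows "gauss s x = sqrt (2 * pi) * std_normal_density (sqrt (2 * pi * s) * x)"
proof -
  have "(sqrt (2 * pi * s) * x)\<^sup>2 = 2 * pi * s * x\<^sup>2"
    using assms by (simp add: power_mult_distrib)
  then show ?thesis by (simp add: std_normal_density_def gauss_def)
qed

lemma integrable_gauss:
  assumes "s > 0"
  shows "integrable lborel (\<lambda>x. gauss s (v + x))"
proof -
  have "integrable lborel (\<lambda>x. sqrt (2 * pi) * std_normal_density (0 + sqrt (2 * pi * s) * x))"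
    using assms by (intro integrable_mult_right lborel_integrable_real_affine) auto
  then have "integrable lborel (gauss s)"
  proof -
    have "gauss s = (\<lambda>x. sqrt (2 * pi) * std_normal_density (0 + sqrt (2 * pi * s) * x))"
      using gauss_normal[OF assms] by (intro ext) simp
    then show ?thesis using \<open>integrable lborel _\<close> by simp
  qed
  then show ?thesis
    using lborel_integrable_real_affine[of "gauss s" 1 v] by simp
qed

text \<open>After rescaling by \<open>sqrt (2 * pi * s)\<close> this is the characteristic function
  of the standard normal distribution.\<close>

lemma integral_gauss_unity:
  assumes s: "s > 0"
  shows "(LINT x|lborel. of_real (gauss s x) * unity (j * x)) = of_real (exp (- (pi * j\<^sup>2 / s)) / sqrt s)"
proof -
  define c where "c = sqrt (2 * pi * s)"
  have c: "c > 0" using s by (simp add: c_def)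
  define t where "t = 2 * pi * j / c"
  have "complex_of_real (exp (- (t\<^sup>2) / 2)) = char std_normal_distribution t"
    by (simp add: char_std_normal_distribution)
  also have "\<dots> = (LINT x|lborel. std_normal_density x *\<^sub>R iexp (t * x))"
    unfolding char_def by (subst integral_density) (auto simp: normal_density_nonneg)
  also have "\<dots> = \<bar>c\<bar> *\<^sub>R (LINT x|lborel. std_normal_density (0 + c * x) *\<^sub>R iexp (t * (0 + c * x)))"
    using c by (intro lborel_integral_real_affine) auto
  also have "(LINT x|lborel. std_normal_density (0 + c * x) *\<^sub>R iexp (t * (0 + c * x)))
      = (LINT x|lborel. of_real (1 / sqrt (2 * pi)) * (of_real (gauss s x) * unity (j * x)))"
  proof (rule Bochner_Integration.integral_cong[OF refl])
    fix x
    have "iexp (t * (0 + c * x)) = unity (j * x)"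
      using c by (simp add: t_def unity_def cis_conv_exp mult_ac)
    then show "std_normal_density (0 + c * x) *\<^sub>R iexp (t * (0 + c * x))
        = of_real (1 / sqrt (2 * pi)) * (of_real (gauss s x) * unity (j * x))"
      using gauss_normal[OF s, of x] by (simp add: c_def scaleR_conv_of_real)
  qed
  also have "\<dots> = of_real (1 / sqrt (2 * pi)) * (LINT x|lborel. of_real (gauss s x) * unity (j * x))"
    by (rule integral_mult_right_zero)
  finally have "complex_of_real (exp (- (t\<^sup>2) / 2)) =
      of_real (c / sqrt (2 * pi)) * (LINT x|lborel. of_real (gauss s x) * unity (j * x))"
    using c by (simp add: scaleR_conv_of_real)
  moreover have "c / sqrt (2 * pi) = sqrt s" by (simp add: c_def real_sqrt_mult)
  moreover have "t\<^sup>2 / 2 = pi * j\<^sup>2 / s"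
  proof -
    have "c\<^sup>2 = 2 * pi * s" using s by (simp add: c_def)
    then show ?thesis using s by (simp add: t_def power_divide power_mult_distrib field_simps power2_eq_square)
  qed
  ultimately show ?thesis using s by (simp add: field_simps)
qed

lemma integral_gauss_shift:
  assumes s: "s > 0"
  shows "(LINT x|lborel. of_real (gauss s (v + x)) * unity (of_int j * x))
    = of_real (exp (- (pi * (of_int j)\<^sup>2 / s)) / sqrt s) * unity (- (of_int j * v))"
proof -
  have "(LINT x|lborel. of_real (gauss s x) * unity (of_int j * x))
      = \<bar>1\<bar> *\<^sub>R (LINT x|lborel. of_real (gauss s (v + 1 * x)) * unity (of_int j * (v + 1 * x)))"
    by (rule lborel_integral_real_affine) simp
  also have "\<dots> = (LINT x|lborel. unity (of_int j * v) * (of_real (gauss s (v + x)) * unity (of_int j * x)))"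
    by (simp add: distrib_left unity_add mult_ac)
  also have "\<dots> = unity (of_int j * v) * (LINT x|lborel. of_real (gauss s (v + x)) * unity (of_int j * x))"
    by (rule integral_mult_right_zero)
  finally have "of_real (exp (- (pi * (of_int j)\<^sup>2 / s)) / sqrt s) =
      unity (of_int j * v) * (LINT x|lborel. of_real (gauss s (v + x)) * unity (of_int j * x))"
    unfolding integral_gauss_unity[OF s] .
  then have "unity (- (of_int j * v)) * of_real (exp (- (pi * (of_int j)\<^sup>2 / s)) / sqrt s) =
      (unity (- (of_int j * v)) * unity (of_int j * v)) * (LINT x|lborel. of_real (gauss s (v + x)) * unity (of_int j * x))"
    by simp
  then show ?thesis by (simp add: unity_add[symmetric] mult.commute)
qed

text \<open>A summability kernel in the manner of Fejer's: nonnegative, of period 1, concentrating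
  at 0 once normalised, and a trigonometric polynomial with binomial coefficients. Testing against
  it yields Poisson's formula pointwise while only finitely many exponentials have to be integrated
  at a time.\<close>

definition cos_kernel :: "nat \<Rightarrow> real \<Rightarrow> real" where
  "cos_kernel n x = cos (pi * x) ^ (2 * n)"

lemma cos_kernel_nonneg: "cos_kernel n x \<ge> 0"
  by (simp add: cos_kernel_def power_mult)

lemma cos_kernel_le_1: "cos_kernel n x \<le> 1"
  unfolding cos_kernel_def power_mult by (rule power_le_one) (auto simp: abs_square_le_1)

lemma cos_kernel_periodic: "cos_kernel n (x + of_int m) = cos_kernel n x"
proof -
  have "(cos (pi * x + pi * of_int m))\<^sup>2 = (cos (pi * x))\<^sup>2"
    by (simp add: cos_add power_mult_distrib cos_int_times_real sin_int_times_real)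
  then show ?thesis by (simp add: cos_kernel_def power_mult distrib_left)
qed

lemma continuous_cos_kernel [continuous_intros]:
  fixes f :: "real \<Rightarrow> real"
  shows "continuous_on A f \<Longrightarrow> continuous_on A (\<lambda>x. cos_kernel n (f x))"
  unfolding cos_kernel_def by (intro continuous_intros)

lemma cos_kernel_measurable [measurable]: "cos_kernel n \<in> borel_measurable borel"
  by (intro borel_measurable_continuous_onI continuous_cos_kernel continuous_on_id)

lemma cos_kernel_expand:
  "complex_of_real (cos_kernel n x) =
    (\<Sum>k\<le>2 * n. of_nat ((2 * n) choose k) * unity (of_int (int k - int n) * x)) / 4 ^ n"
proof -
  have "complex_of_real (cos (pi * x)) = (unity (x / 2) + unity (- (x / 2))) / 2"
    by (simp add: unity_def complex_eq_iff)
  moreover have "complex_of_real (cos_kernel n x) = complex_of_real (cos (pi * x)) ^ (2 * n)"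
    by (simp add: cos_kernel_def)
  ultimately have "complex_of_real (cos_kernel n x) = ((unity (x / 2) + unity (- (x / 2))) / 2) ^ (2 * n)"
    by (simp only:)
  also have "\<dots> = (unity (x / 2) + unity (- (x / 2))) ^ (2 * n) / 4 ^ n"
    unfolding power_divide by (simp add: power_mult)
  also have "(unity (x / 2) + unity (- (x / 2))) ^ (2 * n) =
      (\<Sum>k\<le>2 * n. of_nat ((2 * n) choose k) * unity (of_int (int k - int n) * x))"
    unfolding binomial_ring
  proof (intro sum.cong refl)
    fix k assume k: "k \<in> {..2 * n}"
    have "unity (x / 2) ^ k * unity (- (x / 2)) ^ (2 * n - k) = unity (of_int (int k - int n) * x)"
      unfolding unity_power unity_add[symmetric] using k
      by (intro arg_cong[of _ _ unity]) (simp add: of_nat_diff algebra_simps)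
    then show "of_nat ((2 * n) choose k) * unity (x / 2) ^ k * unity (- (x / 2)) ^ (2 * n - k) =
        of_nat ((2 * n) choose k) * unity (of_int (int k - int n) * x)"
      by (simp add: mult.assoc)
  qed
  finally show ?thesis .
qed

lemma integral_unity_period:
  "integral {- (1 / 2)..1 / 2} (\<lambda>x. unity (of_int j * x)) = of_bool (j = 0)"
proof (cases "j = 0")
  case True
  then show ?thesis by simp
next
  case False
  define F where "F x = unity (of_int j * x) / (2 * pi * \<i> * of_int j)" for x
  have "((\<lambda>x. unity (of_int j * x)) has_integral (F (1 / 2) - F (- (1 / 2)))) {- (1 / 2)..1 / 2}"
  proof (rule fundamental_theorem_of_calculus)
    fix x
    define c where "c = 2 * pi * \<i> * of_int j"
    have c: "c \<noteq> 0" using False by (simp add: c_def)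
    have "((\<lambda>z. exp (c * z) / c) has_field_derivative exp (c * of_real x)) (at (of_real x))"
      using c by (auto intro!: derivative_eq_intros)
    then have "((\<lambda>x. exp (c * of_real x) / c) has_vector_derivative exp (c * of_real x)) (at x within {- (1 / 2)..1 / 2})"
      by (rule has_vector_derivative_real_field)
    moreover have "unity (of_int j * x) = exp (c * of_real x)" for x
      by (simp add: unity_def cis_conv_exp c_def mult_ac)
    ultimately show "(F has_vector_derivative unity (of_int j * x)) (at x within {- (1 / 2)..1 / 2})"
      unfolding F_def c_def[symmetric] by simp
  qed simp
  moreover have "F (1 / 2) = F (- (1 / 2))"
  proof -
    have "unity (of_int j * (1 / 2)) = unity (of_int j * (- (1 / 2)))"
      by (rule unity_eq) simp
    then show ?thesis by (simp add: F_def)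
  qed
  ultimately show ?thesis using False by (simp add: integral_unique)
qed

lemma integral_cos_kernel:
  "integral {- (1 / 2)..1 / 2} (cos_kernel n) = real ((2 * n) choose n) / 4 ^ n"
proof -
  have "complex_of_real (integral {- (1 / 2)..1 / 2} (cos_kernel n)) =
      integral {- (1 / 2)..1 / 2} (\<lambda>x. complex_of_real (cos_kernel n x))"
  proof -
    have "cos_kernel n integrable_on {- (1 / 2)..1 / 2}"
      by (intro integrable_continuous_real continuous_cos_kernel continuous_on_id)
    from integral_linear[OF this, of complex_of_real, OF bounded_linear_of_real] show ?thesis
      by (simp add: o_def)
  qed
  also have "\<dots> = (\<Sum>k\<le>2 * n. of_nat ((2 * n) choose k) * of_bool (int k - int n = 0)) / 4 ^ n"
  proof -
    have "integral {- (1 / 2)..1 / 2} (\<lambda>x. of_nat ((2 * n) choose k) * unity (of_int (int k - int n) * x))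
      = of_nat ((2 * n) choose k) * of_bool (int k - int n = 0)" for k
      unfolding integral_mult_right integral_unity_period ..
    moreover have "integral {- (1 / 2)..1 / 2} (\<lambda>x. \<Sum>k\<le>2 * n. of_nat ((2 * n) choose k) * unity (of_int (int k - int n) * x))
      = (\<Sum>k\<le>2 * n. integral {- (1 / 2)..1 / 2} (\<lambda>x. of_nat ((2 * n) choose k) * unity (of_int (int k - int n) * x)))"
      by (rule integral_sum) (auto intro!: integrable_continuous_real continuous_intros)
    ultimately show ?thesis unfolding cos_kernel_expand integral_divide by (simp only:)
  qed
  also have "(\<Sum>k\<le>2 * n. of_nat ((2 * n) choose k) * of_bool (int k - int n = 0)) = complex_of_nat ((2 * n) choose n)"
    by (simp add: of_bool_def if_distrib[of "\<lambda>x. _ * x"] sum.delta cong: if_cong)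
  finally have "complex_of_real (integral {- (1 / 2)..1 / 2} (cos_kernel n)) = of_real (real ((2 * n) choose n) / 4 ^ n)"
    by simp
  then show ?thesis by (simp only: of_real_eq_iff)
qed

text \<open>Equivalently, the squared sine of \<open>pi * x\<close> has mean
  \<open>1 / (2 * (n + 1))\<close> under the normalised kernel; this expresses the concentration at
  0.\<close>

lemma integral_cos_kernel_Suc:
  "integral {- (1 / 2)..1 / 2} (cos_kernel (Suc n)) =
    integral {- (1 / 2)..1 / 2} (cos_kernel n) * (1 - 1 / (2 * (n + 1)))"
proof -
  have B: "real (2 * m choose m) = fact (2 * m) / (fact m * fact m)" for m
    by (simp add: binomial_fact)
  have "fact (2 * Suc n) = (2 * real n + 2) * (2 * real n + 1) * fact (2 * n)"
    by (simp add: algebra_simps)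
  moreover have "fact (Suc n) = (real n + 1) * fact n" by simp
  ultimately show ?thesis
    unfolding integral_cos_kernel B by (simp add: divide_simps del: fact_Suc) (simp add: algebra_simps)
qed

text \<open>Korovkin's argument: continuity bounds the deviation of \<open>p x\<close> from
  \<open>p 0\<close> by \<open>\<epsilon> / 2\<close> plus a multiple of the squared sine of
  \<open>pi * x\<close>, and the mean of that sine against the kernel tends to 0.\<close>

lemma cos_kernel_approximates:
  fixes p :: "real \<Rightarrow> real"
  assumes p: "continuous_on {- (1 / 2)..1 / 2} p"
  shows "(\<lambda>n. integral {- (1 / 2)..1 / 2} (\<lambda>x. p x * cos_kernel n x) / integral {- (1 / 2)..1 / 2} (cos_kernel n)) \<longlonglongrightarrow> p 0"
proof (rule tendstoI)
  let ?I = "{- (1 / 2)..1 / 2 :: real}"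
  fix \<epsilon> :: real assume \<epsilon>: "\<epsilon> > 0"
  obtain B where B: "\<And>x. x \<in> ?I \<Longrightarrow> \<bar>p x\<bar> \<le> B" "B \<ge> 0"
  proof -
    have "bounded (p ` ?I)" by (intro compact_imp_bounded compact_continuous_image p) auto
    then obtain B where "\<forall>x\<in>?I. \<bar>p x\<bar> \<le> B" by (auto simp: bounded_iff)
    then show ?thesis using that[of "\<bar>B\<bar>"] by force
  qed
  obtain \<delta> where \<delta>: "\<delta> > 0" "\<And>x. x \<in> ?I \<Longrightarrow> \<bar>x\<bar> < \<delta> \<Longrightarrow> \<bar>p x - p 0\<bar> < \<epsilon> / 2"
    using p[unfolded continuous_on_iff, rule_format, of 0 "\<epsilon> / 2"] \<epsilon> by (auto simp: dist_real_def)
  define \<delta>' where "\<delta>' = min \<delta> (1 / 2)"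
  have \<delta>': "0 < \<delta>'" "\<delta>' \<le> \<delta>" "\<delta>' \<le> 1 / 2" using \<delta> by (auto simp: \<delta>'_def)
  define m where "m = 1 - (cos (pi * \<delta>'))\<^sup>2"
  have m: "m > 0"
  proof -
    have "sin (pi * \<delta>') > 0" using \<delta>' by (intro sin_gt_zero) (auto simp: mult_less_cancel_left1)
    then show ?thesis by (simp add: m_def sin_squared_eq[symmetric])
  qed
  \<comment> \<open>At distance \<delta>' or more from 0 the squared sine is at least
    \<open>m\<close>, so \<open>C\<close> times it is at least \<open>2 * B\<close>, the trivial
    bound for the deviation.\<close>
  define C where "C = 2 * B / m"
  have C: "C \<ge> 0" using B m by (simp add: C_def)
  have key: "\<bar>p x - p 0\<bar> \<le> \<epsilon> / 2 + C * (1 - (cos (pi * x))\<^sup>2)" if x: "x \<in> ?I" for x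
  proof (cases "\<bar>x\<bar> < \<delta>'")
    case True
    have "0 \<le> C * (1 - (cos (pi * x))\<^sup>2)" using C by (simp add: abs_square_le_1)
    then show ?thesis using \<delta>(2)[OF x] True \<delta>' by linarith
  next
    case False
    have "pi * \<bar>x\<bar> \<le> pi * (1 / 2)" "pi * \<delta>' \<le> pi * \<bar>x\<bar>" "0 \<le> pi * \<delta>'"
      using False x \<delta>' by (auto intro!: mult_left_mono simp: abs_if)
    then have x': "pi * \<bar>x\<bar> \<le> pi / 2" "pi * \<delta>' \<le> pi * \<bar>x\<bar>" "0 \<le> pi * \<delta>'" "0 \<le> pi * \<bar>x\<bar>"
      by auto
    have "cos (pi * \<bar>x\<bar>) \<le> cos (pi * \<delta>')"
      using x' pi_gt_zero by (intro cos_monotone_0_pi_le) linarith+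
    moreover have "cos (pi * \<bar>x\<bar>) \<ge> 0"
      using x' by (intro cos_ge_zero) linarith+
    moreover have "cos (pi * \<bar>x\<bar>) = cos (pi * x)" by (auto simp: abs_if)
    ultimately have "(cos (pi * x))\<^sup>2 \<le> (cos (pi * \<delta>'))\<^sup>2" by (simp add: power_mono)
    then have "m \<le> 1 - (cos (pi * x))\<^sup>2" by (simp add: m_def)
    then have "C * m \<le> C * (1 - (cos (pi * x))\<^sup>2)" using C by (intro mult_left_mono) auto
    moreover have "C * m = 2 * B" using m by (simp add: C_def)
    moreover have "\<bar>p x - p 0\<bar> \<le> 2 * B" using B(1)[OF x] B(1)[of 0] by simp
    ultimately show ?thesis using \<epsilon> by linarith
  qed
  define M where "M n = integral ?I (cos_kernel n)" for n
  have Mpos: "M n > 0" for n unfolding M_def integral_cos_kernel by simp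
  have bound: "\<bar>integral ?I (\<lambda>x. p x * cos_kernel n x) / M n - p 0\<bar> \<le> \<epsilon> / 2 + C / (2 * (n + 1))" for n
  proof -
    have "integral ?I (\<lambda>x. p x * cos_kernel n x) - p 0 * M n = integral ?I (\<lambda>x. (p x - p 0) * cos_kernel n x)"
      unfolding M_def left_diff_distrib
      by (subst Henstock_Kurzweil_Integration.integral_diff)
         (auto intro!: integrable_continuous_real continuous_intros p)
    moreover have "norm (integral ?I (\<lambda>x. (p x - p 0) * cos_kernel n x)) \<le>
       integral ?I (\<lambda>x. (\<epsilon> / 2 + C) * cos_kernel n x - C * cos_kernel (Suc n) x)"
    proof (rule integral_norm_bound_integral)
      fix x assume x: "x \<in> ?I"
      have "norm ((p x - p 0) * cos_kernel n x) \<le> (\<epsilon> / 2 + C * (1 - (cos (pi * x))\<^sup>2)) * cos_kernel n x"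
        using key[OF x] cos_kernel_nonneg[of n x] by (simp add: abs_mult mult_right_mono)
      also have "\<dots> = (\<epsilon> / 2 + C) * cos_kernel n x - C * cos_kernel (Suc n) x"
        by (simp add: cos_kernel_def power2_eq_square algebra_simps)
      finally show "norm ((p x - p 0) * cos_kernel n x) \<le> (\<epsilon> / 2 + C) * cos_kernel n x - C * cos_kernel (Suc n) x" .
    qed (auto intro!: integrable_continuous_real continuous_intros p)
    moreover have "integral ?I (\<lambda>x. (\<epsilon> / 2 + C) * cos_kernel n x - C * cos_kernel (Suc n) x) = (\<epsilon> / 2 + C) * M n - C * M (Suc n)"
      unfolding M_def
      by (subst Henstock_Kurzweil_Integration.integral_diff)
         (auto intro!: integrable_continuous_real continuous_intros p)
    moreover have "(\<epsilon> / 2 + C) * M n - C * M (Suc n) = (\<epsilon> / 2 + C / (2 * (n + 1))) * M n"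
      unfolding M_def integral_cos_kernel_Suc[of n] by (simp add: algebra_simps)
    ultimately have "\<bar>integral ?I (\<lambda>x. p x * cos_kernel n x) - p 0 * M n\<bar> \<le> (\<epsilon> / 2 + C / (2 * (n + 1))) * M n"
      by simp
    moreover have "integral ?I (\<lambda>x. p x * cos_kernel n x) / M n - p 0 = (integral ?I (\<lambda>x. p x * cos_kernel n x) - p 0 * M n) / M n"
      using Mpos[of n] by (simp add: field_simps)
    ultimately show ?thesis using Mpos[of n] by (simp add: abs_divide pos_divide_le_eq)
  qed
  have "(\<lambda>n. C / (2 * (real n + 1))) \<longlonglongrightarrow> 0"
    by real_asymp
  then have "eventually (\<lambda>n. C / (2 * (real n + 1)) < \<epsilon> / 2) sequentially"
    using \<epsilon> by (intro order_tendstoD) auto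
  then show "eventually (\<lambda>n. dist (integral ?I (\<lambda>x. p x * cos_kernel n x) / integral ?I (cos_kernel n)) (p 0) < \<epsilon>) sequentially"
  proof eventually_elim
    case (elim n)
    have "C / (2 * real (n + 1)) = C / (2 * (real n + 1))" by (simp add: add.commute)
    then show ?case using bound[of n] elim unfolding dist_real_def M_def by linarith
  qed
qed

lemma integral_symmetric_periods:
  fixes h :: "real \<Rightarrow> real"
  assumes h: "continuous_on UNIV h"
  shows "integral {- (real N + 1 / 2)..real N + 1 / 2} h
    = (\<Sum>m\<in>{- int N..int N}. integral {- (1 / 2)..1 / 2} (\<lambda>x. h (x + of_int m)))"
proof -
  have int: "h integrable_on {a..b}" for a b
    by (intro integrable_continuous_real continuous_on_subset[OF h]) auto
  have shift: "integral {- (1 / 2)..1 / 2} (\<lambda>x. h (x + c)) = integral {c - 1 / 2..c + 1 / 2} h" for c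
    using integral_shift_Icc_real[of "- (1 / 2)" "1 / 2" h c] by (simp add: o_def add.commute)
  show ?thesis
  proof (induction N)
    case (Suc N)
    have set: "{- int (Suc N)..int (Suc N)} = insert (int N + 1) (insert (- int N - 1) {- int N..int N})"
      by auto
    have "integral {- (real (Suc N) + 1 / 2)..real (Suc N) + 1 / 2} h =
        integral {- (real (Suc N) + 1 / 2)..- (real N + 1 / 2)} h + integral {- (real N + 1 / 2)..real (Suc N) + 1 / 2} h"
      by (rule Henstock_Kurzweil_Integration.integral_combine[symmetric]) (auto intro: int)
    also have "integral {- (real N + 1 / 2)..real (Suc N) + 1 / 2} h =
        integral {- (real N + 1 / 2)..real N + 1 / 2} h + integral {real N + 1 / 2..real (Suc N) + 1 / 2} h"
      by (rule Henstock_Kurzweil_Integration.integral_combine[symmetric]) (auto intro: int)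
    also have "integral {- (real (Suc N) + 1 / 2)..- (real N + 1 / 2)} h = integral {- (1 / 2)..1 / 2} (\<lambda>x. h (x + of_int (- int N - 1)))"
      unfolding shift by (simp add: algebra_simps)
    also have "integral {real N + 1 / 2..real (Suc N) + 1 / 2} h = integral {- (1 / 2)..1 / 2} (\<lambda>x. h (x + of_int (int N + 1)))"
      unfolding shift by (simp add: algebra_simps)
    finally show ?case unfolding set Suc by simp
  qed simp
qed

lemma lebesgue_integral_exhaust:
  fixes f :: "real \<Rightarrow> real"
  assumes f: "integrable lborel f"
  shows "(\<lambda>N. integral {- (real N + 1 / 2)..real N + 1 / 2} f) \<longlonglongrightarrow> (LINT x|lborel. f x)"
proof -
  have "(\<lambda>N. LINT x|lborel. indicator {- (real N + 1 / 2)..real N + 1 / 2} x *\<^sub>R f x) \<longlonglongrightarrow> (LINT x|lborel. f x)"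
  proof (rule integral_dominated_convergence[where w = "\<lambda>x. \<bar>f x\<bar>"])
    show "AE x in lborel. (\<lambda>N. indicator {- (real N + 1 / 2)..real N + 1 / 2} x *\<^sub>R f x) \<longlonglongrightarrow> f x"
    proof (rule AE_I2)
      fix x :: real
      obtain N0 :: nat where N0: "\<bar>x\<bar> \<le> real N0" using real_arch_simple by blast
      have "eventually (\<lambda>N. indicator {- (real N + 1 / 2)..real N + 1 / 2} x *\<^sub>R f x = f x) sequentially"
        using eventually_ge_at_top[of N0]
      proof eventually_elim
        case (elim N)
        then have "\<bar>x\<bar> \<le> real N" using N0 by linarith
        then have "x \<in> {- (real N + 1 / 2)..real N + 1 / 2}" by (auto simp: abs_le_iff)
        then show ?case by simp
      qed
      then show "(\<lambda>N. indicator {- (real N + 1 / 2)..real N + 1 / 2} x *\<^sub>R f x) \<longlonglongrightarrow> f x"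
        by (rule tendsto_eventually)
    qed
  qed (use f in \<open>auto intro!: AE_I2 simp: indicator_def\<close>)
  moreover have "(LINT x|lborel. indicator {- (real N + 1 / 2)..real N + 1 / 2} x *\<^sub>R f x) =
      integral {- (real N + 1 / 2)..real N + 1 / 2} f" for N
  proof -
    have "set_integrable lborel {- (real N + 1 / 2)..real N + 1 / 2} f"
      unfolding set_integrable_def using f by (intro integrable_mult_indicator) auto
    from set_borel_integral_eq_integral(2)[OF this] show ?thesis
      by (simp add: set_lebesgue_integral_def)
  qed
  ultimately show ?thesis by simp
qed

lemma integrable_gauss_unity:
  assumes "s > 0"
  shows "integrable lborel (\<lambda>x. complex_of_real (gauss s (v + x)) * unity (j * x))"
  by (rule Bochner_Integration.integrable_bound[OF integrable_gauss[OF assms, of v]])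
    (auto simp: norm_mult)

lemma filterlim_symmetric_intervals:
  "filterlim (\<lambda>N. {- int N..int N}) (finite_subsets_at_top UNIV) sequentially"
  unfolding filterlim_finite_subsets_at_top
proof (intro allI impI)
  fix X :: "int set" assume X: "finite X \<and> X \<subseteq> UNIV"
  obtain B where B: "\<And>x. x \<in> X \<Longrightarrow> \<bar>x\<bar> \<le> int B"
  proof -
    have "\<bar>x\<bar> \<le> int (nat (\<Sum>x\<in>X. \<bar>x\<bar>))" if "x \<in> X" for x
      using member_le_sum[of x X "\<lambda>x. \<bar>x\<bar>"] that X by simp
    then show ?thesis using that by blast
  qed
  show "\<forall>\<^sub>F N in sequentially. finite {- int N..int N} \<and> X \<subseteq> {- int N..int N} \<and> {- int N..int N} \<subseteq> UNIV"
    using eventually_ge_at_top[of B]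
  proof eventually_elim
    case (elim N)
    then show ?case using B by (force simp: abs_le_iff)
  qed
qed

lemma uniform_limit_gauss_periods:
  assumes s: "s > 0"
  shows "uniform_limit {- (1 / 2)..1 / 2} (\<lambda>N x. \<Sum>m\<in>{- int N..int N}. gauss s (v + (x + of_int m)) * cos_kernel n x)
    (\<lambda>x. infsum (\<lambda>m :: int. gauss s (of_int m + (v + x))) UNIV * cos_kernel n x) sequentially"
proof -
  have "uniform_limit {- (1 / 2)..1 / 2} (\<lambda>X x. \<Sum>m\<in>X. gauss s (of_int m + (v + x)) * cos_kernel n x)
    (\<lambda>x. infsum (\<lambda>m :: int. gauss s (of_int m + (v + x)) * cos_kernel n x) UNIV) (finite_subsets_at_top UNIV)"
  proof (rule Weierstrass_m_test_general[OF _ gauss_majorant_summable[OF s]])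
    fix m :: int and x :: real assume x: "x \<in> {- (1 / 2)..1 / 2}"
    have "norm (gauss s (of_int m + (v + x)) * cos_kernel n x) \<le> gauss s (of_int m + (v + x))"
      using cos_kernel_nonneg[of n x] cos_kernel_le_1[of n x] gauss_pos[of s "of_int m + (v + x)"]
      by (simp add: abs_mult mult_left_le)
    also have "\<dots> \<le> exp (pi * s * (\<bar>v\<bar> + 1 / 2)\<^sup>2) * exp (- (pi * s / 2)) ^ nat \<bar>m\<bar>"
      using x by (intro gauss_le_geometric[OF s]) (auto simp: abs_if)
    finally show "norm (gauss s (of_int m + (v + x)) * cos_kernel n x) \<le>
        exp (pi * s * (\<bar>v\<bar> + 1 / 2)\<^sup>2) * exp (- (pi * s / 2)) ^ nat \<bar>m\<bar>" .
  qed
  then have "uniform_limit {- (1 / 2)..1 / 2} (\<lambda>N x. \<Sum>m\<in>{- int N..int N}. gauss s (of_int m + (v + x)) * cos_kernel n x)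
    (\<lambda>x. infsum (\<lambda>m :: int. gauss s (of_int m + (v + x)) * cos_kernel n x) UNIV) sequentially"
    by (rule filterlim_compose) (rule filterlim_symmetric_intervals)
  then show ?thesis
    by (simp add: infsum_cmult_left' add_ac)
qed

text \<open>Unfolding: the kernel has period 1, so an integral over the line becomes one over a
  period of the sum of all translates of the Gaussian.\<close>

lemma integral_gauss_kernel:
  assumes s: "s > 0"
  shows "(LINT x|lborel. gauss s (v + x) * cos_kernel n x)
    = integral {- (1 / 2)..1 / 2} (\<lambda>x. infsum (\<lambda>m :: int. gauss s (of_int m + (v + x))) UNIV * cos_kernel n x)"
proof -
  let ?I = "{- (1 / 2)..1 / 2 :: real}"
  define h where "h x = gauss s (v + x) * cos_kernel n x" for x
  have h: "integrable lborel h"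
    unfolding h_def
    by (rule Bochner_Integration.integrable_bound[OF integrable_gauss[OF s, of v]])
      (auto simp: abs_mult cos_kernel_nonneg cos_kernel_le_1 mult_left_le gauss_pos less_imp_le)
  have hc: "continuous_on UNIV h"
    unfolding h_def by (intro continuous_intros)
  have "(\<lambda>N. integral {- (real N + 1 / 2)..real N + 1 / 2} h) \<longlonglongrightarrow> (LINT x|lborel. h x)"
    by (rule lebesgue_integral_exhaust[OF h])
  moreover have "integral {- (real N + 1 / 2)..real N + 1 / 2} h =
      integral ?I (\<lambda>x. \<Sum>m\<in>{- int N..int N}. gauss s (v + (x + of_int m)) * cos_kernel n x)" for N
  proof -
    have "integral ?I (\<lambda>x. \<Sum>m\<in>{- int N..int N}. gauss s (v + (x + of_int m)) * cos_kernel n x)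
      = (\<Sum>m\<in>{- int N..int N}. integral ?I (\<lambda>x. gauss s (v + (x + of_int m)) * cos_kernel n x))"
      by (rule integral_sum) (auto intro!: integrable_continuous_real continuous_intros)
    then show ?thesis unfolding integral_symmetric_periods[OF hc] h_def cos_kernel_periodic by simp
  qed
  moreover have "(\<lambda>N. integral ?I (\<lambda>x. \<Sum>m\<in>{- int N..int N}. gauss s (v + (x + of_int m)) * cos_kernel n x))
    \<longlonglongrightarrow> integral ?I (\<lambda>x. infsum (\<lambda>m :: int. gauss s (of_int m + (v + x))) UNIV * cos_kernel n x)"
  proof -
    have "\<And>N. continuous_on ?I (\<lambda>x. \<Sum>m\<in>{- int N..int N}. gauss s (v + (x + of_int m)) * cos_kernel n x)"
      by (intro continuous_intros)
    from uniform_limit_integral[OF uniform_limit_gauss_periods[OF s] this] obtain I J where IJ: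
      "\<And>N. ((\<lambda>x. \<Sum>m\<in>{- int N..int N}. gauss s (v + (x + of_int m)) * cos_kernel n x) has_integral I N) ?I"
      "((\<lambda>x. infsum (\<lambda>m :: int. gauss s (of_int m + (v + x))) UNIV * cos_kernel n x) has_integral J) ?I"
      "I \<longlonglongrightarrow> J" by auto
    then show ?thesis unfolding integral_unique[OF IJ(1)] integral_unique[OF IJ(2)] by simp
  qed
  ultimately show ?thesis unfolding h_def using LIMSEQ_unique by simp
qed

lemma continuous_gauss_periodization:
  assumes s: "s > 0"
  shows "continuous_on {- (1 / 2)..1 / 2} (\<lambda>x. infsum (\<lambda>m :: int. gauss s (of_int m + (v + x))) UNIV)"
proof -
  have "uniform_limit {- (1 / 2)..1 / 2} (\<lambda>N x. \<Sum>m\<in>{- int N..int N}. gauss s (v + (x + of_int m)) * cos_kernel 0 x)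
    (\<lambda>x. infsum (\<lambda>m :: int. gauss s (of_int m + (v + x))) UNIV * cos_kernel 0 x) sequentially"
    by (rule uniform_limit_gauss_periods[OF s])
  then have "continuous_on {- (1 / 2)..1 / 2} (\<lambda>x. infsum (\<lambda>m :: int. gauss s (of_int m + (v + x))) UNIV * cos_kernel 0 x)"
    by (rule uniform_limit_theorem[rotated]) (auto intro!: always_eventually continuous_intros)
  then show ?thesis by (simp add: cos_kernel_def)
qed

text \<open>The weight of the Fourier mode \<open>k\<close> in the kernel relative to mode 0; since
  it tends to 1, every fixed mode is recovered in the limit.\<close>

lemma central_ratio_tendsto:
  "(\<lambda>n. real ((2 * n) choose (n + k)) / real ((2 * n) choose n)) \<longlonglongrightarrow> 1"
proof (induction k)
  case 0
  then show ?case by simp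
next
  case (Suc k)
  have "(\<lambda>n. real ((2 * n) choose (n + k)) / real ((2 * n) choose n) * ((real n - real k) / (real n + real k + 1))) \<longlonglongrightarrow> 1 * 1"
    by (intro tendsto_mult Suc) real_asymp
  moreover have "eventually (\<lambda>n. real ((2 * n) choose (n + k)) / real ((2 * n) choose n) * ((real n - real k) / (real n + real k + 1))
      = real ((2 * n) choose (n + Suc k)) / real ((2 * n) choose n)) sequentially"
    using eventually_ge_at_top[of k]
  proof eventually_elim
    case (elim n)
    have "Suc (n + k) * ((2 * n) choose Suc (n + k)) = (2 * n - (n + k)) * ((2 * n) choose (n + k))"
      by (metis binomial_absorb_comp binomial_absorption)
    then have "real (Suc (n + k)) * real ((2 * n) choose Suc (n + k)) = (real n - real k) * real ((2 * n) choose (n + k))"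
      using elim by (metis (no_types, lifting) of_nat_mult of_nat_diff mult_2 diff_cancel2 add_diff_cancel_left)
    then have "(real n + real k + 1) * real ((2 * n) choose (n + Suc k)) = (real n - real k) * real ((2 * n) choose (n + k))"
      by (simp only: of_nat_Suc of_nat_add add_Suc_right add.commute[of 1])
    then have B: "real ((2 * n) choose (n + Suc k)) = (real n - real k) * real ((2 * n) choose (n + k)) / (real n + real k + 1)"
      by (subst eq_divide_eq) (simp only: mult.commute[of "real n + real k + 1"], auto)
    show ?case unfolding B by (simp add: mult.commute)
  qed
  ultimately show ?case using tendsto_cong by force
qed

text \<open>The integral of the shifted Gaussian against the normalised kernel is evaluated twice.
  Expanding the kernel gives the Fourier side with weights tending to 1; unfolding gives the
  periodised Gaussian averaged ever closer to 0.\<close>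

theorem poisson_gauss:
  assumes s: "s > 0"
  shows "complex_of_real (infsum (\<lambda>m :: int. gauss s (of_int m + v)) UNIV) =
    infsum (\<lambda>j :: int. of_real (gauss (1 / s) (of_int j) / sqrt s) * unity (- (of_int j * v))) UNIV"
proof -
  define a where "a j = of_real (gauss (1 / s) (of_int j) / sqrt s) * unity (- (of_int j * v))" for j :: int
  have a_norm: "norm (a j) = gauss (1 / s) (of_int j) / sqrt s" for j
    using s gauss_pos[of "1 / s" "of_int j"] by (simp add: a_def norm_mult norm_divide)
  have a_sum: "(\<lambda>j. norm (a j)) summable_on UNIV"
    unfolding a_norm divide_inverse[of "gauss _ _"]
    using gauss_summable[of "1 / s" 0] s by (intro summable_on_cmult_left) simp
  let ?I = "{- (1 / 2)..1 / 2 :: real}"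
  define M where "M n = integral ?I (cos_kernel n)" for n
  define f where "f n j = (if \<bar>j\<bar> \<le> int n then of_real (real ((2 * n) choose nat (int n + j)) / real ((2 * n) choose n)) else 0) * a j" for n j
  have J: "(LINT x|lborel. complex_of_real (gauss s (v + x)) * unity (of_int j * x)) = a j" for j :: int
    unfolding integral_gauss_shift[OF s] a_def by (simp add: gauss_def)
  have "complex_of_real ((LINT x|lborel. gauss s (v + x) * cos_kernel n x) / M n) = infsum (f n) UNIV" for n
  proof -
    have "complex_of_real (LINT x|lborel. gauss s (v + x) * cos_kernel n x) =
        (LINT x|lborel. complex_of_real (gauss s (v + x) * cos_kernel n x))"
      by (rule integral_complex_of_real[symmetric])
    also have "\<dots> = (LINT x|lborel. (\<Sum>k\<le>2 * n. of_nat ((2 * n) choose k) / 4 ^ n * (complex_of_real (gauss s (v + x)) * unity (of_int (int k - int n) * x))))"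
      unfolding of_real_mult cos_kernel_expand
      by (intro Bochner_Integration.integral_cong refl) (simp add: sum_distrib_left sum_divide_distrib mult_ac)
    also have "\<dots> = (\<Sum>k\<le>2 * n. of_nat ((2 * n) choose k) / 4 ^ n * a (int k - int n))"
      by (subst Bochner_Integration.integral_sum)
        (auto intro!: integrable_mult_right integrable_gauss_unity[OF s] simp: J simp del: of_int_diff)
    also have "\<dots> = (\<Sum>j\<in>{- int n..int n}. of_nat ((2 * n) choose nat (int n + j)) / 4 ^ n * a j)"
      by (rule sum.reindex_bij_witness[of _ "\<lambda>j. nat (int n + j)" "\<lambda>k. int k - int n"]) auto
    finally have "complex_of_real ((LINT x|lborel. gauss s (v + x) * cos_kernel n x) / M n)
      = (\<Sum>j\<in>{- int n..int n}. of_nat ((2 * n) choose nat (int n + j)) / 4 ^ n * a j) / of_real (M n)"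
      by simp
    also have "\<dots> = (\<Sum>j\<in>{- int n..int n}. f n j)"
      unfolding sum_divide_distrib M_def integral_cos_kernel
      by (intro sum.cong refl) (auto simp: f_def)
    also have "\<dots> = infsum (f n) {- int n..int n}" by simp
    also have "\<dots> = infsum (f n) UNIV"
      by (rule infsum_cong_neutral) (auto simp: f_def)
    finally show ?thesis .
  qed
  moreover have "(\<lambda>n. infsum (f n) UNIV) \<longlonglongrightarrow> infsum a UNIV"
  proof (rule tannery_infsum[OF _ a_sum])
    fix n j
    \<comment> \<open>The central binomial coefficient is the largest one, so the weights are at
      most 1 and the norms of \<open>a\<close> are a majorant.\<close>
    have "real ((2 * n) choose nat (int n + j)) / real ((2 * n) choose n) \<le> 1"
      using binomial_maximum'[of n "nat (int n + j)"] by simp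
    then have "norm (complex_of_real (real ((2 * n) choose nat (int n + j)) / real ((2 * n) choose n))) \<le> 1"
      unfolding norm_of_real by simp
    then show "norm (f n j) \<le> norm (a j)"
      unfolding f_def norm_mult by (intro mult_left_le_one_le) (simp_all del: of_real_divide)
  next
    fix j :: int
    define k where "k = nat \<bar>j\<bar>"
    have "(\<lambda>n. complex_of_real (real ((2 * n) choose (n + k)) / real ((2 * n) choose n)) * a j) \<longlonglongrightarrow> of_real 1 * a j"
      by (intro tendsto_intros central_ratio_tendsto)
    moreover have "eventually (\<lambda>n. complex_of_real (real ((2 * n) choose (n + k)) / real ((2 * n) choose n)) * a j = f n j) sequentially"
      using eventually_ge_at_top[of k]
    proof eventually_elim
      case (elim n)
      have "(2 * n) choose (n + k) = (2 * n) choose nat (int n + j)"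
      proof (cases "j \<ge> 0")
        case True
        then show ?thesis by (simp add: k_def nat_add_distrib)
      next
        case False
        then have "nat (int n + j) = 2 * n - (n + k)" using elim by (simp add: k_def)
        then show ?thesis using binomial_symmetric[of "n + k" "2 * n"] elim by simp
      qed
      then show ?case using elim by (simp add: f_def k_def)
    qed
    ultimately show "(\<lambda>n. f n j) \<longlonglongrightarrow> a j"
      using tendsto_cong by force
  qed
  ultimately have "(\<lambda>n. complex_of_real ((LINT x|lborel. gauss s (v + x) * cos_kernel n x) / M n)) \<longlonglongrightarrow> infsum a UNIV"
    by simp
  moreover have "(\<lambda>n. complex_of_real ((LINT x|lborel. gauss s (v + x) * cos_kernel n x) / M n)) \<longlonglongrightarrow>
      complex_of_real (infsum (\<lambda>m :: int. gauss s (of_int m + (v + 0))) UNIV)"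
    unfolding integral_gauss_kernel[OF s] M_def
    by (intro tendsto_of_real cos_kernel_approximates continuous_gauss_periodization s)
  ultimately show ?thesis
    unfolding a_def using LIMSEQ_unique by simp
qed

subsection \<open>Theta series and their transformation\<close>

lemma has_sum_product_abs:
  fixes f :: "'a \<Rightarrow> complex" and g :: "'b \<Rightarrow> complex"
  assumes f: "(\<lambda>x. norm (f x)) summable_on A" and g: "(\<lambda>y. norm (g y)) summable_on B"
  shows "((\<lambda>(x, y). f x * g y) has_sum infsum f A * infsum g B) (A \<times> B)"
    and "(\<lambda>(x, y). norm (f x * g y)) summable_on A \<times> B"
proof -
  have "(\<lambda>(x, y). norm (f x * g y)) summable_on Sigma A (\<lambda>_. B)"
  proof (rule summable_on_SigmaI[where g = "\<lambda>x. norm (f x) * infsum (\<lambda>y. norm (g y)) B"])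
    show "((\<lambda>y. case (x, y) of (x, y) \<Rightarrow> norm (f x * g y)) has_sum norm (f x) * infsum (\<lambda>y. norm (g y)) B) B" for x
      unfolding norm_mult prod.case by (intro has_sum_cmult_right has_sum_infsum g)
    show "(\<lambda>x. norm (f x) * infsum (\<lambda>y. norm (g y)) B) summable_on A"
      using f by (rule summable_on_cmult_left)
  qed simp
  then show *: "(\<lambda>(x, y). norm (f x * g y)) summable_on A \<times> B" .
  have "(\<lambda>p. norm (case p of (x, y) \<Rightarrow> f x * g y)) summable_on A \<times> B"
    using * by (simp add: split_def)
  then have s: "(\<lambda>(x, y). f x * g y) summable_on A \<times> B"
    by (rule abs_summable_summable)
  show "((\<lambda>(x, y). f x * g y) has_sum infsum f A * infsum g B) (A \<times> B)"
  proof (rule has_sum_SigmaI[where g = "\<lambda>x. f x * infsum g B"])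
    fix x
    show "((\<lambda>y. case (x, y) of (x, y) \<Rightarrow> f x * g y) has_sum f x * infsum g B) B"
      unfolding prod.case by (intro has_sum_cmult_right has_sum_infsum abs_summable_summable[OF g])
  next
    show "((\<lambda>x. f x * infsum g B) has_sum infsum f A * infsum g B) A"
      by (intro has_sum_cmult_left has_sum_infsum abs_summable_summable[OF f])
  qed (rule s)
qed

lemma has_sum_finite_family:
  fixes f :: "'i \<Rightarrow> 'a \<Rightarrow> complex"
  assumes "\<And>i. i \<in> I \<Longrightarrow> (f i has_sum s i) A"
  shows "((\<lambda>x. \<Sum>i\<in>I. f i x) has_sum (\<Sum>i\<in>I. s i)) A"
  using assms by (induction I rule: infinite_finite_induct) (auto intro!: has_sum_add)

lemma has_sum_residue_class:
  fixes f :: "int \<Rightarrow> complex"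
  assumes L: "L > 0" and f: "((\<lambda>m. f (int L * m + a)) has_sum s) UNIV"
  shows "((\<lambda>x. of_bool (int L dvd x - a) * f x) has_sum s) UNIV"
proof -
  define h where "h m = int L * m + a" for m
  have inj: "inj h" using L by (auto simp: inj_def h_def)
  have "(f has_sum s) (range h)"
    unfolding has_sum_reindex[OF inj] using f by (simp add: o_def h_def)
  then show ?thesis
  proof (rule has_sum_cong_neutral[THEN iffD1, rotated -1])
    show "of_bool (int L dvd x - a) * f x = 0" if "x \<in> UNIV - range h" for x :: int
    proof -
      have "\<not> int L dvd x - a"
      proof
        assume "int L dvd x - a"
        then obtain m where "x - a = int L * m" by blast
        then have "x = h m" by (simp add: h_def)
        then show False using that by blast
      qed
      then show ?thesis by simp
    qed
  qed (auto simp: h_def)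
qed

context binary_theta
begin

definition qform :: "int \<times> int \<Rightarrow> nat" where
  "qform p = nat (int \<alpha> * fst p ^ 2 + int \<beta> * snd p ^ 2)"

definition theta :: "(int \<Rightarrow> int \<Rightarrow> complex) \<Rightarrow> complex fps" where
  "theta \<phi> = Abs_fps (\<lambda>n. \<Sum>p | qform p = n. \<phi> (fst p) (snd p))"

lemma int_qform: "int (qform p) = int \<alpha> * fst p ^ 2 + int \<beta> * snd p ^ 2"
  unfolding qform_def by simp

lemma abs_le_qform: "\<bar>fst p\<bar> \<le> int (qform p)" "\<bar>snd p\<bar> \<le> int (qform p)"
    "\<bar>fst p\<bar> + \<bar>snd p\<bar> \<le> int (qform p)"
proof -
  have sq: "\<bar>x\<bar> \<le> int c * x ^ 2" if "c > 0" for x :: int and c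
  proof (cases "x = 0")
    case False
    have "\<bar>x\<bar> * 1 \<le> \<bar>x\<bar> * \<bar>x\<bar>" using False by (intro mult_left_mono) auto
    also have "\<dots> = x ^ 2" by (simp add: power2_eq_square abs_mult_self_eq)
    also have "\<dots> \<le> int c * x ^ 2"
      using mult_right_mono[of 1 "int c" "x ^ 2"] that by simp
    finally show ?thesis by simp
  qed simp
  have "\<bar>fst p\<bar> + \<bar>snd p\<bar> \<le> int (qform p)"
    unfolding int_qform by (intro add_mono sq \<alpha>_pos \<beta>_pos)
  then show "\<bar>fst p\<bar> \<le> int (qform p)" "\<bar>snd p\<bar> \<le> int (qform p)"
    "\<bar>fst p\<bar> + \<bar>snd p\<bar> \<le> int (qform p)" by linarith+
qed

lemma finite_qform: "finite {p. qform p = n}"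
proof (rule finite_subset)
  show "{p. qform p = n} \<subseteq> {- int n..int n} \<times> {- int n..int n}"
  proof
    fix p assume "p \<in> {p. qform p = n}"
    then show "p \<in> {- int n..int n} \<times> {- int n..int n}"
      using abs_le_qform(1,2)[of p] by (cases p) auto
  qed
qed simp

text \<open>The form dominates the sum of the absolute values of the coordinates, so a product of
  two geometric series is a majorant.\<close>

lemma theta_summable:
  fixes q :: complex
  assumes B: "\<And>x y. norm (\<phi> x y) \<le> B" and q: "norm q < 1"
  shows "(\<lambda>p. norm (\<phi> (fst p) (snd p) * q ^ qform p)) summable_on UNIV"
proof (rule Infinite_Sum.abs_summable_on_comparison_test')
  have s: "(\<lambda>n :: int. norm (complex_of_real (norm q ^ nat \<bar>n\<bar>))) summable_on UNIV"
    using summable_on_power_abs_int[of "norm q"] q by (simp add: norm_power)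
  have "(\<lambda>(x :: int, y :: int). norm (complex_of_real (norm q ^ nat \<bar>x\<bar>) * complex_of_real (norm q ^ nat \<bar>y\<bar>))) summable_on UNIV \<times> UNIV"
    by (rule has_sum_product_abs(2)[OF s s])
  then have "(\<lambda>p :: int \<times> int. norm q ^ nat \<bar>fst p\<bar> * norm q ^ nat \<bar>snd p\<bar>) summable_on UNIV"
    by (simp add: split_def norm_mult norm_power)
  then show "(\<lambda>p :: int \<times> int. B * (norm q ^ nat \<bar>fst p\<bar> * norm q ^ nat \<bar>snd p\<bar>)) summable_on UNIV"
    by (rule summable_on_cmult_right)
next
  fix p :: "int \<times> int"
  have "norm q ^ qform p \<le> norm q ^ (nat \<bar>fst p\<bar> + nat \<bar>snd p\<bar>)"
    using abs_le_qform(3)[of p] q by (intro power_decreasing) auto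
  then have "norm (\<phi> (fst p) (snd p)) * norm q ^ qform p \<le> B * norm q ^ (nat \<bar>fst p\<bar> + nat \<bar>snd p\<bar>)"
    using B[of "fst p" "snd p"] by (intro mult_mono) (auto intro: order_trans[OF norm_ge_zero])
  then show "norm (\<phi> (fst p) (snd p) * q ^ qform p) \<le> B * (norm q ^ nat \<bar>fst p\<bar> * norm q ^ nat \<bar>snd p\<bar>)"
    by (simp add: norm_mult norm_power power_add)
qed

lemma theta_has_sum_nat:
  fixes q :: complex
  assumes B: "\<And>x y. norm (\<phi> x y) \<le> B" and q: "norm q < 1"
  shows "((\<lambda>n. fps_nth (theta \<phi>) n * q ^ n) has_sum
    infsum (\<lambda>p. \<phi> (fst p) (snd p) * q ^ qform p) UNIV) UNIV"
proof -
  let ?f = "\<lambda>p. \<phi> (fst p) (snd p) * q ^ qform p"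
  have "(\<lambda>p. norm (\<phi> (fst p) (snd p) * q ^ qform p)) summable_on UNIV"
    by (rule theta_summable[OF B q])
  then have "(?f has_sum infsum ?f UNIV) UNIV"
    by (rule has_sum_infsum[OF abs_summable_summable])
  then have "((\<lambda>(n, p). ?f p) has_sum infsum ?f UNIV) (Sigma UNIV (\<lambda>n. {p. qform p = n}))"
    by (rule has_sum_reindex_bij_witness[of _ "\<lambda>(n, p). p" "\<lambda>p. (qform p, p)", THEN iffD1, rotated -1]) auto
  then show ?thesis
  proof (rule has_sum_SigmaD)
    fix n
    have "((\<lambda>p. ?f p) has_sum (\<Sum>p | qform p = n. ?f p)) {p. qform p = n}"
      by (rule has_sum_finite[OF finite_qform])
    moreover have "(\<Sum>p | qform p = n. ?f p) = fps_nth (theta \<phi>) n * q ^ n"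
      by (simp add: theta_def sum_distrib_right)
    ultimately show "((\<lambda>p. case (n, p) of (n, p) \<Rightarrow> ?f p) has_sum fps_nth (theta \<phi>) n * q ^ n) {p. qform p = n}"
      by simp
  qed
qed

lemma theta_conv_radius:
  assumes B: "\<And>x y. norm (\<phi> x y) \<le> B"
  shows "fps_conv_radius (theta \<phi>) \<ge> 1"
  unfolding fps_conv_radius_def
proof (rule conv_radius_geI_ex')
  fix r :: real assume "0 < r" "ereal r < 1"
  then have "norm (complex_of_real r) < 1" by simp
  from has_sum_imp_sums[OF theta_has_sum_nat[OF B this]] show "summable (\<lambda>n. fps_nth (theta \<phi>) n * of_real r ^ n)"
    by (auto simp: sums_iff)
qed

lemma eval_theta:
  fixes q :: complex
  assumes B: "\<And>x y. norm (\<phi> x y) \<le> B" and q: "norm q < 1"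
  shows "eval_fps (theta \<phi>) q = infsum (\<lambda>p. \<phi> (fst p) (snd p) * q ^ qform p) UNIV"
  unfolding eval_fps_def using has_sum_imp_sums[OF theta_has_sum_nat[OF B q]] by (simp add: sums_iff)

lemma theta_opT: "fps_nth (theta (opT \<phi>)) n = unity (n / (2 * E)) * fps_nth (theta \<phi>) n"
proof -
  have "opT \<phi> (fst p) (snd p) = unity (n / (2 * E)) * \<phi> (fst p) (snd p)" if "qform p = n" for p
  proof -
    have "real n = \<alpha> * real_of_int (fst p) ^ 2 + \<beta> * real_of_int (snd p) ^ 2"
    proof -
      have "real n = real_of_int (int (qform p))" using that by simp
      then show ?thesis unfolding int_qform by simp
    qed
    moreover have "\<alpha> * real_of_int (fst p) ^ 2 / (2 * E) = real_of_int (fst p) ^ 2 / (2 * L1)"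
      unfolding level1[symmetric] using \<alpha>_pos by simp
    moreover have "\<beta> * real_of_int (snd p) ^ 2 / (2 * E) = real_of_int (snd p) ^ 2 / (2 * L2)"
      unfolding level2[symmetric] using \<beta>_pos by simp
    ultimately have "n / (2 * E) = of_int (fst p) ^ 2 / (2 * L1) + of_int (snd p) ^ 2 / (2 * L2)"
      by (simp add: add_divide_distrib)
    then show ?thesis by (simp add: opT_def)
  qed
  then show ?thesis by (simp add: theta_def sum_distrib_left)
qed

lemma nome_add_1: "nome E (z + 1) = unity (1 / (2 * E)) * nome E z"
  by (simp add: nome_def unity_def cis_conv_exp exp_add[symmetric] distrib_left add_divide_distrib add.commute)

lemma eval_theta_T:
  "eval_fps (theta \<phi>) (nome E (z + 1)) = eval_fps (theta (opT \<phi>)) (nome E z)"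
  unfolding eval_fps_def theta_opT nome_add_1 power_mult_distrib unity_power
  by (simp add: mult_ac)

lemma nome_imaginary: "nome E (\<i> * of_real y) = of_real (exp (- (pi * y / E)))"
proof -
  have "\<i> * pi * (\<i> * of_real y) / E = (\<i> * \<i>) * complex_of_real (pi * y / E)"
    by (simp add: mult_ac)
  then show ?thesis unfolding nome_def by (simp add: exp_of_real[symmetric])
qed

lemma per_bounded:
  assumes "per \<phi>"
  obtains B where "\<And>x y. norm (\<phi> x y) \<le> B"
proof -
  obtain B where "\<forall>w x y. norm (op_word w \<phi> x y) \<le> B" using op_word_bounded[OF assms] by blast
  then have "norm (\<phi> x y) \<le> B" for x y by (metis op_word.simps(1))
  then show ?thesis using that by blast
qed

lemma nome_power_level:
  assumes "c * L = E" "L > 0" "y > 0"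
  shows "exp (- (pi * y / E)) ^ nat (int c * x ^ 2) = gauss (y / L) (of_int x)"
proof -
  have E: "real E = real c * real L" using assms(1) by (simp flip: of_nat_mult)
  have "c > 0" using assms(1) E_pos by (cases c) auto
  have "real (nat (int c * x ^ 2)) = real c * of_int x ^ 2" by simp
  then have "exp (- (pi * y / E)) ^ nat (int c * x ^ 2) = exp (real c * of_int x ^ 2 * (- (pi * y / E)))"
    by (metis exp_of_nat_mult)
  also have "real c * of_int x ^ 2 * (- (pi * y / E)) = - (pi * (y / L) * (of_int x)\<^sup>2)"
    unfolding E using \<open>c > 0\<close> assms(2) by (simp add: field_simps)
  finally show ?thesis by (simp add: gauss_def)
qed

lemma nome_power_qform:
  assumes "y > 0"
  shows "exp (- (pi * y / E)) ^ qform p = gauss (y / L1) (of_int (fst p)) * gauss (y / L2) (of_int (snd p))"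
proof -
  have "qform p = nat (int \<alpha> * fst p ^ 2) + nat (int \<beta> * snd p ^ 2)"
    by (simp add: qform_def nat_add_distrib)
  then show ?thesis
    by (simp add: power_add nome_power_level[OF level1 L1_pos assms] nome_power_level[OF level2 L2_pos assms])
qed

text \<open>Poisson's formula along the progression \<open>L * m + a\<close>. The offset
  \<open>a / L\<close> turns into the phase from which the kernel of \<open>opS\<close> is later
  assembled.\<close>

lemma gauss_residue_has_sum:
  assumes L: "L > 0" and y: "y > 0"
  shows "((\<lambda>x :: int. of_bool (int L dvd x - a) * complex_of_real (gauss (1 / y / L) (of_int x))) has_sum
      of_real (sqrt (y / L)) * infsum (\<lambda>j :: int. of_real (gauss (y / L) (of_int j)) * unity (- (of_int j * of_int a / L))) UNIV) UNIV"
proof (rule has_sum_residue_class[OF L])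
  have g: "gauss (1 / y / L) (of_int (int L * m + a)) = gauss (L / y) (of_int m + of_int a / L)" for m
  proof -
    have "1 / y / L * (of_int (int L * m + a))\<^sup>2 = L / y * (of_int m + of_int a / L)\<^sup>2"
      using L y by (simp add: power2_eq_square field_simps)
    then show ?thesis unfolding gauss_def mult.assoc by simp
  qed
  have s: "L / y > 0" using L y by simp
  have "((\<lambda>m :: int. gauss (L / y) (of_int m + of_int a / L)) has_sum
      infsum (\<lambda>m :: int. gauss (L / y) (of_int m + of_int a / L)) UNIV) UNIV"
    by (intro has_sum_infsum gauss_summable s)
  then have "((\<lambda>m :: int. complex_of_real (gauss (1 / y / L) (of_int (int L * m + a)))) has_sum
      complex_of_real (infsum (\<lambda>m :: int. gauss (L / y) (of_int m + of_int a / L)) UNIV)) UNIV"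
    unfolding g by (rule has_sum_of_real)
  also have "complex_of_real (infsum (\<lambda>m :: int. gauss (L / y) (of_int m + of_int a / L)) UNIV)
     = infsum (\<lambda>j :: int. of_real (sqrt (y / L)) * (of_real (gauss (y / L) (of_int j)) * unity (- (of_int j * of_int a / L)))) UNIV"
    unfolding poisson_gauss[OF s]
    using L y by (intro infsum_cong) (simp add: real_sqrt_divide field_simps)
  also have "\<dots> = of_real (sqrt (y / L)) * infsum (\<lambda>j :: int. of_real (gauss (y / L) (of_int j)) * unity (- (of_int j * of_int a / L))) UNIV"
    by (rule infsum_cmult_right')
  finally show "((\<lambda>m :: int. complex_of_real (gauss (1 / y / L) (of_int (int L * m + a)))) has_sum
      of_real (sqrt (y / L)) * infsum (\<lambda>j :: int. of_real (gauss (y / L) (of_int j)) * unity (- (of_int j * of_int a / L))) UNIV) UNIV" .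
qed

text \<open>On the imaginary axis the series splits into products of one-dimensional sums over
  residue classes. The factors \<open>sqrt (y / L1)\<close> and \<open>sqrt (y / L2)\<close>
  multiply to \<open>y / sqrt (L1 * L2)\<close>: the weight 1 together with the normalisation of
  \<open>opS\<close>.\<close>

lemma theta_S_imaginary:
  assumes per: "per \<phi>" and y: "y > 0"
  shows "eval_fps (theta \<phi>) (nome E (\<i> * of_real (1 / y))) = of_real y * eval_fps (theta (opS \<phi>)) (nome E (\<i> * of_real y))"
proof -
  let ?A = "{0..<int L1}" and ?B = "{0..<int L2}"
  let ?I = "?A \<times> ?B"
  obtain B where B: "\<And>x y. norm (\<phi> x y) \<le> B" using per_bounded[OF per] by blast
  obtain B' where B': "\<And>x y. norm (opS \<phi> x y) \<le> B'" using per_bounded[OF per_opS] by blast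
  have q1: "norm (nome E (\<i> * of_real (1 / y))) < 1" "norm (nome E (\<i> * of_real y)) < 1"
    using y E_pos by (auto intro!: norm_nome_less_1)
  define G where "G L a = of_real (sqrt (y / real L)) * infsum (\<lambda>j :: int. of_real (gauss (y / real L) (of_int j)) * unity (- (of_int j * of_int a / real L))) UNIV"
    for L :: nat and a :: int
  define u where "u L a j = of_real (gauss (y / real L) (of_int j)) * unity (- (of_int j * of_int a / real L))"
    for L :: nat and a j :: int
  have abs_res: "(\<lambda>x :: int. norm (of_bool (int L dvd x - a) * complex_of_real (gauss (1 / y / L) (of_int x)))) summable_on UNIV" if "L > 0" for L a
  proof (rule Infinite_Sum.abs_summable_on_comparison_test')
    show "(\<lambda>x :: int. gauss (1 / y / L) (of_int x)) summable_on UNIV"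
      using gauss_summable[of "1 / y / L" 0] that y by simp
  qed (auto simp: norm_mult gauss_pos less_imp_le)
  have abs_u: "(\<lambda>j. norm (u L a j)) summable_on UNIV" if "L > 0" for L a
  proof (rule Infinite_Sum.abs_summable_on_comparison_test')
    show "(\<lambda>x :: int. gauss (y / L) (of_int x)) summable_on UNIV"
      using gauss_summable[of "y / L" 0] that y by simp
  qed (auto simp: u_def norm_mult gauss_pos less_imp_le)
  have res: "((\<lambda>(x, y'). (of_bool (int L1 dvd x - a) * complex_of_real (gauss (1 / y / L1) (of_int x))) *
      (of_bool (int L2 dvd y' - b) * complex_of_real (gauss (1 / y / L2) (of_int y')))) has_sum G L1 a * G L2 b) UNIV" for a b
  proof -
    have "G L1 a = infsum (\<lambda>x. of_bool (int L1 dvd x - a) * complex_of_real (gauss (1 / y / L1) (of_int x))) UNIV"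
      "G L2 b = infsum (\<lambda>x. of_bool (int L2 dvd x - b) * complex_of_real (gauss (1 / y / L2) (of_int x))) UNIV"
      unfolding G_def using gauss_residue_has_sum[OF L1_pos y, of a] gauss_residue_has_sum[OF L2_pos y, of b]
      by (simp_all add: infsumI)
    then show ?thesis
      using has_sum_product_abs(1)[OF abs_res[OF L1_pos, of a] abs_res[OF L2_pos, of b]] by simp
  qed
  have lhs: "((\<lambda>p. \<phi> (fst p) (snd p) * nome E (\<i> * of_real (1 / y)) ^ qform p) has_sum
      (\<Sum>i\<in>?I. \<phi> (fst i) (snd i) * (G L1 (fst i) * G L2 (snd i)))) UNIV"
  proof -
    have "((\<lambda>p. \<Sum>i\<in>?I. \<phi> (fst i) (snd i) * (case p of (x, y') \<Rightarrow> (of_bool (int L1 dvd x - fst i) * complex_of_real (gauss (1 / y / L1) (of_int x))) *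
      (of_bool (int L2 dvd y' - snd i) * complex_of_real (gauss (1 / y / L2) (of_int y'))))) has_sum
      (\<Sum>i\<in>?I. \<phi> (fst i) (snd i) * (G L1 (fst i) * G L2 (snd i)))) UNIV"
      by (intro has_sum_finite_family has_sum_cmult_right res)
    moreover have "(\<Sum>i\<in>?I. \<phi> (fst i) (snd i) * (case p of (x, y') \<Rightarrow> (of_bool (int L1 dvd x - fst i) * complex_of_real (gauss (1 / y / L1) (of_int x))) *
      (of_bool (int L2 dvd y' - snd i) * complex_of_real (gauss (1 / y / L2) (of_int y')))))
      = \<phi> (fst p) (snd p) * nome E (\<i> * of_real (1 / y)) ^ qform p" for p
    proof -
      have "\<phi> (fst p) (snd p) = (\<Sum>i\<in>?I. \<phi> (fst i) (snd i) * heis (- fst i, 0) (- snd i, 0) delta (fst p) (snd p))"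
        using per_expand[OF per] by metis
      moreover have "nome E (\<i> * of_real (1 / y)) ^ qform p =
          complex_of_real (gauss (1 / y / L1) (of_int (fst p)) * gauss (1 / y / L2) (of_int (snd p)))"
        unfolding nome_imaginary of_real_power[symmetric] nome_power_qform[OF divide_pos_pos[OF zero_less_one y]] ..
      ultimately show ?thesis
        by (simp add: sum_distrib_left split_def heis_def delta_def of_bool_conj mult_ac)
    qed
    ultimately show ?thesis by simp
  qed
  have rhs: "((\<lambda>p. opS \<phi> (fst p) (snd p) * nome E (\<i> * of_real y) ^ qform p) has_sum
      (\<Sum>i\<in>?I. \<phi> (fst i) (snd i) / of_real (sqrt (L1 * L2)) * (infsum (u L1 (fst i)) UNIV * infsum (u L2 (snd i)) UNIV))) UNIV"
  proof -
    have "((\<lambda>p. \<Sum>i\<in>?I. \<phi> (fst i) (snd i) / of_real (sqrt (L1 * L2)) * (case p of (x, y') \<Rightarrow> u L1 (fst i) x * u L2 (snd i) y')) has_sum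
      (\<Sum>i\<in>?I. \<phi> (fst i) (snd i) / of_real (sqrt (L1 * L2)) * (infsum (u L1 (fst i)) UNIV * infsum (u L2 (snd i)) UNIV))) (UNIV \<times> UNIV)"
      by (intro has_sum_finite_family has_sum_cmult_right has_sum_product_abs(1) abs_u L1_pos L2_pos)
    moreover have "(\<Sum>i\<in>?I. \<phi> (fst i) (snd i) / of_real (sqrt (L1 * L2)) * (case p of (x, y') \<Rightarrow> u L1 (fst i) x * u L2 (snd i) y'))
      = opS \<phi> (fst p) (snd p) * nome E (\<i> * of_real y) ^ qform p" for p
    proof -
      have 1: "nome E (\<i> * of_real y) ^ qform p =
          complex_of_real (gauss (y / L1) (of_int (fst p)) * gauss (y / L2) (of_int (snd p)))"
        unfolding nome_imaginary of_real_power[symmetric] nome_power_qform[OF y] ..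
      have 2: "unity (- (of_int a * of_int (fst p) / L1) - of_int b * of_int (snd p) / L2) =
         unity (- (of_int (fst p) * of_int a / L1)) * unity (- (of_int (snd p) * of_int b / L2))" for a b
        unfolding unity_add[symmetric] by (simp add: mult.commute)
      show ?thesis
        unfolding 1 opS_def 2 sum.cartesian_product
        by (simp add: sum_distrib_left sum_divide_distrib split_def u_def mult_ac)
    qed
    ultimately show ?thesis by simp
  qed
  have "(\<Sum>i\<in>?I. \<phi> (fst i) (snd i) * (G L1 (fst i) * G L2 (snd i))) =
      of_real y * (\<Sum>i\<in>?I. \<phi> (fst i) (snd i) / of_real (sqrt (L1 * L2)) * (infsum (u L1 (fst i)) UNIV * infsum (u L2 (snd i)) UNIV))"
  proof -
    have "sqrt (y / L1) * sqrt (y / L2) = y / sqrt (L1 * L2)"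
      using y by (simp add: real_sqrt_divide real_sqrt_mult)
    then have "complex_of_real (sqrt (y / L1)) * of_real (sqrt (y / L2)) = of_real y / of_real (sqrt (L1 * L2))"
      by (simp only: of_real_mult[symmetric] of_real_divide[symmetric])
    then have "\<phi> a b * (G L1 a * G L2 b) =
        of_real y * (\<phi> a b / of_real (sqrt (L1 * L2)) * (infsum (u L1 a) UNIV * infsum (u L2 b) UNIV))" for a b
    proof -
      assume sq: "complex_of_real (sqrt (y / L1)) * of_real (sqrt (y / L2)) = of_real y / of_real (sqrt (L1 * L2))"
      have "\<phi> a b * (G L1 a * G L2 b) = (complex_of_real (sqrt (y / L1)) * of_real (sqrt (y / L2))) * (\<phi> a b * (infsum (u L1 a) UNIV * infsum (u L2 b) UNIV))"
        unfolding G_def u_def by (simp only: mult_ac)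
      then show ?thesis unfolding sq by simp
    qed
    then show ?thesis by (simp add: sum_distrib_left)
  qed
  then show ?thesis
    unfolding eval_theta[OF B q1(1)] eval_theta[OF B' q1(2)] infsumI[OF lhs] infsumI[OF rhs] .
qed

lemma holomorphic_theta:
  assumes per: "per \<phi>" and f: "f holomorphic_on {z. Im z > 0}" "\<And>z. Im z > 0 \<Longrightarrow> Im (f z) > 0"
  shows "(\<lambda>z. eval_fps (theta \<phi>) (nome E (f z))) holomorphic_on {z. Im z > 0}"
proof -
  obtain B where B: "\<And>x y. norm (\<phi> x y) \<le> B" using per_bounded[OF per] by blast
  have "(\<lambda>z. nome E (f z)) holomorphic_on {z. Im z > 0}"
    unfolding nome_def using E_pos by (intro holomorphic_intros f) auto
  moreover have "(\<lambda>z. nome E (f z)) ` {z. Im z > 0} \<subseteq> eball 0 (fps_conv_radius (theta \<phi>))"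
  proof safe
    fix z assume "Im z > 0"
    then have "norm (nome E (f z)) < 1" using f(2) E_pos by (intro norm_nome_less_1)
    then show "nome E (f z) \<in> eball 0 (fps_conv_radius (theta \<phi>))"
      using theta_conv_radius[OF B] by (auto simp: in_eball_iff intro: less_le_trans[of _ 1])
  qed
  ultimately show ?thesis
    using holomorphic_on_compose_gen[of "\<lambda>z. nome E (f z)" "{z. Im z > 0}" "eval_fps (theta \<phi>)" "eball 0 (fps_conv_radius (theta \<phi>))"]
      holomorphic_on_eval_fps[of _ "theta \<phi>"]
    by (auto simp: o_def)
qed

lemma Im_neg_inverse: "Im z > 0 \<Longrightarrow> Im (- 1 / z) > 0"
  by (auto simp: Im_divide intro!: divide_pos_pos add_nonneg_pos)

text \<open>Both sides are holomorphic in the upper half-plane and agree on the imaginary axis,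
  where \<open>- \<i> * z\<close> is the positive real \<open>y\<close> of
  \<open>theta_S_imaginary\<close>.\<close>

theorem eval_theta_S:
  assumes per: "per \<phi>" and z: "Im z > 0"
  shows "eval_fps (theta \<phi>) (nome E (- 1 / z)) = - \<i> * z * eval_fps (theta (opS \<phi>)) (nome E z)"
proof -
  let ?H = "{z. Im z > 0}"
  let ?f = "\<lambda>z. eval_fps (theta \<phi>) (nome E (- 1 / z)) - (- \<i> * z * eval_fps (theta (opS \<phi>)) (nome E z))"
  have "?f z = 0"
  proof (rule analytic_continuation[of ?f ?H "(\<lambda>y. \<i> * of_real y) ` {0<..}" \<i>])
    show "?f holomorphic_on ?H"
      using per by (intro holomorphic_intros holomorphic_theta per_opS Im_neg_inverse) auto
    show "open ?H" by (rule open_halfspace_Im_gt)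
    show "connected ?H" by (intro convex_connected convex_halfspace_Im_gt)
    show "\<i> islimpt (\<lambda>y. \<i> * of_real y) ` {0<..}"
      unfolding islimpt_approachable
    proof (intro allI impI)
      fix e :: real assume e: "e > 0"
      have "dist (\<i> * of_real (1 + e / 2)) \<i> = e / 2"
        using e by (simp add: dist_norm algebra_simps norm_mult)
      then show "\<exists>x'\<in>(\<lambda>y. \<i> * complex_of_real y) ` {0<..}. x' \<noteq> \<i> \<and> dist x' \<i> < e"
        using e by (intro bexI[of _ "\<i> * of_real (1 + e / 2)"] conjI image_eqI[of _ _ "1 + e / 2"]) auto
    qed
    show "?f x = 0" if x: "x \<in> (\<lambda>y. \<i> * of_real y) ` {0<..}" for x
    proof -
      obtain y where y: "x = \<i> * of_real y" "y > 0" using x by auto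
      have "- 1 / x = \<i> * of_real (1 / y)" using y by (simp add: field_simps)
      then show ?thesis using theta_S_imaginary[OF per y(2)] y(1) by simp
    qed
  qed (use z in auto)
  then show ?thesis by (simp only: right_minus_eq)
qed

end

subsection \<open>Integral relations and their reduction modulo 2\<close>

text \<open>Gaussian elimination: an equation with a nonzero coefficient at \<open>p\<close> is
  solved for the unknown at \<open>p\<close>, which is then removed from the other
  equations.\<close>

lemma homogeneous_system_nontrivial:
  fixes m :: "'e \<Rightarrow> 'i \<Rightarrow> 'a :: field"
  assumes "finite Eq" "finite I" "card Eq < card I"
  shows "\<exists>c. (\<exists>i\<in>I. c i \<noteq> 0) \<and> (\<forall>e\<in>Eq. (\<Sum>i\<in>I. c i * m e i) = 0)"
  using assms
proof (induction Eq arbitrary: I m rule: finite_induct)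
  case empty
  then obtain i where "i \<in> I" by fastforce
  then show ?case by (intro exI[of _ "\<lambda>_. 1"]) auto
next
  case (insert e Eq)
  show ?case
  proof (cases "\<forall>i\<in>I. m e i = 0")
    case True
    obtain c where "\<exists>i\<in>I. c i \<noteq> 0" "\<forall>e\<in>Eq. (\<Sum>i\<in>I. c i * m e i) = 0"
      using insert.IH[of I m] insert.prems insert.hyps by auto
    then show ?thesis using True by (intro exI[of _ c]) simp
  next
    case False
    then obtain p where p: "p \<in> I" "m e p \<noteq> 0" by blast
    define I' where "I' = I - {p}"
    have "card Eq < card I'" "finite I'"
      using insert.prems insert.hyps p by (auto simp: I'_def card_Diff_singleton)
    from insert.IH[OF this(2,1), of "\<lambda>e' i. m e' i - m e' p * m e i / m e p"] obtain c where
      c: "\<exists>i\<in>I'. c i \<noteq> 0" "\<forall>e'\<in>Eq. (\<Sum>i\<in>I'. c i * (m e' i - m e' p * m e i / m e p)) = 0" by blast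
    define c' where "c' i = (if i = p then - (\<Sum>i\<in>I'. c i * m e i) / m e p else c i)" for i
    have sum: "(\<Sum>i\<in>I. c' i * m e' i) = (\<Sum>i\<in>I'. c i * (m e' i - m e' p * m e i / m e p))" for e'
    proof -
      have "(\<Sum>i\<in>I. c' i * m e' i) = c' p * m e' p + (\<Sum>i\<in>I'. c' i * m e' i)"
        unfolding I'_def using p insert.prems by (intro sum.remove) auto
      also have "(\<Sum>i\<in>I'. c' i * m e' i) = (\<Sum>i\<in>I'. c i * m e' i)"
        by (intro sum.cong) (auto simp: c'_def I'_def)
      also have "c' p * m e' p + (\<Sum>i\<in>I'. c i * m e' i) = (\<Sum>i\<in>I'. c i * m e' i - c i * (m e' p * m e i / m e p))"
        unfolding c'_def sum_subtractf by (simp add: sum_distrib_left sum_distrib_right sum_divide_distrib mult_ac)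
      finally show ?thesis by (simp add: right_diff_distrib)
    qed
    have "(\<Sum>i\<in>I. c' i * m e i) = 0" unfolding sum using p by simp
    moreover have "\<exists>i\<in>I. c' i \<noteq> 0" using c(1) by (auto simp: c'_def I'_def)
    ultimately show ?thesis using c(2) sum by (intro exI[of _ c']) auto
  qed
qed

text \<open>Over the rationals, \<open>c\<close> extends to a basis of the complex numbers. Applied
  to the coefficients of a relation between integer vectors, the functional makes them rational and
  keeps the one equal to \<open>c\<close> from vanishing.\<close>

lemma rational_functional:
  fixes c :: complex
  assumes "c \<noteq> 0"
  obtains f :: "complex \<Rightarrow> rat"
  where "\<And>x y. f (x + y) = f x + f y" "\<And>q x. f (of_rat q * x) = q * f x" "f c \<noteq> 0"
proof -
  interpret C: vector_space "\<lambda>q z. of_rat q * z :: complex"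
    by unfold_locales (simp_all add: of_rat_add of_rat_mult distrib_left distrib_right mult.assoc)
  interpret Q: vector_space "(*) :: rat \<Rightarrow> rat \<Rightarrow> rat"
    by unfold_locales (simp_all add: distrib_left distrib_right mult.assoc)
  interpret P: vector_space_pair "\<lambda>q z. of_rat q * z :: complex" "(*) :: rat \<Rightarrow> rat \<Rightarrow> rat"
    by unfold_locales
  have "C.independent {c}" using assms by simp
  from P.linear_independent_extend[OF this, of "\<lambda>_. 1"] obtain f where
    f: "Vector_Spaces.linear (\<lambda>q z. of_rat q * z) (*) f" "f c = 1" by auto
  interpret f: Vector_Spaces.linear "\<lambda>q z. of_rat q * z :: complex" "(*) :: rat \<Rightarrow> rat \<Rightarrow> rat" f
    by (rule f(1))
  show ?thesis using that[of f] f.add f.scale f(2) by auto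
qed

text \<open>Division by the gcd leaves an odd coefficient, so that the relation stays nontrivial
  modulo 2.\<close>

lemma integer_relation_primitive:
  fixes D :: "'i \<Rightarrow> int"
  assumes "finite I" "i0 \<in> I" "D i0 \<noteq> 0"
  obtains d where "\<exists>i\<in>I. odd (d i)" "\<And>v :: 'i \<Rightarrow> int. (\<Sum>i\<in>I. D i * v i) = 0 \<Longrightarrow> (\<Sum>i\<in>I. d i * v i) = 0"
proof -
  define g where "g = Gcd (D ` I)"
  have g: "g \<noteq> 0" using assms by (auto simp: g_def)
  have dvd: "g dvd D i" if "i \<in> I" for i using that by (auto simp: g_def)
  define d where "d i = D i div g" for i
  have D: "D i = g * d i" if "i \<in> I" for i using dvd[OF that] by (simp add: d_def)
  have "\<exists>i\<in>I. odd (d i)"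
  proof (rule ccontr)
    assume "\<not> ?thesis"
    then have "2 * g dvd D i" if "i \<in> I" for i
      using D[OF that] that by (auto intro: mult_dvd_mono simp: mult.commute)
    then have "2 * g dvd g" unfolding g_def by (intro Gcd_greatest) auto
    then obtain k where "g * 1 = g * (2 * k)" by (auto simp: dvd_def mult_ac)
    then have "1 = 2 * k" using g by (simp only: mult_cancel_left) simp
    then show False by presburger
  qed
  moreover have "(\<Sum>i\<in>I. d i * v i) = 0" if "(\<Sum>i\<in>I. D i * v i) = 0" for v
  proof -
    have "(\<Sum>i\<in>I. D i * v i) = g * (\<Sum>i\<in>I. d i * v i)"
      by (simp add: D sum_distrib_left mult.assoc)
    then show ?thesis using that g by simp
  qed
  ultimately show ?thesis using that by blast
qed

text \<open>One family \<open>d\<close> serves every integer vector \<open>v\<close> that satisfies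
  the complex relation. In the application \<open>v\<close> runs through the coefficients of the
  monomials degree by degree, so an identity of series stays an identity of series.\<close>

lemma complex_relation_imp_integer:
  fixes c :: "'i \<Rightarrow> complex"
  assumes fin: "finite I" and i0: "i0 \<in> I" "c i0 \<noteq> 0"
  obtains d :: "'i \<Rightarrow> int" where "\<exists>i\<in>I. odd (d i)"
    "\<And>v :: 'i \<Rightarrow> int. (\<Sum>i\<in>I. c i * of_int (v i)) = 0 \<Longrightarrow> (\<Sum>i\<in>I. d i * v i) = 0"
proof -
  obtain f :: "complex \<Rightarrow> rat" where f: "\<And>x y. f (x + y) = f x + f y" "\<And>q x. f (of_rat q * x) = q * f x" "f (c i0) \<noteq> 0"
    using rational_functional[OF i0(2)] by blast
  \<comment> \<open>A common denominator of the rational values \<open>f (c i)\<close>.\<close>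
  define m where "m = (\<Prod>i\<in>I. snd (quotient_of (f (c i))))"
  have m0: "m \<noteq> 0" unfolding m_def using fin quotient_of_denom_pos' by (simp add: less_le)
  have "\<exists>D :: int. of_int D = of_int m * f (c i)" if i: "i \<in> I" for i
  proof -
    obtain k where k: "m = snd (quotient_of (f (c i))) * k"
      using dvd_prodI[OF fin i, of "\<lambda>i. snd (quotient_of (f (c i)))"] unfolding m_def by blast
    have "f (c i) = of_int (fst (quotient_of (f (c i)))) / of_int (snd (quotient_of (f (c i))))"
      by (rule quotient_of_div) simp
    moreover have "snd (quotient_of (f (c i))) \<noteq> 0" using quotient_of_denom_pos' by (metis less_irrefl)
    ultimately have "of_int m * f (c i) = of_int (k * fst (quotient_of (f (c i))))"
      unfolding k by (simp add: field_simps)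
    then show ?thesis by metis
  qed
  then obtain D :: "'i \<Rightarrow> int" where D: "\<And>i. i \<in> I \<Longrightarrow> of_int (D i) = of_int m * f (c i)" by metis
  have f0: "f 0 = 0" using f(1)[of 0 0] by simp
  have "D i0 \<noteq> 0"
  proof
    assume "D i0 = 0"
    then have "of_int m * f (c i0) = 0" using D[OF i0(1)] by simp
    then show False using f(3) m0 by simp
  qed
  from integer_relation_primitive[where D = D, OF fin i0(1) this] obtain d where
    d: "\<exists>i\<in>I. odd (d i)" "\<And>v :: 'i \<Rightarrow> int. (\<Sum>i\<in>I. D i * v i) = 0 \<Longrightarrow> (\<Sum>i\<in>I. d i * v i) = 0" by blast
  have "(\<Sum>i\<in>I. D i * v i) = 0" if "(\<Sum>i\<in>I. c i * of_int (v i)) = 0" for v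
  proof -
    have fs: "f (sum g J) = (\<Sum>i\<in>J. f (g i))" if "finite J" for g :: "'i \<Rightarrow> complex" and J
      using that by (induction J rule: finite_induct) (simp_all add: f f0)
    have fi: "f (c i * of_int (v i)) = of_int (v i) * f (c i)" for i
      using f(2)[of "of_int (v i)" "c i"] by (simp add: mult.commute)
    have "of_int (\<Sum>i\<in>I. D i * v i) = of_int m * (\<Sum>i\<in>I. of_int (v i) * f (c i))"
      by (simp add: D sum_distrib_left mult_ac)
    also have "(\<Sum>i\<in>I. of_int (v i) * f (c i)) = f (\<Sum>i\<in>I. c i * of_int (v i))"
      by (simp add: fs[OF fin] fi)
    also have "\<dots> = 0" by (simp add: that f0)
    finally have "of_int (\<Sum>i\<in>I. D i * v i) = (0 :: rat)" by (simp only: mult_zero_right)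
    then show ?thesis by (simp only: of_int_eq_0_iff)
  qed
  then show ?thesis using that d by blast
qed

definition fps_map :: "('a \<Rightarrow> 'b) \<Rightarrow> 'a fps \<Rightarrow> 'b fps" where
  "fps_map f F = Abs_fps (\<lambda>n. f (fps_nth F n))"

lemma fps_map_nth [simp]: "fps_nth (fps_map f F) n = f (fps_nth F n)"
  by (simp add: fps_map_def)

text \<open>Polymorphic in the target ring, so that one integral series can be viewed over
  \<open>complex\<close> and over \<open>bit\<close>.\<close>

abbreviation fps_int :: "int fps \<Rightarrow> 'a :: ring_1 fps" where
  "fps_int \<equiv> fps_map of_int"

lemma fps_int_add: "fps_int (F + G) = fps_int F + fps_int G"
  and fps_int_mult: "fps_int (F * G) = fps_int F * fps_int G"
  and fps_int_1: "fps_int 1 = 1"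
  and fps_int_0: "fps_int 0 = 0"
  and fps_int_diff: "fps_int (F - G) = fps_int F - fps_int G"
  and fps_int_const: "fps_int (fps_const c) = fps_const (of_int c)"
  by (rule fps_ext; simp add: fps_mult_nth)+

lemma fps_int_power: "fps_int (F ^ n) = fps_int F ^ n"
  by (induction n) (simp_all add: fps_int_mult fps_int_1)

lemma fps_int_sum: "fps_int (\<Sum>i\<in>I. F i) = (\<Sum>i\<in>I. fps_int (F i))"
  by (induction I rule: infinite_finite_induct) (simp_all add: fps_int_add fps_int_0)

lemma fps_int_prod: "fps_int (\<Prod>i\<in>I. F i) = (\<Prod>i\<in>I. (fps_int (F i) :: 'a :: comm_ring_1 fps))"
  by (induction I rule: infinite_finite_induct) (simp_all add: fps_int_mult fps_int_1)

lemma of_int_bit: "(of_int n :: bit) = of_bool (odd n)"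
proof -
  have "(of_int (2 * k) :: bit) = 0" for k :: int
    by (simp only: of_int_mult of_int_numeral) simp
  then have "(of_int (2 * k) :: bit) = 0" "(of_int (2 * k + 1) :: bit) = 1" for k :: int
    by (simp_all only: of_int_add of_int_1 add_0)
  then show ?thesis by (cases "even n") (auto elim!: evenE oddE simp del: of_int_mult of_int_add)
qed

text \<open>The least \<open>i\<close> with \<open>a i\<close> nonzero works: once the common power
  of \<open>F\<close> is cancelled, all other terms are multiples of \<open>F\<close>.\<close>

lemma fps_power_sum_zero_dvd:
  fixes F :: "'a :: idom fps"
  assumes "(\<Sum>i\<le>n. a i * F ^ i) = 0" "\<exists>i\<le>n. a i \<noteq> 0" "F \<noteq> 0"
  shows "\<exists>i\<le>n. a i \<noteq> 0 \<and> F dvd a i"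
  using assms(1,2)
proof (induction n arbitrary: a)
  case 0
  then show ?case by auto
next
  case (Suc n)
  have split: "(\<Sum>i\<le>Suc n. a i * F ^ i) = a 0 + F * (\<Sum>i\<le>n. a (Suc i) * F ^ i)"
    unfolding sum.atMost_Suc_shift by (simp add: sum_distrib_left mult_ac)
  show ?case
  proof (cases "a 0 = 0")
    case True
    then have "(\<Sum>i\<le>n. a (Suc i) * F ^ i) = 0" using Suc.prems(1) assms(3) split by simp
    moreover have "\<exists>i\<le>n. a (Suc i) \<noteq> 0"
      using Suc.prems(2) True by (metis Suc_le_mono not0_implies_Suc)
    ultimately obtain i where "i \<le> n" "a (Suc i) \<noteq> 0" "F dvd a (Suc i)"
      using Suc.IH[of "\<lambda>i. a (Suc i)"] by blast
    then show ?thesis by (intro exI[of _ "Suc i"]) simp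
  next
    case False
    have "a 0 = F * (- (\<Sum>i\<le>n. a (Suc i) * F ^ i))"
      using Suc.prems(1) split by (simp add: eq_neg_iff_add_eq_0)
    then have "F dvd a 0" by (rule dvdI)
    then show ?thesis using False by blast
  qed
qed

text \<open>Because \<open>G\<close> has positive order, the nonzero term with the least
  \<open>j\<close> dominates, and its order is \<open>j * subdegree G\<close>.\<close>

lemma subdegree_const_power_sum:
  fixes G :: "'a :: idom fps"
  assumes "\<exists>j\<le>n. d j \<noteq> 0" "subdegree G > 0"
  shows "(\<Sum>j\<le>n. fps_const (d j) * G ^ j) \<noteq> 0 \<and> subdegree (\<Sum>j\<le>n. fps_const (d j) * G ^ j) \<le> n * subdegree G"
  using assms(1)
proof (induction n arbitrary: d)
  case 0
  then show ?case by simp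
next
  case (Suc n)
  have G: "G \<noteq> 0" "fps_nth G 0 = 0" using assms(2) by (auto simp: nth_less_subdegree_zero)
  have split: "(\<Sum>j\<le>Suc n. fps_const (d j) * G ^ j) = fps_const (d 0) + G * (\<Sum>j\<le>n. fps_const (d (Suc j)) * G ^ j)"
    unfolding sum.atMost_Suc_shift by (simp add: sum_distrib_left mult_ac)
  show ?case
  proof (cases "d 0 = 0")
    case True
    then have "\<exists>j\<le>n. d (Suc j) \<noteq> 0"
      using Suc.prems by (metis Suc_le_mono not0_implies_Suc)
    from Suc.IH[OF this] show ?thesis unfolding split using True G by simp
  next
    case False
    have "fps_nth (\<Sum>j\<le>Suc n. fps_const (d j) * G ^ j) 0 \<noteq> 0"
      unfolding split using False G by simp
    then have "(\<Sum>j\<le>Suc n. fps_const (d j) * G ^ j) \<noteq> 0" "subdegree (\<Sum>j\<le>Suc n. fps_const (d j) * G ^ j) = 0"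
      by (metis fps_zero_nth, simp only: subdegree_eq_0_iff, simp)
    then show ?thesis by simp
  qed
qed

text \<open>The relation is read as a polynomial in \<open>F\<close> whose coefficients are
  polynomials in \<open>G\<close>: the lowest nonzero one is divisible by \<open>F\<close>, yet its
  order is at most \<open>A * subdegree G\<close>.\<close>

lemma subdegree_le_of_algebraic_relation:
  fixes F G :: "'a :: idom fps"
  assumes rel: "(\<Sum>i\<le>A. \<Sum>j\<le>A. fps_const (d (i, j)) * F ^ i * G ^ j) = 0"
    and d: "\<exists>i\<le>A. \<exists>j\<le>A. d (i, j) \<noteq> 0" and F: "F \<noteq> 0" and G: "subdegree G > 0"
  shows "subdegree F \<le> A * subdegree G"
proof -
  define a where "a i = (\<Sum>j\<le>A. fps_const (d (i, j)) * G ^ j)" for i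
  have "(\<Sum>i\<le>A. a i * F ^ i) = 0"
    using rel unfolding a_def sum_distrib_right by (simp add: mult_ac)
  moreover have a: "a i \<noteq> 0 \<and> subdegree (a i) \<le> A * subdegree G" if "\<exists>j\<le>A. d (i, j) \<noteq> 0" for i
    unfolding a_def using that G by (rule subdegree_const_power_sum)
  moreover have "\<exists>i\<le>A. a i \<noteq> 0" using d a by blast
  ultimately obtain i where i: "i \<le> A" "a i \<noteq> 0" "F dvd a i"
    using fps_power_sum_zero_dvd[of a F A] F by blast
  have "subdegree (a i) \<le> A * subdegree G"
  proof (rule conjunct2[OF a], rule ccontr)
    assume "\<not> (\<exists>j\<le>A. d (i, j) \<noteq> 0)"
    then have "a i = 0" by (simp add: a_def)
    then show False using i by simp
  qed
  moreover have "subdegree F \<le> subdegree (a i)"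
  proof -
    obtain Q where Q: "a i = F * Q" using i(3) by blast
    then have "Q \<noteq> 0" using i(2) by auto
    then show ?thesis unfolding Q using F by simp
  qed
  ultimately show ?thesis by linarith
qed

subsection \<open>A relation between three theta series\<close>

definition fps_scale :: "'a :: comm_ring_1 \<Rightarrow> 'a fps \<Rightarrow> 'a fps" where
  "fps_scale \<zeta> F = Abs_fps (\<lambda>n. \<zeta> ^ n * fps_nth F n)"

lemma fps_scale_nth [simp]: "fps_nth (fps_scale \<zeta> F) n = \<zeta> ^ n * fps_nth F n"
  by (simp add: fps_scale_def)

lemma fps_scale_mult: "fps_scale \<zeta> (F * G) = fps_scale \<zeta> F * fps_scale \<zeta> G"
proof (rule fps_ext)
  fix n
  have "\<zeta> ^ n * (fps_nth F i * fps_nth G (n - i)) = (\<zeta> ^ i * fps_nth F i) * (\<zeta> ^ (n - i) * fps_nth G (n - i))"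
    if "i \<le> n" for i
  proof -
    have "\<zeta> ^ n = \<zeta> ^ i * \<zeta> ^ (n - i)" using that by (simp flip: power_add)
    then show ?thesis by (simp add: mult_ac)
  qed
  then show "fps_nth (fps_scale \<zeta> (F * G)) n = fps_nth (fps_scale \<zeta> F * fps_scale \<zeta> G) n"
    by (simp add: fps_mult_nth sum_distrib_left)
qed

lemma fps_scale_1: "fps_scale \<zeta> 1 = 1"
  by (rule fps_ext) (simp add: fps_one_nth)

lemma fps_scale_power: "fps_scale \<zeta> (F ^ n) = fps_scale \<zeta> F ^ n"
  by (induction n) (simp_all add: fps_scale_mult fps_scale_1)

lemma fps_scale_const: "fps_scale \<zeta> (fps_const c) = fps_const c"
  by (rule fps_ext) simp

lemma fps_scale_sum: "fps_scale \<zeta> (\<Sum>i\<in>I. F i) = (\<Sum>i\<in>I. fps_scale \<zeta> (F i))"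
  by (rule fps_ext) (simp add: fps_sum_nth sum_distrib_left)

text \<open>Homogeneous of degree \<open>2 * A\<close>, so that all terms transform alike under the
  modular group and under a common scalar. As both exponents are at most \<open>A\<close>, the
  natural subtraction is exact, and \<open>H = 1\<close> leaves degree at most \<open>A\<close> in
  each of \<open>F\<close> and \<open>G\<close>.\<close>

definition ternary_form :: "nat \<Rightarrow> (nat \<times> nat \<Rightarrow> 'a :: comm_ring_1) \<Rightarrow> 'a fps \<Rightarrow> 'a fps \<Rightarrow> 'a fps \<Rightarrow> 'a fps" where
  "ternary_form A c F G H = (\<Sum>p\<in>{..A} \<times> {..A}. fps_const (c p) * (F ^ fst p * G ^ snd p * H ^ (2 * A - fst p - snd p)))"

lemma ternary_form_scale:
  "ternary_form A c (fps_scale \<zeta> F) (fps_scale \<zeta> G) (fps_scale \<zeta> H) = fps_scale \<zeta> (ternary_form A c F G H)"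
  by (simp add: ternary_form_def fps_scale_sum fps_scale_mult fps_scale_power fps_scale_const)

lemma ternary_form_const:
  "ternary_form A c (fps_const k * F) (fps_const k * G) (fps_const k * H) = fps_const (k ^ (2 * A)) * ternary_form A c F G H"
proof -
  have "(fps_const k * F) ^ i * (fps_const k * G) ^ j * (fps_const k * H) ^ (2 * A - i - j)
     = fps_const (k ^ (2 * A)) * (F ^ i * G ^ j * H ^ (2 * A - i - j))" if "i \<le> A" "j \<le> A" for i j
  proof -
    have "2 * A = i + j + (2 * A - i - j)" using that by simp
    then have "k ^ (2 * A) = k ^ i * k ^ j * k ^ (2 * A - i - j)" by (metis power_add)
    then show ?thesis by (simp add: power_mult_distrib fps_const_power mult_ac flip: fps_const_mult)
  qed
  then show ?thesis
    unfolding ternary_form_def sum_distrib_left by (intro sum.cong) (auto simp: mult_ac)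
qed

lemma ternary_form_conv_radius:
  fixes F G H :: "complex fps"
  assumes "fps_conv_radius F \<ge> 1" "fps_conv_radius G \<ge> 1" "fps_conv_radius H \<ge> 1"
  shows "fps_conv_radius (ternary_form A c F G H) \<ge> 1"
    and "norm q < 1 \<Longrightarrow> eval_fps (ternary_form A c F G H) q =
      (\<Sum>p\<in>{..A} \<times> {..A}. c p * (eval_fps F q ^ fst p * eval_fps G q ^ snd p * eval_fps H q ^ (2 * A - fst p - snd p)))"
proof -
  define R where "R = {F :: complex fps. fps_conv_radius F \<ge> 1}"
  have Rm: "F * G \<in> R" "norm q < 1 \<Longrightarrow> eval_fps (F * G) q = eval_fps F q * eval_fps G q" if "F \<in> R" "G \<in> R" for F G q
    using that fps_conv_radius_mult[of F G]
    by (auto simp: R_def min_def split: if_splits intro!: eval_fps_mult intro: order_trans less_le_trans[of _ 1])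
  have Ra: "F + G \<in> R" "norm q < 1 \<Longrightarrow> eval_fps (F + G) q = eval_fps F q + eval_fps G q" if "F \<in> R" "G \<in> R" for F G q
    using that fps_conv_radius_add[of F G]
    by (auto simp: R_def min_def split: if_splits intro!: eval_fps_add intro: order_trans less_le_trans[of _ 1])
  have Rc: "fps_const k \<in> R" for k by (simp add: R_def)
  have Rp: "F ^ n \<in> R \<and> (norm q < 1 \<longrightarrow> eval_fps (F ^ n) q = eval_fps F q ^ n)" if "F \<in> R" for F n q
    using that
  proof (induction n)
    case 0
    then show ?case using Rc[of 1] by simp
  next
    case (Suc n)
    then show ?case using Rm(1)[of F "F ^ n"] Rm(2)[of F "F ^ n" q] by simp
  qed
  have Rs: "(\<Sum>i\<in>I. f i) \<in> R \<and> (norm q < 1 \<longrightarrow> eval_fps (\<Sum>i\<in>I. f i) q = (\<Sum>i\<in>I. eval_fps (f i) q))"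
    if "finite I" "\<And>i. i \<in> I \<Longrightarrow> f i \<in> R" for f :: "nat \<times> nat \<Rightarrow> complex fps" and I q
    using that
  proof (induction I rule: finite_induct)
    case empty
    then show ?case using Rc[of 0] by simp
  next
    case (insert i I)
    then show ?case using Ra(1)[of "f i" "sum f I"] Ra(2)[of "f i" "sum f I" q] by simp
  qed
  have FGH: "F \<in> R" "G \<in> R" "H \<in> R" using assms by (auto simp: R_def)
  let ?t = "\<lambda>p. fps_const (c p) * (F ^ fst p * G ^ snd p * H ^ (2 * A - fst p - snd p))"
  have t: "?t p \<in> R" "norm q < 1 \<Longrightarrow> eval_fps (?t p) q =
      c p * (eval_fps F q ^ fst p * eval_fps G q ^ snd p * eval_fps H q ^ (2 * A - fst p - snd p))" for p q
    using FGH Rp Rm Rc by auto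
  have fin: "finite ({..A} \<times> {..A})" by simp
  show "fps_conv_radius (ternary_form A c F G H) \<ge> 1"
    using Rs[OF fin, of ?t] t(1) unfolding ternary_form_def R_def by blast
  show "eval_fps (ternary_form A c F G H) q =
      (\<Sum>p\<in>{..A} \<times> {..A}. c p * (eval_fps F q ^ fst p * eval_fps G q ^ snd p * eval_fps H q ^ (2 * A - fst p - snd p)))"
    if "norm q < 1"
    using Rs[OF fin, of ?t q] t that unfolding ternary_form_def by simp
qed

context binary_theta
begin

text \<open>One word is chosen for each pair of residues modulo \<open>2 * E\<close> that occurs as
  a first row; the bound counts all such pairs.\<close>

lemma first_row_representatives:
  obtains R where "finite R" "card R \<le> 4 * E * E"
    "\<And>w. \<exists>w0\<in>R. [fst (mat_word w0 (1, 0)) = fst (mat_word w (1, 0))] (mod P)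
      \<and> [fst (mat_word w0 (0, 1)) = fst (mat_word w (0, 1))] (mod P)"
proof -
  define key where "key w = (fst (mat_word w (1, 0)) mod P, fst (mat_word w (0, 1)) mod P)" for w
  define R where "R = (\<lambda>k. SOME w. key w = k) ` (range key)"
  have sub: "range key \<subseteq> {0..<P} \<times> {0..<P}" using P_pos by (auto simp: key_def)
  then have fin: "finite (range key)" by (rule finite_subset) simp
  have "card R \<le> card (range key)" unfolding R_def by (rule card_image_le[OF fin])
  also have "\<dots> \<le> card ({0..<P} \<times> {0..<P})" by (rule card_mono[OF _ sub]) simp
  also have "\<dots> = 4 * E * E" by (simp add: nat_mult_distrib)
  finally have "card R \<le> 4 * E * E" .
  moreover have "finite R" using fin by (simp add: R_def)
  moreover have "\<exists>w0\<in>R. [fst (mat_word w0 (1, 0)) = fst (mat_word w (1, 0))] (mod P)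
      \<and> [fst (mat_word w0 (0, 1)) = fst (mat_word w (0, 1))] (mod P)" for w
  proof
    show "(SOME w'. key w' = key w) \<in> R" by (simp add: R_def)
    have "key (SOME w'. key w' = key w) = key w" by (rule someI) simp
    then show "[fst (mat_word (SOME w'. key w' = key w) (1, 0)) = fst (mat_word w (1, 0))] (mod P)
      \<and> [fst (mat_word (SOME w'. key w' = key w) (0, 1)) = fst (mat_word w (0, 1))] (mod P)"
      by (simp add: key_def cong_def)
  qed
  ultimately show ?thesis using that by blast
qed

lemma theta_scale: "theta (\<lambda>x y. c * \<phi> x y) = fps_const c * theta \<phi>"
  by (rule fps_ext) (simp add: theta_def sum_distrib_left)

lemma theta_translate:
  "theta (op_word (replicate n True @ w) \<phi>) = fps_scale (unity (n / (2 * E))) (theta (op_word w \<phi>))"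
proof (induction n)
  case 0
  then show ?case by (intro fps_ext) simp
next
  case (Suc n)
  have "theta (op_word (replicate (Suc n) True @ w) \<phi>) = theta (opT (op_word (replicate n True @ w) \<phi>))"
    by simp
  also have "\<dots> = fps_scale (unity (1 / (2 * E))) (theta (op_word (replicate n True @ w) \<phi>))"
    by (rule fps_ext) (simp add: theta_opT unity_power)
  also have "\<dots> = fps_scale (unity (Suc n / (2 * E))) (theta (op_word w \<phi>))"
    unfolding Suc by (rule fps_ext)
      (simp add: unity_power mult.assoc[symmetric] unity_add[symmetric] add_divide_distrib distrib_left)
  finally show ?case .
qed

text \<open>Height at least 1/2 keeps the nome in a fixed smaller disc, and
  \<open>op_word_bounded\<close> makes the coefficient functions bounded uniformly in the
  word.\<close>

lemma eval_theta_bounded: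
  assumes "per \<phi>"
  shows "\<exists>C. \<forall>w z. Im z \<ge> 1 / 2 \<longrightarrow> norm (eval_fps (theta (op_word w \<phi>)) (nome E z)) \<le> C"
proof -
  obtain B where B: "\<And>w x y. norm (op_word w \<phi> x y) \<le> B" using op_word_bounded[OF assms] by blast
  have B0: "B \<ge> 0" using B[of "[]" 0 0] norm_ge_zero order_trans by blast
  define r where "r = exp (- (pi * (1 / 2) / E))"
  have r: "0 < r" "r < 1" using E_pos by (auto simp: r_def)
  have sr: "(\<lambda>p. norm (complex_of_real B * of_real r ^ qform p)) summable_on UNIV"
    by (rule theta_summable[of "\<lambda>_ _. of_real B" "B"]) (use r B0 in auto)
  have "norm (eval_fps (theta (op_word w \<phi>)) (nome E z)) \<le> infsum (\<lambda>p. norm (complex_of_real B * of_real r ^ qform p)) UNIV"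
    if z: "Im z \<ge> 1 / 2" for w z
  proof -
    have q: "norm (nome E z) < 1" using z E_pos by (intro norm_nome_less_1) auto
    have qr: "norm (nome E z) \<le> r"
    proof -
      have "pi * (1 / 2) \<le> pi * Im z" using z by (intro mult_left_mono) auto
      then have "pi * (1 / 2) / E \<le> pi * Im z / E" by (intro divide_right_mono) auto
      then show ?thesis by (simp add: norm_nome r_def)
    qed
    show ?thesis unfolding eval_theta[OF B q]
    proof (rule order_trans[OF norm_infsum_bound infsum_mono])
      show "(\<lambda>p. norm (op_word w \<phi> (fst p) (snd p) * nome E z ^ qform p)) summable_on UNIV"
        by (rule theta_summable[OF B q])
      then show "(\<lambda>p. norm (op_word w \<phi> (fst p) (snd p) * nome E z ^ qform p)) summable_on UNIV" .
      show "norm (op_word w \<phi> (fst p) (snd p) * nome E z ^ qform p) \<le> norm (complex_of_real B * of_real r ^ qform p)" for p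
        using B[of w "fst p" "snd p"] B0 qr r
        by (auto simp: norm_mult norm_power intro!: mult_mono power_mono)
    qed (rule sr)
  qed
  then show ?thesis by blast
qed

text \<open>Each theta series has weight 1, so the form fits \<open>modular_family_vanishes\<close>
  with \<open>K = 2 * A\<close>; prefixing a letter to the word is the action of \<open>opT\<close>
  or \<open>opS\<close>.\<close>

theorem ternary_form_theta_vanishes:
  assumes per: "per \<phi>f" "per \<phi>g" "per \<phi>h" and A: "A > 0"
    and van: "\<And>w n. n < E * (2 * A) \<Longrightarrow>
      fps_nth (ternary_form A c (theta (op_word w \<phi>f)) (theta (op_word w \<phi>g)) (theta (op_word w \<phi>h))) n = 0"
  shows "ternary_form A c (theta \<phi>f) (theta \<phi>g) (theta \<phi>h) = 0"
proof -
  define F where "F w = ternary_form A c (theta (op_word w \<phi>f)) (theta (op_word w \<phi>g)) (theta (op_word w \<phi>h))" for w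
  have rad: "fps_conv_radius (theta (op_word w \<phi>)) \<ge> 1" if per': "per \<phi>" for w \<phi>
  proof -
    obtain B where "\<And>x y. norm (op_word w \<phi> x y) \<le> B" using per_bounded[OF per_op_word[OF per']] by blast
    then show ?thesis by (rule theta_conv_radius)
  qed
  have ev: "eval_fps (F w) q =
      (\<Sum>p\<in>{..A} \<times> {..A}. c p * (eval_fps (theta (op_word w \<phi>f)) q ^ fst p * eval_fps (theta (op_word w \<phi>g)) q ^ snd p
        * eval_fps (theta (op_word w \<phi>h)) q ^ (2 * A - fst p - snd p)))" if "norm q < 1" for w q
    unfolding F_def using that by (intro ternary_form_conv_radius(2) rad per)
  have radF: "fps_conv_radius (F w) \<ge> 1" for w
    unfolding F_def by (intro ternary_form_conv_radius(1) rad per)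
  obtain Cf Cg Ch where C:
    "\<And>w z. Im z \<ge> 1 / 2 \<Longrightarrow> norm (eval_fps (theta (op_word w \<phi>f)) (nome E z)) \<le> Cf"
    "\<And>w z. Im z \<ge> 1 / 2 \<Longrightarrow> norm (eval_fps (theta (op_word w \<phi>g)) (nome E z)) \<le> Cg"
    "\<And>w z. Im z \<ge> 1 / 2 \<Longrightarrow> norm (eval_fps (theta (op_word w \<phi>h)) (nome E z)) \<le> Ch"
    using eval_theta_bounded per by meson
  have zero: "eval_fps (F []) q = 0" if "norm q < 1" "q \<noteq> 0" for q
  proof (rule modular_family_vanishes[OF E_pos radF, where K = "2 * A" and w = "[]"])
    show "eval_fps (F w) (nome E (z + 1)) = eval_fps (F (True # w)) (nome E z)" if "Im z > 0" for w z
      using that E_pos by (subst (1 2) ev) (auto intro: norm_nome_less_1 simp: eval_theta_T)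
    show "eval_fps (F w) (nome E (- 1 / z)) = (- \<i> * z) ^ (2 * A) * eval_fps (F (False # w)) (nome E z)"
      if z: "Im z > 0" for w z
    proof -
      have n: "norm (nome E z) < 1" "norm (nome E (- 1 / z)) < 1"
        using z E_pos Im_neg_inverse[OF z] by (auto intro: norm_nome_less_1)
      have S: "eval_fps (theta (op_word w \<phi>)) (nome E (- 1 / z)) =
          - \<i> * z * eval_fps (theta (op_word (False # w) \<phi>)) (nome E z)" if "per \<phi>" for \<phi>
        using eval_theta_S[OF per_op_word[OF that] z] by simp
      have hom: "(k * a) ^ i * (k * b) ^ j * (k * d) ^ (2 * A - i - j) = k ^ (2 * A) * (a ^ i * b ^ j * d ^ (2 * A - i - j))"
        if "i \<le> A" "j \<le> A" for k a b d :: complex and i j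
      proof -
        have "2 * A = i + j + (2 * A - i - j)" using that by simp
        then have "k ^ (2 * A) = k ^ i * k ^ j * k ^ (2 * A - i - j)" by (metis power_add)
        then show ?thesis by (simp add: power_mult_distrib mult_ac)
      qed
      show ?thesis
        unfolding ev[OF n(1)] ev[OF n(2)] S[OF per(1)] S[OF per(2)] S[OF per(3)] sum_distrib_left
      proof (intro sum.cong refl)
        fix p assume "p \<in> {..A} \<times> {..A}"
        then have "fst p \<le> A" "snd p \<le> A" by auto
        then show "c p * ((- \<i> * z * eval_fps (theta (op_word (False # w) \<phi>f)) (nome E z)) ^ fst p *
           (- \<i> * z * eval_fps (theta (op_word (False # w) \<phi>g)) (nome E z)) ^ snd p *
           (- \<i> * z * eval_fps (theta (op_word (False # w) \<phi>h)) (nome E z)) ^ (2 * A - fst p - snd p)) =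
         (- \<i> * z) ^ (2 * A) * (c p * (eval_fps (theta (op_word (False # w) \<phi>f)) (nome E z) ^ fst p *
           eval_fps (theta (op_word (False # w) \<phi>g)) (nome E z) ^ snd p *
           eval_fps (theta (op_word (False # w) \<phi>h)) (nome E z) ^ (2 * A - fst p - snd p)))"
          unfolding hom[OF \<open>fst p \<le> A\<close> \<open>snd p \<le> A\<close>] by (simp only: mult_ac)
      qed
    qed
    show "norm (eval_fps (F w) (nome E z)) \<le>
        (\<Sum>p\<in>{..A} \<times> {..A}. norm (c p) * (Cf ^ fst p * Cg ^ snd p * Ch ^ (2 * A - fst p - snd p)))"
      if z: "Im z \<ge> 1 / 2" for w z
    proof -
      have n: "norm (nome E z) < 1" using z E_pos by (intro norm_nome_less_1) auto
      have pos: "Cf \<ge> 0" "Cg \<ge> 0" "Ch \<ge> 0"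
        using C(1)[OF z, of w] C(2)[OF z, of w] C(3)[OF z, of w] norm_ge_zero order_trans by blast+
      show ?thesis unfolding ev[OF n]
        by (rule order_trans[OF norm_sum sum_mono])
          (use pos C[OF z] in \<open>auto simp: norm_mult norm_power intro!: mult_mono power_mono mult_nonneg_nonneg\<close>)
    qed
  qed (use van A that in \<open>auto simp: F_def\<close>)
  have "F [] = 0"
  proof (rule eval_fps_eqD)
    show "fps_conv_radius (F []) > 0" using radF[of "[]"] by (rule less_le_trans[rotated]) simp
    \<comment> \<open>The point \<open>q = 0\<close> is not a nome of any \<open>z\<close>; it is
      covered by the vanishing constant coefficient.\<close>
    have F0: "fps_nth (F []) 0 = 0" using van[of 0 "[]"] E_pos A by (simp add: F_def)
    have "eventually (\<lambda>q :: complex. q \<in> ball 0 1) (nhds 0)"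
      by (intro eventually_nhds_in_open) auto
    then show "eventually (\<lambda>z. eval_fps (F []) z = eval_fps 0 z) (nhds 0)"
    proof eventually_elim
      case (elim q)
      then show ?case using zero[of q] F0 by (cases "q = 0") (auto simp: eval_fps_at_0)
    qed
  qed simp
  then show ?thesis by (simp add: F_def)
qed

text \<open>The monomials outnumber the vanishing conditions, because one condition per first row of the
  matrix suffices.\<close>

theorem ternary_relation:
  assumes per: "per \<phi>f" "per \<phi>g" "per \<phi>h"
  shows "\<exists>c. (\<exists>p\<in>{..8 * E ^ 3} \<times> {..8 * E ^ 3}. c p \<noteq> 0) \<and>
    ternary_form (8 * E ^ 3) c (theta \<phi>f) (theta \<phi>g) (theta \<phi>h) = (0 :: complex fps)"
proof -
  define A where "A = 8 * E ^ 3"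
  have A: "A > 0" using E_pos by (simp add: A_def)
  obtain R where R: "finite R" "card R \<le> 4 * E * E"
    "\<And>w. \<exists>w0\<in>R. [fst (mat_word w0 (1, 0)) = fst (mat_word w (1, 0))] (mod P)
      \<and> [fst (mat_word w0 (0, 1)) = fst (mat_word w (0, 1))] (mod P)"
    using first_row_representatives by blast
  define m where "m e p = fps_nth (theta (op_word (fst e) \<phi>f) ^ fst p * theta (op_word (fst e) \<phi>g) ^ snd p *
      theta (op_word (fst e) \<phi>h) ^ (2 * A - fst p - snd p)) (snd e)" for e :: "bool list \<times> nat" and p :: "nat \<times> nat"
  \<comment> \<open>At most \<open>4 * E * E\<close> words with \<open>2 * A * E\<close>
    coefficients each make at most \<open>8 * E ^ 3 * A\<close> conditions. The choice of
    \<open>A\<close> turns this into \<open>A * A\<close>, one step below the number of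
    monomials.\<close>
  have "card (R \<times> {..<E * (2 * A)}) < card ({..A} \<times> {..A})"
  proof -
    have "card (R \<times> {..<E * (2 * A)}) \<le> (4 * E * E) * (E * (2 * A))"
      unfolding card_cartesian_product card_lessThan by (intro mult_right_mono R(2)) simp
    also have "\<dots> = A * A" by (simp add: A_def power3_eq_cube)
    also have "\<dots> < (A + 1) * (A + 1)" by simp
    finally show ?thesis by (simp add: card_cartesian_product)
  qed
  from homogeneous_system_nontrivial[OF _ _ this, of m] R(1) obtain c where
    c: "\<exists>p\<in>{..A} \<times> {..A}. c p \<noteq> 0" "\<And>e. e \<in> R \<times> {..<E * (2 * A)} \<Longrightarrow> (\<Sum>p\<in>{..A} \<times> {..A}. c p * m e p) = 0"
    by auto
  have "ternary_form A c (theta \<phi>f) (theta \<phi>g) (theta \<phi>h) = 0"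
  proof (rule ternary_form_theta_vanishes[OF per A])
    fix w n assume n: "n < E * (2 * A)"
    obtain w0 where w0: "w0 \<in> R" "[fst (mat_word w0 (1, 0)) = fst (mat_word w (1, 0))] (mod P)"
      "[fst (mat_word w0 (0, 1)) = fst (mat_word w (0, 1))] (mod P)" using R(3) by blast
    from same_first_row[OF w0(2,3)] obtain l k where
      lk: "\<And>\<phi>. per \<phi> \<Longrightarrow> op_word w \<phi> = (\<lambda>x y. k * op_word (replicate l True @ w0) \<phi> x y)" by blast
    \<comment> \<open>The same \<open>k\<close> and \<open>l\<close> serve all three functions, so
      by homogeneity the form for \<open>w\<close> is a rescaling of the form for \<open>w0\<close>
      and has its zero coefficients in the same degrees.\<close>
    have th: "theta (op_word w \<phi>) = fps_const k * fps_scale (unity (l / (2 * E))) (theta (op_word w0 \<phi>))"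
      if "per \<phi>" for \<phi>
      unfolding lk[OF that] theta_scale theta_translate ..
    have "fps_nth (ternary_form A c (theta (op_word w0 \<phi>f)) (theta (op_word w0 \<phi>g)) (theta (op_word w0 \<phi>h))) n = 0"
      using c(2)[of "(w0, n)"] w0(1) n unfolding ternary_form_def m_def by (simp add: fps_sum_nth)
    then show "fps_nth (ternary_form A c (theta (op_word w \<phi>f)) (theta (op_word w \<phi>g)) (theta (op_word w \<phi>h))) n = 0"
      unfolding th[OF per(1)] th[OF per(2)] th[OF per(3)] ternary_form_const ternary_form_scale by simp
  qed
  then show ?thesis using c(1) unfolding A_def by blast
qed

text \<open>Substitute for Sturm's theorem modulo 2: the relation of the previous theorem can be made integral
  with an odd coefficient, so modulo 2 it says that the first series is algebraic over the second.\<close>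

theorem theta_parity_order:
  fixes Fi Gi Hi :: "int fps"
  assumes per: "per \<phi>f" "per \<phi>g" "per \<phi>h"
    and int: "theta \<phi>f = fps_int Fi" "theta \<phi>g = fps_int Gi" "theta \<phi>h = fps_int Hi"
    and H: "(fps_int Hi :: bit fps) = 1" and F: "(fps_int Fi :: bit fps) \<noteq> 0"
    and G: "subdegree (fps_int Gi :: bit fps) > 0"
  shows "subdegree (fps_int Fi :: bit fps) \<le> 8 * E ^ 3 * subdegree (fps_int Gi :: bit fps)"
proof -
  define A where "A = 8 * E ^ 3"
  let ?I = "{..A} \<times> {..A}"
  let ?M = "\<lambda>p. Fi ^ fst p * Gi ^ snd p * Hi ^ (2 * A - fst p - snd p)"
  obtain c :: "nat \<times> nat \<Rightarrow> complex" where c: "\<exists>p\<in>?I. c p \<noteq> 0"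
    "ternary_form A c (theta \<phi>f) (theta \<phi>g) (theta \<phi>h) = 0"
    using ternary_relation[OF per] unfolding A_def by blast
  have c0: "(\<Sum>p\<in>?I. c p * of_int (fps_nth (?M p) n)) = 0" for n
  proof -
    have "(\<Sum>p\<in>?I. c p * of_int (fps_nth (?M p) n)) = fps_nth (ternary_form A c (theta \<phi>f) (theta \<phi>g) (theta \<phi>h)) n"
      unfolding ternary_form_def int fps_int_power[symmetric] fps_int_mult[symmetric] by (simp add: fps_sum_nth)
    then show ?thesis by (simp add: c(2))
  qed
  obtain p0 where "p0 \<in> ?I" "c p0 \<noteq> 0" using c(1) by blast
  then obtain d :: "nat \<times> nat \<Rightarrow> int" where d: "\<exists>p\<in>?I. odd (d p)"
    "\<And>v :: nat \<times> nat \<Rightarrow> int. (\<Sum>p\<in>?I. c p * of_int (v p)) = 0 \<Longrightarrow> (\<Sum>p\<in>?I. d p * v p) = 0"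
    using complex_relation_imp_integer[of ?I p0 c] by auto
  have "(\<Sum>p\<in>?I. fps_const (d p) * ?M p) = 0"
    by (rule fps_ext) (simp add: fps_sum_nth d(2)[OF c0] del: diff_diff_left)
  then have "fps_int (\<Sum>p\<in>?I. fps_const (d p) * ?M p) = (0 :: bit fps)"
    by (simp only: fps_int_0)
  \<comment> \<open>Modulo 2 the powers of the third series become 1, and an odd \<open>d p\<close>
    keeps the remaining polynomial nonzero.\<close>
  then have "(\<Sum>i\<le>A. \<Sum>j\<le>A. fps_const (of_int (d (i, j)) :: bit) * fps_int Fi ^ i * fps_int Gi ^ j) = 0"
    by (simp add: fps_int_sum fps_int_mult fps_int_power fps_int_const H sum.cartesian_product split_def mult.assoc)
  moreover have "\<exists>i\<le>A. \<exists>j\<le>A. (of_int (d (i, j)) :: bit) \<noteq> 0"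
    using d(1) by (auto simp: of_int_bit)
  ultimately show ?thesis
    unfolding A_def[symmetric] by (intro subdegree_le_of_algebraic_relation[where d = "\<lambda>p. of_int (d p)"] F G)
qed

end

section \<open>Congruence of power series below a given degree\<close>

definition fps_cong :: "nat \<Rightarrow> 'a fps \<Rightarrow> 'a fps \<Rightarrow> bool" where
  "fps_cong N F G \<longleftrightarrow> (\<forall>k<N. fps_nth F k = fps_nth G k)"

lemma fps_cong_refl: "fps_cong N F F"
  by (simp add: fps_cong_def)

lemma fps_cong_sym: "fps_cong N F G \<Longrightarrow> fps_cong N G F"
  by (simp add: fps_cong_def)

lemma fps_cong_trans [trans]: "fps_cong N F G \<Longrightarrow> fps_cong N G H \<Longrightarrow> fps_cong N F H"
  by (simp add: fps_cong_def)

lemma fps_cong_mult: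
  fixes F G :: "'a :: comm_ring_1 fps"
  shows "fps_cong N F F' \<Longrightarrow> fps_cong N G G' \<Longrightarrow> fps_cong N (F * G) (F' * G')"
  by (auto simp: fps_cong_def fps_mult_nth intro!: sum.cong)

lemma fps_cong_add:
  fixes F G :: "'a :: comm_ring_1 fps"
  shows "fps_cong N F F' \<Longrightarrow> fps_cong N G G' \<Longrightarrow> fps_cong N (F + G) (F' + G')"
  by (simp add: fps_cong_def)

lemma fps_cong_diff:
  fixes F G :: "'a :: comm_ring_1 fps"
  shows "fps_cong N F F' \<Longrightarrow> fps_cong N G G' \<Longrightarrow> fps_cong N (F - G) (F' - G')"
  by (simp add: fps_cong_def)

lemma fps_cong_power:
  fixes F G :: "'a :: comm_ring_1 fps"
  shows "fps_cong N F G \<Longrightarrow> fps_cong N (F ^ n) (G ^ n)"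
  by (induction n) (auto intro: fps_cong_refl fps_cong_mult)

lemma fps_cong_sum:
  fixes f g :: "'i \<Rightarrow> 'a :: comm_ring_1 fps"
  shows "(\<And>i. i \<in> I \<Longrightarrow> fps_cong N (f i) (g i)) \<Longrightarrow> fps_cong N (\<Sum>i\<in>I. f i) (\<Sum>i\<in>I. g i)"
  by (auto simp: fps_cong_def fps_sum_nth intro!: sum.cong)

lemma fps_cong_cancel:
  fixes F G U :: "'a :: comm_ring_1 fps"
  assumes "fps_cong N (F * U) (G * U)" "fps_nth U 0 = 1"
  shows "fps_cong N F G"
proof -
  have U: "U * fps_right_inverse U 1 = 1"
    by (rule fps_right_inverse) (simp add: assms)
  have "fps_cong N (F * U * fps_right_inverse U 1) (G * U * fps_right_inverse U 1)"
    by (intro fps_cong_mult assms fps_cong_refl)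
  then show ?thesis by (simp add: mult.assoc U)
qed

lemma fps_cong_X_power_0:
  "N \<le> m \<Longrightarrow> fps_cong N (fps_X ^ m * F) (0 :: 'a :: comm_ring_1 fps)"
  by (simp add: fps_cong_def fps_X_power_mult_nth)

lemma fps_cong_one_plus:
  "N \<le> m \<Longrightarrow> fps_cong N (1 + fps_X ^ m * F) (1 :: 'a :: comm_ring_1 fps)"
  using fps_cong_add[OF fps_cong_refl fps_cong_X_power_0, of N m 1 F] by simp

text \<open>Lets a finite product stand in for an infinite one: factors equal to 1 below degree
  \<open>K\<close> change nothing there.\<close>

lemma fps_cong_prod_extend:
  fixes f :: "nat \<Rightarrow> 'a :: comm_ring_1 fps"
  assumes "\<And>i. i \<ge> N \<Longrightarrow> fps_cong K (f i) 1" "N \<le> M"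
  shows "fps_cong K (\<Prod>i<M. f i) (\<Prod>i<N. f i)"
  using assms(2)
proof (induction M rule: dec_induct)
  case (step M)
  show ?case using fps_cong_mult[OF step.IH assms(1)[OF step.hyps(1)]] by simp
qed (rule fps_cong_refl)

subsection \<open>Gaussian binomials and the Jacobi triple product\<close>

text \<open>Given by one q-Pascal rule instead of a quotient of q-factorials, so that no division in
  the ring is involved. The mirrored rule is \<open>gauss_binomial_pascal\<close>, obtained by
  cancelling q-factorials.\<close>

fun gauss_binomial :: "'a :: comm_ring_1 \<Rightarrow> nat \<Rightarrow> nat \<Rightarrow> 'a" where
  "gauss_binomial Q n 0 = 1"
| "gauss_binomial Q 0 (Suc k) = 0"
| "gauss_binomial Q (Suc n) (Suc k) = gauss_binomial Q n k + Q ^ Suc k * gauss_binomial Q n (Suc k)"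

definition q_factorial :: "'a :: comm_ring_1 \<Rightarrow> nat \<Rightarrow> 'a" where
  "q_factorial Q n = (\<Prod>i<n. 1 - Q ^ Suc i)"

lemma q_factorial_Suc: "q_factorial Q (Suc n) = q_factorial Q n * (1 - Q ^ Suc n)"
  by (simp add: q_factorial_def)

lemma gauss_binomial_eq_0: "n < k \<Longrightarrow> gauss_binomial Q n k = 0"
  by (induction Q n k rule: gauss_binomial.induct) auto

lemma gauss_binomial_self: "gauss_binomial Q n n = 1"
  by (induction n) (simp_all add: gauss_binomial_eq_0)

lemma gauss_binomial_product:
  "k \<le> n \<Longrightarrow> gauss_binomial Q n k * (q_factorial Q k * q_factorial Q (n - k)) = q_factorial Q n"
proof (induction Q n k rule: gauss_binomial.induct)
  case (3 Q n k)
  show ?case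
  proof (cases "k = n")
    case True
    then show ?thesis by (simp only: gauss_binomial_self) (simp add: q_factorial_def)
  next
    case False
    then have k: "k \<le> n" "Suc k \<le> n" using 3 by auto
    have nk: "q_factorial Q (n - k) = q_factorial Q (n - Suc k) * (1 - Q ^ (n - k))"
      using q_factorial_Suc[of Q "n - Suc k"] k by (simp add: Suc_diff_Suc)
    have pw: "Q ^ Suc k * Q ^ (n - k) = Q ^ Suc n" using k by (simp flip: power_add power_Suc)
    have aux: "(g + u * h) * (x * (1 - u) * (y * (1 - v))) = (g * (x * (y * (1 - v)))) * (1 - u)
        + u * (1 - v) * (h * (x * (1 - u) * y))" for g h u v x y :: 'a
      by (simp add: algebra_simps)
    have "gauss_binomial Q (Suc n) (Suc k) * (q_factorial Q (Suc k) * q_factorial Q (Suc n - Suc k))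
      = (gauss_binomial Q n k * (q_factorial Q k * q_factorial Q (n - k))) * (1 - Q ^ Suc k)
      + Q ^ Suc k * (1 - Q ^ (n - k)) * (gauss_binomial Q n (Suc k) * (q_factorial Q (Suc k) * q_factorial Q (n - Suc k)))"
      unfolding gauss_binomial.simps diff_Suc_Suc nk q_factorial_Suc[of Q k] by (rule aux)
    also have "\<dots> = q_factorial Q n * (1 - Q ^ Suc k) + Q ^ Suc k * (1 - Q ^ (n - k)) * q_factorial Q n"
      using 3 k by simp
    also have "\<dots> = q_factorial Q n * (1 - Q ^ Suc k * Q ^ (n - k))"
      by (simp add: algebra_simps)
    finally show ?thesis unfolding pw q_factorial_Suc .
  qed
qed (auto simp: q_factorial_def)

lemma gauss_binomial_pascal:
  fixes Q :: "'a :: idom"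
  assumes "k \<le> n" and nz: "\<And>n. q_factorial Q n \<noteq> 0"
  shows "gauss_binomial Q (Suc n) (Suc k) = Q ^ (n - k) * gauss_binomial Q n k + gauss_binomial Q n (Suc k)"
proof (cases "k = n")
  case True
  then show ?thesis by (simp only: gauss_binomial_self) (simp add: gauss_binomial_eq_0)
next
  case False
  then have k: "k \<le> n" "Suc k \<le> n" using assms by auto
  have nk: "q_factorial Q (n - k) = q_factorial Q (n - Suc k) * (1 - Q ^ (n - k))"
    using q_factorial_Suc[of Q "n - Suc k"] k by (simp add: Suc_diff_Suc)
  have pw: "Q ^ (n - k) * Q ^ Suc k = Q ^ Suc n" using k by (simp flip: power_add power_Suc)
  let ?D = "q_factorial Q (Suc k) * q_factorial Q (Suc n - Suc k)"
  have aux: "(v * g + h) * (x * (1 - u) * (y * (1 - v))) = v * (1 - u) * (g * (x * (y * (1 - v))))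
      + (1 - v) * (h * (x * (1 - u) * y))" for g h u v x y :: 'a
    by (simp add: algebra_simps)
  have "(Q ^ (n - k) * gauss_binomial Q n k + gauss_binomial Q n (Suc k)) * ?D =
     Q ^ (n - k) * (1 - Q ^ Suc k) * (gauss_binomial Q n k * (q_factorial Q k * q_factorial Q (n - k)))
     + (1 - Q ^ (n - k)) * (gauss_binomial Q n (Suc k) * (q_factorial Q (Suc k) * q_factorial Q (n - Suc k)))"
    unfolding diff_Suc_Suc nk q_factorial_Suc[of Q k] by (rule aux)
  also have "\<dots> = (Q ^ (n - k) * (1 - Q ^ Suc k) + (1 - Q ^ (n - k))) * q_factorial Q n"
    unfolding gauss_binomial_product[OF k(1)] gauss_binomial_product[OF k(2)] by (simp only: ring_distribs)
  also have "Q ^ (n - k) * (1 - Q ^ Suc k) + (1 - Q ^ (n - k)) = 1 - Q ^ (n - k) * Q ^ Suc k"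
    by (simp add: algebra_simps)
  also have "(1 - Q ^ (n - k) * Q ^ Suc k) * q_factorial Q n = gauss_binomial Q (Suc n) (Suc k) * ?D"
    unfolding pw using gauss_binomial_product[of "Suc k" "Suc n" Q] k by (simp add: q_factorial_Suc mult.commute)
  finally show ?thesis using nz by (simp only: mult_cancel_right) auto
qed

text \<open>The general term of Ramanujan's theta function f(a, b). Both exponents are nonnegative
  for every integer \<open>k\<close>, so the triple product can be written without negative powers
  of a variable.\<close>

definition triangle_term :: "'a :: comm_ring_1 \<Rightarrow> 'a \<Rightarrow> int \<Rightarrow> 'a" where
  "triangle_term a b k = a ^ nat (k * (k + 1) div 2) * b ^ nat (k * (k - 1) div 2)"

lemma triangle_half: "2 * (k * (k + 1) div 2) = k * (k + 1 :: int)" "2 * (k * (k - 1) div 2) = k * (k - 1 :: int)"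
  by (auto intro!: dvd_mult_div_cancel)

lemma triangle_nonneg: "0 \<le> k * (k + 1) div (2 :: int)" "0 \<le> k * (k - 1) div (2 :: int)"
proof -
  have "0 \<le> k * (k + 1)" "0 \<le> k * (k - 1)"
    by (cases "k \<ge> 0"; simp add: mult_nonneg_nonneg mult_nonpos_nonpos; fail)
      (cases "k \<ge> 1"; simp add: mult_nonneg_nonneg mult_nonpos_nonpos)
  then show "0 \<le> k * (k + 1) div (2 :: int)" "0 \<le> k * (k - 1) div (2 :: int)" by simp_all
qed

lemma triangle_term_step:
  assumes "k \<le> int n"
  shows "a * (a * b) ^ n * triangle_term a b k = (a * b) ^ nat (int n - k) * triangle_term a b (k + 1)"
proof -
  have A: "(k + 1) * (k + 1 + 1) div 2 = k * (k + 1) div 2 + (k + 1)"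
    using triangle_half(1)[of k] triangle_half(1)[of "k + 1"] by (simp add: algebra_simps)
  have B: "(k + 1) * (k + 1 - 1) div 2 = k * (k - 1) div 2 + k"
    using triangle_half(2)[of k] triangle_half(2)[of "k + 1"] by (simp add: algebra_simps)
  have 1: "Suc n + nat (k * (k + 1) div 2) = nat (int n - k) + nat ((k + 1) * (k + 1 + 1) div 2)"
    using assms triangle_nonneg(1)[of k] triangle_nonneg(1)[of "k + 1"] unfolding A by linarith
  have 2: "n + nat (k * (k - 1) div 2) = nat (int n - k) + nat ((k + 1) * (k + 1 - 1) div 2)"
    using assms triangle_nonneg(2)[of k] triangle_nonneg(2)[of "k + 1"] unfolding B by linarith
  have "a * (a * b) ^ n * triangle_term a b k = a ^ (Suc n + nat (k * (k + 1) div 2)) * b ^ (n + nat (k * (k - 1) div 2))"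
    by (simp add: triangle_term_def power_add power_mult_distrib mult_ac)
  also have "\<dots> = (a * b) ^ nat (int n - k) * triangle_term a b (k + 1)"
    unfolding 1 2 by (simp only: triangle_term_def power_add power_mult_distrib mult_ac)
  finally show ?thesis .
qed

lemma triangle_term_swap: "triangle_term a b k = triangle_term b a (- k)"
  by (simp add: triangle_term_def algebra_simps)

lemma triangle_term_step':
  assumes "- k \<le> int n"
  shows "b * (a * b) ^ n * triangle_term a b k = (a * b) ^ nat (int n + k) * triangle_term a b (k - 1)"
  using triangle_term_step[of "- k" n b a] assms
  unfolding triangle_term_swap[of a b] by (simp add: mult.commute add.commute)

text \<open>A finite form of Jacobi's identity, by induction: the new pair of factors yields three
  copies of the sum with the index of \<open>triangle_term\<close> shifted by 0, 1 and -1, and the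
  coefficients recombine through both q-Pascal rules.\<close>

lemma finite_triple_product:
  fixes a b :: "'a :: idom"
  assumes nz: "\<And>n. q_factorial (a * b) n \<noteq> 0"
  shows "(\<Prod>i<n. (1 + a * (a * b) ^ i) * (1 + b * (a * b) ^ i)) =
    (\<Sum>j\<le>2 * n. gauss_binomial (a * b) (2 * n) j * triangle_term a b (int j - int n))"
proof (induction n)
  case 0
  then show ?case by (simp add: triangle_term_def)
next
  case (Suc n)
  let ?Q = "a * b" and ?G = "gauss_binomial (a * b) (2 * n)" and ?T = "triangle_term a b"
  let ?N = "2 * n"
  have "(\<Prod>i<Suc n. (1 + a * ?Q ^ i) * (1 + b * ?Q ^ i)) =
     (\<Sum>j\<le>?N. ?G j * ?T (int j - int n)) * ((1 + a * ?Q ^ n) * (1 + b * ?Q ^ n))"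
    by (simp add: Suc)
  also have "(1 + a * ?Q ^ n) * (1 + b * ?Q ^ n) = (1 + ?Q ^ Suc ?N) + a * ?Q ^ n + b * ?Q ^ n"
  proof -
    have pw: "?Q ^ Suc ?N = ?Q * (?Q ^ n * ?Q ^ n)" by (simp only: power_Suc mult_2 power_add)
    have aux: "(1 + a * w) * (1 + b * w) = (1 + ?Q * (w * w)) + a * w + b * w" for w :: 'a
      by (simp add: algebra_simps)
    show ?thesis unfolding pw by (rule aux)
  qed
  also have "(\<Sum>j\<le>?N. ?G j * ?T (int j - int n)) * ((1 + ?Q ^ Suc ?N) + a * ?Q ^ n + b * ?Q ^ n) =
     (\<Sum>j\<le>?N. (1 + ?Q ^ Suc ?N) * ?G j * ?T (int j - int n)) +
     (\<Sum>j\<le>?N. ?Q ^ (?N - j) * ?G j * ?T (int j + 1 - int n)) +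
     (\<Sum>j\<le>?N. ?Q ^ j * ?G j * ?T (int j - 1 - int n))"
  proof -
    have aux: "S * (u + v + w) = u * S + v * S + w * S" for S u v w :: 'a
      by (simp add: algebra_simps)
    show ?thesis unfolding aux sum_distrib_left
    proof (intro arg_cong2[of _ _ _ _ "(+)"] sum.cong refl)
      fix j assume j: "j \<in> {..?N}"
      have n1: "nat (int n - (int j - int n)) = ?N - j" "nat (int n + (int j - int n)) = j" using j by auto
      have "a * ?Q ^ n * (?G j * ?T (int j - int n)) = ?G j * (a * ?Q ^ n * ?T (int j - int n))"
        by (simp only: mult_ac)
      also have "a * ?Q ^ n * ?T (int j - int n) = ?Q ^ (?N - j) * ?T (int j - int n + 1)"
        using triangle_term_step[of "int j - int n" n a b] j unfolding n1 by simp
      finally show "a * ?Q ^ n * (?G j * ?T (int j - int n)) = ?Q ^ (?N - j) * ?G j * ?T (int j + 1 - int n)"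
        by (simp add: mult_ac algebra_simps)
      have "b * ?Q ^ n * (?G j * ?T (int j - int n)) = ?G j * (b * ?Q ^ n * ?T (int j - int n))"
        by (simp only: mult_ac)
      also have "b * ?Q ^ n * ?T (int j - int n) = ?Q ^ j * ?T (int j - int n - 1)"
        using triangle_term_step'[of "int j - int n" n b a] j unfolding n1 by simp
      finally show "b * ?Q ^ n * (?G j * ?T (int j - int n)) = ?Q ^ j * ?G j * ?T (int j - 1 - int n)"
        by (simp add: mult_ac algebra_simps)
    qed (simp only: mult.assoc)
  qed
  also have "\<dots> = (\<Sum>i\<le>?N + 2. gauss_binomial ?Q (?N + 2) i * ?T (int i - int (Suc n)))"
  proof -
    \<comment> \<open>What the three copies contribute at index \<open>i\<close>. With N = 2 n and
      brackets for Gaussian binomials, the identity is [N+2, i] = (1 + Q^(N+1)) [N, i-1] + Q^(N+2-i)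
      [N, i-2] + Q^i [N, i].\<close>
    define g where "g i = (if i \<ge> 1 \<and> i \<le> ?N + 1 then (1 + ?Q ^ Suc ?N) * ?G (i - 1) else 0)" for i
    define g' where "g' i = (if i \<ge> 2 then ?Q ^ (?N + 2 - i) * ?G (i - 2) else 0)" for i
    define g'' where "g'' i = (if i \<le> ?N then ?Q ^ i * ?G i else 0)" for i
    have "gauss_binomial ?Q (?N + 2) i = g i + g' i + g'' i" if i: "i \<le> ?N + 2" for i
    proof (cases i)
      case 0
      then show ?thesis by (simp add: g_def g'_def g''_def)
    next
      case (Suc j)
      then have jN: "j \<le> Suc ?N" using i by simp
      have P1: "gauss_binomial ?Q (?N + 2) (Suc j) = gauss_binomial ?Q (Suc ?N) j + ?Q ^ Suc j * gauss_binomial ?Q (Suc ?N) (Suc j)"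
        by simp
      have A: "gauss_binomial ?Q (Suc ?N) j = (if j \<ge> 1 then ?Q ^ (?N + 1 - j) * ?G (j - 1) else 0) + (if j \<le> ?N then ?G j else 0)"
      proof (cases j)
        case (Suc l)
        then show ?thesis using gauss_binomial_pascal[of l ?N ?Q] nz jN by (simp add: gauss_binomial_eq_0)
      qed simp
      have B: "?Q ^ Suc j * gauss_binomial ?Q (Suc ?N) (Suc j) = (if j \<le> ?N then ?Q ^ Suc ?N * ?G j else 0) + (if Suc j \<le> ?N then ?Q ^ Suc j * ?G (Suc j) else 0)"
      proof (cases "j \<le> ?N")
        case True
        have "?Q ^ Suc j * ?Q ^ (?N - j) = ?Q ^ Suc ?N" using True by (simp flip: power_add power_Suc)
        then show ?thesis using gauss_binomial_pascal[OF True nz] True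
          by (simp add: distrib_left mult.assoc[symmetric] gauss_binomial_eq_0 del: power_Suc)
      next
        case False
        then show ?thesis by (simp add: gauss_binomial_eq_0)
      qed
      have "g (Suc j) = (if j \<le> ?N then ?G j + ?Q ^ Suc ?N * ?G j else 0)"
        unfolding g_def by (simp add: distrib_right del: power_Suc)
      moreover have "g' (Suc j) = (if j \<ge> 1 then ?Q ^ (?N + 1 - j) * ?G (j - 1) else 0)"
        unfolding g'_def by (cases j) simp_all
      moreover have "g'' (Suc j) = (if Suc j \<le> ?N then ?Q ^ Suc j * ?G (Suc j) else 0)"
        unfolding g''_def by (simp del: power_Suc)
      ultimately show ?thesis unfolding Suc P1 A B by (cases "j \<le> ?N") (simp_all only: if_True if_False ac_simps add_0_left add_0_right)
    qed
    then have "(\<Sum>i\<le>?N + 2. gauss_binomial ?Q (?N + 2) i * ?T (int i - int (Suc n))) =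
      (\<Sum>i\<le>?N + 2. g i * ?T (int i - int (Suc n))) + (\<Sum>i\<le>?N + 2. g' i * ?T (int i - int (Suc n)))
      + (\<Sum>i\<le>?N + 2. g'' i * ?T (int i - int (Suc n)))"
      by (simp add: distrib_right sum.distrib)
    moreover have "(\<Sum>i\<le>?N + 2. g i * ?T (int i - int (Suc n))) = (\<Sum>j\<le>?N. (1 + ?Q ^ Suc ?N) * ?G j * ?T (int j - int n))"
    proof -
      have "(\<Sum>i\<le>Suc (Suc ?N). f i) = f 0 + (\<Sum>j\<le>?N. f (Suc j)) + f (Suc (Suc ?N))" for f :: "nat \<Rightarrow> 'a"
        by (simp only: sum.atMost_Suc_shift[of f] sum.atMost_Suc[of "\<lambda>i. f (Suc i)"] add.assoc)
      then show ?thesis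
        unfolding add_2_eq_Suc' by (simp add: g_def del: power_Suc sum.atMost_Suc)
    qed
    moreover have "(\<Sum>i\<le>?N + 2. g' i * ?T (int i - int (Suc n))) = (\<Sum>j\<le>?N. ?Q ^ (?N - j) * ?G j * ?T (int j + 1 - int n))"
    proof -
      have "(\<Sum>i\<le>Suc (Suc ?N). f i) = f 0 + (f (Suc 0) + (\<Sum>j\<le>?N. f (Suc (Suc j))))" for f :: "nat \<Rightarrow> 'a"
        by (simp only: sum.atMost_Suc_shift[of f] sum.atMost_Suc_shift[of "\<lambda>i. f (Suc i)"])
      then show ?thesis
        unfolding add_2_eq_Suc' by (simp add: g'_def add.commute add_diff_eq del: power_Suc sum.atMost_Suc)
    qed
    moreover have "(\<Sum>i\<le>?N + 2. g'' i * ?T (int i - int (Suc n))) = (\<Sum>j\<le>?N. ?Q ^ j * ?G j * ?T (int j - 1 - int n))"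
      by (rule sum.mono_neutral_cong_right) (auto simp: g''_def algebra_simps)
    ultimately show ?thesis by simp
  qed
  finally show ?case by simp
qed

section \<open>Counting series, dilations and Euler products\<close>

definition count_series :: "('i \<Rightarrow> nat) \<Rightarrow> 'a :: semiring_1 fps" where
  "count_series f = Abs_fps (\<lambda>n. of_nat (card {i. f i = n}))"

lemma count_series_nth: "fps_nth (count_series f) n = of_nat (card {i. f i = n})"
  by (simp add: count_series_def)

lemma count_series_mult:
  fixes f :: "'i \<Rightarrow> nat" and g :: "'j \<Rightarrow> nat"
  assumes f: "\<And>n. finite {i. f i = n}" and g: "\<And>n. finite {j. g j = n}"
  shows "count_series f * count_series g = (count_series (\<lambda>p. f (fst p) + g (snd p)) :: 'a :: comm_semiring_1 fps)"
proof (rule fps_ext)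
  fix n
  have "{p. f (fst p) + g (snd p) = n} = (\<Union>k\<in>{0..n}. {i. f i = k} \<times> {j. g j = n - k})"
    by (auto intro!: bexI[of _ "f _"])
  also have "card \<dots> = (\<Sum>k\<in>{0..n}. card ({i. f i = k} \<times> {j. g j = n - k}))"
    using f g by (intro card_UN_disjoint) auto
  finally have "card {p. f (fst p) + g (snd p) = n} = (\<Sum>k\<in>{0..n}. card {i. f i = k} * card {j. g j = n - k})"
    by (simp add: card_cartesian_product)
  then show "fps_nth (count_series f * count_series g :: 'a fps) n = fps_nth (count_series (\<lambda>p. f (fst p) + g (snd p))) n"
    by (simp add: fps_mult_nth count_series_nth)
qed

lemma count_series_shift: "fps_X ^ m * count_series f = (count_series (\<lambda>i. m + f i) :: 'a :: comm_semiring_1 fps)"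
proof (rule fps_ext)
  fix n
  have "{i. m + f i = n} = (if n < m then {} else {i. f i = n - m})" by auto
  then show "fps_nth (fps_X ^ m * count_series f :: 'a fps) n = fps_nth (count_series (\<lambda>i. m + f i)) n"
    by (simp add: count_series_nth fps_X_power_mult_nth)
qed

lemma fps_compose_X_power_nth:
  fixes F :: "'a :: comm_ring_1 fps"
  assumes m: "m > 0"
  shows "fps_nth (F oo fps_X ^ m) n = (if m dvd n then fps_nth F (n div m) else 0)"
proof -
  have "fps_nth (F oo fps_X ^ m) n = (\<Sum>i\<in>{0..n}. if n = m * i then fps_nth F i else 0)"
    unfolding fps_compose_nth by (intro sum.cong refl) (simp add: fps_X_power_nth flip: power_mult)
  also have "\<dots> = (if m dvd n then fps_nth F (n div m) else 0)"
  proof (cases "m dvd n")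
    case True
    then obtain k where k: "n = m * k" by blast
    have "k \<le> n" using k m by simp
    moreover have "(n = m * i) \<longleftrightarrow> i = k" for i using k m by auto
    ultimately have "(\<Sum>i\<in>{0..n}. if n = m * i then fps_nth F i else 0) = fps_nth F k"
      by (simp only:) (simp add: sum.delta)
    moreover have "n div m = k" using k m by simp
    ultimately show ?thesis using True by (simp only: if_True)
  next
    case False
    then have "(if n = m * i then fps_nth F i else 0) = 0" for i by auto
    then show ?thesis using False by simp
  qed
  finally show ?thesis .
qed

lemma count_series_dilate:
  assumes "m > 0"
  shows "count_series f oo fps_X ^ m = (count_series (\<lambda>i. m * f i) :: 'a :: comm_ring_1 fps)"
proof (rule fps_ext)
  fix n
  have "{i. m * f i = n} = (if m dvd n then {i. f i = n div m} else {})" using assms by auto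
  then show "fps_nth (count_series f oo fps_X ^ m :: 'a fps) n = fps_nth (count_series (\<lambda>i. m * f i)) n"
    using assms by (simp add: count_series_nth fps_compose_X_power_nth)
qed

lemma fps_X_power_nth_0: "m > 0 \<Longrightarrow> fps_nth (fps_X ^ m :: 'a :: comm_ring_1 fps) 0 = 0"
  by (simp add: fps_X_power_nth)

lemma fps_cong_dilate:
  fixes F G :: "'a :: comm_ring_1 fps"
  assumes "fps_cong N F G" "m > 0"
  shows "fps_cong N (F oo fps_X ^ m) (G oo fps_X ^ m)"
  using assms by (auto simp: fps_cong_def fps_compose_X_power_nth intro: le_less_trans[OF div_le_dividend])

definition euler_product :: "nat \<Rightarrow> nat \<Rightarrow> 'a :: comm_ring_1 fps" where
  "euler_product m N = (\<Prod>i<N. 1 - fps_X ^ (m * Suc i))"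

lemma euler_product_eq_q_factorial: "euler_product m N = q_factorial (fps_X ^ m) N"
  by (simp only: euler_product_def q_factorial_def power_mult)

lemma euler_product_nth_0: "m > 0 \<Longrightarrow> fps_nth (euler_product m N :: 'a :: comm_ring_1 fps) 0 = 1"
  by (induction N) (simp_all add: euler_product_def fps_X_power_nth)

lemma fps_cong_one_minus:
  "N \<le> m \<Longrightarrow> fps_cong N (1 - fps_X ^ m) (1 :: 'a :: comm_ring_1 fps)"
  by (simp add: fps_cong_def fps_X_power_nth)

lemma euler_product_extend:
  assumes "m > 0" "N \<le> M"
  shows "fps_cong N (euler_product m M) (euler_product m N :: 'a :: comm_ring_1 fps)"
  unfolding euler_product_def
proof (rule fps_cong_prod_extend[OF fps_cong_one_minus assms(2)])
  fix i assume "N \<le> i"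
  also have "i \<le> m * Suc i" using assms(1) by (simp add: trans_le_add2)
  finally show "N \<le> m * Suc i" .
qed

lemma euler_product_dilate:
  fixes m k N :: nat
  assumes "k > 0"
  shows "(euler_product m N :: 'a :: idom fps) oo fps_X ^ k = euler_product (k * m) N"
proof -
  have c0: "fps_nth (fps_X ^ k :: 'a fps) 0 = 0" using assms by (rule fps_X_power_nth_0)
  have "(fps_X ^ j :: 'a fps) oo fps_X ^ k = fps_X ^ (k * j)" for j
    using fps_compose_power[OF c0, of fps_X j] by (simp add: fps_X_fps_compose_startby0[OF c0] power_mult)
  then have "(1 - fps_X ^ (m * Suc i) :: 'a fps) oo fps_X ^ k = 1 - fps_X ^ (k * m * Suc i)" for i
    by (simp only: fps_compose_sub_distrib fps_compose_1 mult.assoc)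
  then show ?thesis unfolding euler_product_def fps_compose_prod_distrib[OF c0] by (simp only:)
qed

text \<open>The exponent of \<open>fps_X\<close> in \<open>triangle_term\<close> at two monomials.
  As \<open>k\<close> runs through the integers, the weights (1, 1) give the squares, (1, 3) the
  triangular numbers 2 k^2 - k, and (1, 2) the generalised pentagonal numbers (3 k^2 - k) /
  2.\<close>

definition triangle_weight :: "nat \<Rightarrow> nat \<Rightarrow> int \<Rightarrow> nat" where
  "triangle_weight \<alpha> \<beta> k = \<alpha> * nat (k * (k + 1) div 2) + \<beta> * nat (k * (k - 1) div 2)"

lemma triangle_weight_ge:
  assumes "\<alpha> + \<beta> > 0" "int N < \<bar>k\<bar>"
  shows "N \<le> triangle_weight \<alpha> \<beta> k"
proof -
  have 1: "\<bar>k\<bar> * (\<bar>k\<bar> - 1) \<le> k * (k + 1)" "\<bar>k\<bar> * (\<bar>k\<bar> - 1) \<le> k * (k - 1)"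
    by (cases "k \<ge> 0"; simp add: algebra_simps)+
  have 2: "2 * int N \<le> \<bar>k\<bar> * (\<bar>k\<bar> - 1)"
  proof (cases "N = 0")
    case True
    then show ?thesis using assms(2) by simp
  next
    case False
    then have "2 * int N \<le> (int N + 1) * int N" by simp
    also have "\<dots> \<le> \<bar>k\<bar> * (\<bar>k\<bar> - 1)" using assms(2) by (intro mult_mono) auto
    finally show ?thesis .
  qed
  have "int N \<le> k * (k + 1) div 2" "int N \<le> k * (k - 1) div 2"
    using 1 2 triangle_half[of k] by linarith+
  then have "N \<le> nat (k * (k + 1) div 2)" "N \<le> nat (k * (k - 1) div 2)" by linarith+
  then have "\<alpha> * N + \<beta> * N \<le> triangle_weight \<alpha> \<beta> k"
    unfolding triangle_weight_def by (intro add_mono mult_left_mono) auto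
  moreover have "1 * N \<le> (\<alpha> + \<beta>) * N" using assms(1) by (intro mult_right_mono) auto
  ultimately show ?thesis by (simp add: distrib_right)
qed

lemma finite_triangle_weight:
  assumes "\<alpha> + \<beta> > 0"
  shows "finite {k. triangle_weight \<alpha> \<beta> k = n}"
proof (rule finite_subset)
  show "{k. triangle_weight \<alpha> \<beta> k = n} \<subseteq> {- int (Suc n)..int (Suc n)}"
  proof
    fix k assume "k \<in> {k. triangle_weight \<alpha> \<beta> k = n}"
    then have "\<not> int (Suc n) < \<bar>k\<bar>" using triangle_weight_ge[OF assms, of "Suc n" k] by auto
    then show "k \<in> {- int (Suc n)..int (Suc n)}" by auto
  qed
qed simp

lemma triangle_term_monomial:
  "triangle_term (fps_const c * fps_X ^ \<alpha>) (fps_const c * fps_X ^ \<beta>) k =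
    fps_const (c ^ (nat (k * (k + 1) div 2) + nat (k * (k - 1) div 2))) * fps_X ^ triangle_weight \<alpha> \<beta> k"
  by (simp add: triangle_term_def triangle_weight_def power_mult_distrib power_add power_mult[symmetric]
      fps_const_power mult_ac flip: fps_const_mult)

lemma q_factorial_X_power_nonzero:
  "m > 0 \<Longrightarrow> q_factorial (fps_X ^ m :: 'a :: idom fps) n \<noteq> 0"
  using euler_product_nth_0[of m n, where ?'a = 'a] unfolding euler_product_eq_q_factorial
  by (metis fps_zero_nth zero_neq_one)

text \<open>The condition on \<open>c\<close> makes it a sign, so \<open>a * b\<close> is a pure
  power of \<open>fps_X\<close>. The finite identity is used with \<open>2 * N\<close> factors:
  below degree \<open>N\<close> the middle Gaussian binomials are inverse to the Euler product, and
  every term with index beyond \<open>N\<close> in absolute value starts at degree \<open>N\<close>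
  or later.\<close>

theorem jacobi_triple_product_cong:
  fixes c :: "'a :: idom"
  assumes c: "c * c = 1" and pos: "\<alpha> + \<beta> > 0"
  defines "a \<equiv> fps_const c * fps_X ^ \<alpha>" and "b \<equiv> fps_const c * fps_X ^ \<beta>"
  shows "fps_cong N ((\<Prod>i<N. (1 + a * (fps_X ^ (\<alpha> + \<beta>)) ^ i) * (1 + b * (fps_X ^ (\<alpha> + \<beta>)) ^ i)) * euler_product (\<alpha> + \<beta>) N)
    (\<Sum>k\<in>{- int N..int N}. triangle_term a b k)"
proof -
  define m where "m = \<alpha> + \<beta>"
  define Q where "Q = (fps_X ^ m :: 'a fps)"
  have ab: "a * b = Q"
    by (simp add: a_def b_def Q_def m_def power_add mult_ac c fps_const_mult[symmetric] del: fps_const_mult)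
  have m: "m > 0" using pos by (simp add: m_def)
  have nz: "q_factorial (a * b) n \<noteq> 0" for n
    unfolding ab Q_def by (rule q_factorial_X_power_nonzero[OF m])
  define e where "e = (euler_product m N :: 'a fps)"
  have e0: "fps_nth e 0 = 1" unfolding e_def by (rule euler_product_nth_0[OF m])
  let ?P = "\<lambda>n. \<Prod>i<n. (1 + a * Q ^ i) * (1 + b * Q ^ i)"
  have far: "fps_cong N (1 + fps_const c * fps_X ^ \<gamma> * Q ^ i) 1" if "i \<ge> N" for i \<gamma>
  proof -
    have "fps_const c * fps_X ^ \<gamma> * Q ^ i = fps_X ^ (\<gamma> + m * i) * fps_const c"
    proof -
      have "(fps_X :: 'a fps) ^ (\<gamma> + m * i) = fps_X ^ \<gamma> * (fps_X ^ m) ^ i" by (simp only: power_add power_mult)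
      then show ?thesis unfolding Q_def by (simp only: mult_ac)
    qed
    moreover have "N \<le> \<gamma> + m * i" using that m by (simp add: trans_le_add2 le_trans[OF that])
    ultimately show ?thesis using fps_cong_one_plus[of N "\<gamma> + m * i" "fps_const c"] by (simp only:)
  qed
  have P: "fps_cong N (?P (2 * N)) (?P N)"
  proof (rule fps_cong_prod_extend)
    fix i assume "N \<le> i"
    then show "fps_cong N ((1 + a * Q ^ i) * (1 + b * Q ^ i)) 1"
      using fps_cong_mult[OF far far, of i i \<alpha> \<beta>] by (simp add: a_def b_def)
  qed simp
  have qf: "fps_cong N (q_factorial Q M) e" if "M \<ge> N" for M
    using euler_product_extend[OF m that] unfolding e_def euler_product_eq_q_factorial Q_def .
  \<comment> \<open>A Gaussian binomial times two q-factorials is a q-factorial, and in this range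
    all three have index at least \<open>N\<close>, hence agree with \<open>e\<close>; one factor
    \<open>e\<close> is cancelled.\<close>
  have gb: "fps_cong N (gauss_binomial Q (2 * (2 * N)) j * e) 1" if "N \<le> j" "j \<le> 3 * N" for j
  proof (rule fps_cong_cancel[OF _ e0])
    have "fps_cong N (gauss_binomial Q (2 * (2 * N)) j * (e * e))
       (gauss_binomial Q (2 * (2 * N)) j * (q_factorial Q j * q_factorial Q (2 * (2 * N) - j)))"
      using that by (intro fps_cong_mult fps_cong_refl fps_cong_sym[OF qf]) auto
    also have "\<dots> = q_factorial Q (2 * (2 * N))"
      using that by (intro gauss_binomial_product) auto
    also have "fps_cong N \<dots> e" by (rule qf) simp
    finally show "fps_cong N (gauss_binomial Q (2 * (2 * N)) j * e * e) (1 * e)" by (simp add: mult.assoc)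
  qed
  have T0: "fps_cong N (triangle_term a b k) 0" if "\<not> \<bar>k\<bar> \<le> int N" for k
  proof -
    have "triangle_term a b k = fps_X ^ triangle_weight \<alpha> \<beta> k * fps_const (c ^ (nat (k * (k + 1) div 2) + nat (k * (k - 1) div 2)))"
      unfolding a_def b_def triangle_term_monomial by (rule mult.commute)
    moreover have "N \<le> triangle_weight \<alpha> \<beta> k"
      using that triangle_weight_ge[OF pos, of N k] by auto
    ultimately show ?thesis using fps_cong_X_power_0 by simp
  qed
  have "fps_cong N (?P N * e) (?P (2 * N) * e)"
    by (intro fps_cong_mult fps_cong_refl fps_cong_sym[OF P])
  also have "?P (2 * N) * e = (\<Sum>j\<le>2 * (2 * N). gauss_binomial Q (2 * (2 * N)) j * e * triangle_term a b (int j - int (2 * N)))"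
    unfolding finite_triple_product[OF nz, unfolded ab] by (simp add: sum_distrib_left sum_distrib_right mult_ac)
  also have "fps_cong N \<dots> (\<Sum>j\<le>2 * (2 * N). if \<bar>int j - int (2 * N)\<bar> \<le> int N then triangle_term a b (int j - int (2 * N)) else 0)"
  proof (rule fps_cong_sum)
    fix j assume "j \<in> {..2 * (2 * N)}"
    show "fps_cong N (gauss_binomial Q (2 * (2 * N)) j * e * triangle_term a b (int j - int (2 * N)))
      (if \<bar>int j - int (2 * N)\<bar> \<le> int N then triangle_term a b (int j - int (2 * N)) else 0)"
    proof (cases "\<bar>int j - int (2 * N)\<bar> \<le> int N")
      case True
      then have "N \<le> j" "j \<le> 3 * N" by auto
      from fps_cong_mult[OF gb[OF this] fps_cong_refl] show ?thesis using True by simp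
    next
      case False
      from fps_cong_mult[OF fps_cong_refl T0[OF False], of "gauss_binomial Q (2 * (2 * N)) j * e"] show ?thesis
        using False by simp
    qed
  qed
  also have "(\<Sum>j\<le>2 * (2 * N). if \<bar>int j - int (2 * N)\<bar> \<le> int N then triangle_term a b (int j - int (2 * N)) else 0)
      = (\<Sum>k\<in>{- int N..int N}. triangle_term a b k)"
  proof -
    have "(\<Sum>j\<le>2 * (2 * N). if \<bar>int j - int (2 * N)\<bar> \<le> int N then triangle_term a b (int j - int (2 * N)) else 0)
      = (\<Sum>j\<in>{N..3 * N}. triangle_term a b (int j - int (2 * N)))"
      by (rule sum.mono_neutral_cong_right) auto
    also have "\<dots> = (\<Sum>k\<in>{- int N..int N}. triangle_term a b k)"
      by (rule sum.reindex_bij_witness[of _ "\<lambda>k. nat (k + int (2 * N))" "\<lambda>j. int j - int (2 * N)"]) auto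
    finally show ?thesis .
  qed
  finally show ?thesis unfolding e_def Q_def m_def .
qed

lemma sum_triangle_term_cong:
  assumes pos: "\<alpha> + \<beta> > 0"
  shows "fps_cong N (\<Sum>k\<in>{- int N..int N}. triangle_term (fps_const c * fps_X ^ \<alpha>) (fps_const c * fps_X ^ \<beta>) k)
    (Abs_fps (\<lambda>n. \<Sum>k | triangle_weight \<alpha> \<beta> k = n. (c :: 'a :: idom) ^ (nat (k * (k + 1) div 2) + nat (k * (k - 1) div 2))))"
  unfolding fps_cong_def
proof (intro allI impI)
  fix n assume n: "n < N"
  have sub: "{k. triangle_weight \<alpha> \<beta> k = n} \<subseteq> {- int N..int N}"
  proof
    fix k assume "k \<in> {k. triangle_weight \<alpha> \<beta> k = n}"
    then have "\<not> int N < \<bar>k\<bar>" using triangle_weight_ge[OF pos, of N k] n by auto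
    then show "k \<in> {- int N..int N}" by auto
  qed
  let ?c = "\<lambda>k. c ^ (nat (k * (k + 1) div 2) + nat (k * (k - 1) div 2))"
  have "fps_nth (\<Sum>k\<in>{- int N..int N}. triangle_term (fps_const c * fps_X ^ \<alpha>) (fps_const c * fps_X ^ \<beta>) k) n
    = (\<Sum>k\<in>{- int N..int N}. if triangle_weight \<alpha> \<beta> k = n then ?c k else 0)"
    unfolding fps_sum_nth triangle_term_monomial
    by (intro sum.cong refl) (simp add: fps_mult_left_const_nth fps_X_power_nth)
  also have "\<dots> = (\<Sum>k | triangle_weight \<alpha> \<beta> k = n. ?c k)"
    using sub by (intro sum.mono_neutral_cong_right) auto
  finally show "fps_nth (\<Sum>k\<in>{- int N..int N}. triangle_term (fps_const c * fps_X ^ \<alpha>) (fps_const c * fps_X ^ \<beta>) k) n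
    = fps_nth (Abs_fps (\<lambda>n. \<Sum>k | triangle_weight \<alpha> \<beta> k = n. ?c k)) n" by simp
qed

lemma jacobi_triple_product_count:
  assumes "\<alpha> + \<beta> > 0"
  shows "fps_cong N ((\<Prod>i<N. (1 + fps_X ^ (\<alpha> + (\<alpha> + \<beta>) * i)) * (1 + fps_X ^ (\<beta> + (\<alpha> + \<beta>) * i))) * euler_product (\<alpha> + \<beta>) N)
    (count_series (triangle_weight \<alpha> \<beta>) :: 'a :: idom fps)"
proof -
  have "fps_cong N ((\<Prod>i<N. (1 + fps_const 1 * fps_X ^ \<alpha> * (fps_X ^ (\<alpha> + \<beta>)) ^ i) * (1 + fps_const 1 * fps_X ^ \<beta> * (fps_X ^ (\<alpha> + \<beta>)) ^ i)) * euler_product (\<alpha> + \<beta>) N)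
    (\<Sum>k\<in>{- int N..int N}. triangle_term (fps_const (1 :: 'a) * fps_X ^ \<alpha>) (fps_const 1 * fps_X ^ \<beta>) k)"
    by (rule jacobi_triple_product_cong) (use assms in auto)
  also have "fps_cong N \<dots> (Abs_fps (\<lambda>n. \<Sum>k | triangle_weight \<alpha> \<beta> k = n. 1 ^ (nat (k * (k + 1) div 2) + nat (k * (k - 1) div 2))))"
    by (rule sum_triangle_term_cong[OF assms])
  also have "\<dots> = count_series (triangle_weight \<alpha> \<beta>)"
    by (simp add: count_series_def)
  finally show ?thesis by (simp add: power_add power_mult)
qed

subsection \<open>The parity of the coefficients\<close>

text \<open>Bounding the parts by \<open>k\<close> permits an induction in which each new part size
  contributes one factor of the Euler product.\<close>

definition bounded_partitions :: "nat \<Rightarrow> nat \<Rightarrow> nat multiset set" where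
  "bounded_partitions k n = {Q. set_mset Q \<subseteq> {1..k} \<and> sum_mset Q = n}"

lemma finite_bounded_partitions: "finite (bounded_partitions k n)"
  by (rule finite_subset[OF _ finite_partitions[of n]]) (auto simp: bounded_partitions_def)

lemma bounded_partitions_0: "bounded_partitions 0 n = (if n = 0 then {{#}} else {})"
  by (auto simp: bounded_partitions_def)

lemma card_bounded_partitions_Suc:
  "card (bounded_partitions (Suc k) n) =
    card (bounded_partitions k n) + (if Suc k \<le> n then card (bounded_partitions (Suc k) (n - Suc k)) else 0)"
proof -
  define B where "B = {Q \<in> bounded_partitions (Suc k) n. Suc k \<in># Q}"
  have "bounded_partitions (Suc k) n = bounded_partitions k n \<union> B"
  proof -
    have "x \<le> k" if "x \<le> Suc k" "x \<noteq> Suc k" for x using that by simp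
    then show ?thesis unfolding bounded_partitions_def B_def
      by (auto simp: subset_iff) (metis le_SucE)+
  qed
  moreover have "bounded_partitions k n \<inter> B = {}" by (auto simp: bounded_partitions_def B_def)
  moreover have "finite B" unfolding B_def using finite_bounded_partitions by simp
  ultimately have "card (bounded_partitions (Suc k) n) = card (bounded_partitions k n) + card B"
    using finite_bounded_partitions by (simp add: card_Un_disjoint)
  moreover have "card B = (if Suc k \<le> n then card (bounded_partitions (Suc k) (n - Suc k)) else 0)"
  proof (cases "Suc k \<le> n")
    case True
    have "bij_betw (add_mset (Suc k)) (bounded_partitions (Suc k) (n - Suc k)) B"
    proof (rule bij_betw_byWitness[where f' = "\<lambda>Q. Q - {#Suc k#}"])
      show "add_mset (Suc k) ` bounded_partitions (Suc k) (n - Suc k) \<subseteq> B"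
        using True by (auto simp: bounded_partitions_def B_def)
      show "(\<lambda>Q. Q - {#Suc k#}) ` B \<subseteq> bounded_partitions (Suc k) (n - Suc k)"
      proof
        fix R assume "R \<in> (\<lambda>Q. Q - {#Suc k#}) ` B"
        then obtain Q where Q: "R = Q - {#Suc k#}" "Q \<in> B" by blast
        then have "Q = add_mset (Suc k) R" by (simp add: B_def)
        then show "R \<in> bounded_partitions (Suc k) (n - Suc k)"
          using Q(2) by (auto simp: B_def bounded_partitions_def)
      qed
    qed (auto simp: B_def)
    then show ?thesis using True by (simp add: bij_betw_same_card)
  next
    case False
    have "Q \<notin> B" for Q
    proof
      assume "Q \<in> B"
      then obtain R where "Q = add_mset (Suc k) R" "sum_mset Q = n"
        by (auto simp: B_def bounded_partitions_def dest: multi_member_split)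
      then show False using False by simp
    qed
    then have "B = {}" by blast
    then show ?thesis using False by simp
  qed
  ultimately show ?thesis by simp
qed

lemma bounded_partition_series:
  "Abs_fps (\<lambda>n. of_nat (card (bounded_partitions N n))) * euler_product 1 N = (1 :: 'a :: comm_ring_1 fps)"
proof (induction N)
  case 0
  have "Abs_fps (\<lambda>n. of_nat (card (bounded_partitions 0 n))) = (1 :: 'a fps)"
    by (rule fps_ext) (simp add: bounded_partitions_0)
  then show ?case by (simp add: euler_product_def)
next
  case (Suc N)
  have "Abs_fps (\<lambda>n. of_nat (card (bounded_partitions (Suc N) n))) * (1 - fps_X ^ Suc N) =
      (Abs_fps (\<lambda>n. of_nat (card (bounded_partitions N n))) :: 'a fps)"
    unfolding right_diff_distrib mult_1_right
    by (rule fps_ext) (simp add: fps_X_power_mult_right_nth card_bounded_partitions_Suc not_less del: power_Suc)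
  then have "Abs_fps (\<lambda>n. of_nat (card (bounded_partitions (Suc N) n))) * euler_product 1 (Suc N) =
      (Abs_fps (\<lambda>n. of_nat (card (bounded_partitions N n))) :: 'a fps) * euler_product 1 N"
  proof -
    assume A: "Abs_fps (\<lambda>n. of_nat (card (bounded_partitions (Suc N) n))) * (1 - fps_X ^ Suc N) =
      (Abs_fps (\<lambda>n. of_nat (card (bounded_partitions N n))) :: 'a fps)"
    have e: "euler_product 1 (Suc N) = (1 - fps_X ^ Suc N) * (euler_product 1 N :: 'a fps)"
      by (simp add: euler_product_def mult.commute)
    show ?thesis unfolding e mult.assoc[symmetric] A ..
  qed
  then show ?case using Suc by simp
qed

lemma partition_series_cong:
  "fps_cong N (Abs_fps (\<lambda>n. of_nat (partition_number n)) * euler_product 1 N) (1 :: 'a :: comm_ring_1 fps)"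
proof -
  have "partition_number n = card (bounded_partitions N n)" if "n < N" for n
  proof -
    have "{P :: nat multiset. 0 \<notin># P \<and> sum_mset P = n} = bounded_partitions N n"
    proof -
      have "x \<in> {1..N}" if "0 \<notin># P" "sum_mset P = n" "x \<in># P" for P :: "nat multiset" and x
      proof -
        obtain R where "P = add_mset x R" using \<open>x \<in># P\<close> by (blast dest: multi_member_split)
        then show ?thesis using that \<open>n < N\<close> by (cases x) auto
      qed
      then show ?thesis by (auto simp: bounded_partitions_def)
    qed
    then show ?thesis by (simp add: partition_number_def)
  qed
  then have "fps_cong N (Abs_fps (\<lambda>n. of_nat (partition_number n))) (Abs_fps (\<lambda>n. of_nat (card (bounded_partitions N n))) :: 'a fps)"
    by (simp add: fps_cong_def)
  from fps_cong_mult[OF this fps_cong_refl, of "euler_product 1 N"] show ?thesis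
    unfolding bounded_partition_series .
qed

lemma half_partition_series_cong:
  "fps_cong N (Abs_fps (\<lambda>n. if even n then of_nat (partition_number (n div 2)) else 0) * euler_product 2 N) (1 :: int fps)"
proof -
  have c0: "fps_nth (fps_X ^ 2 :: int fps) 0 = 0" by simp
  have "Abs_fps (\<lambda>n. if even n then of_nat (partition_number (n div 2)) else 0) =
      (Abs_fps (\<lambda>n. of_nat (partition_number n)) oo fps_X ^ 2 :: int fps)"
    by (rule fps_ext) (simp add: fps_compose_X_power_nth)
  moreover have "fps_cong N ((Abs_fps (\<lambda>n. of_nat (partition_number n)) * euler_product 1 N) oo fps_X ^ 2) (1 oo fps_X ^ 2 :: int fps)"
    by (intro fps_cong_dilate partition_series_cong) simp
  ultimately show ?thesis
    by (simp add: fps_compose_mult_distrib[OF c0] euler_product_dilate)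
qed

lemma cphi2_product_cong:
  "fps_cong N (Abs_fps cphi2) (\<Prod>i<N. cphi2_factor i)"
proof -
  have "cphi2_factor has_prod Abs_fps (\<lambda>k. fps_nth (\<Prod>i\<le>k. cphi2_factor i) k)"
    by (rule fps_has_prod_stable) (simp add: cphi2_factor_nth)
  with cphi2_factor_has_prod have eq: "Abs_fps cphi2 = Abs_fps (\<lambda>k. fps_nth (\<Prod>i\<le>k. cphi2_factor i) k)"
    by (rule has_prod_unique2)
  have "fps_nth (\<Prod>i\<le>k. cphi2_factor i) k = fps_nth (\<Prod>i<N. cphi2_factor i) k" if "k < N" for k
  proof -
    have "fps_cong (Suc k) (\<Prod>i<N. cphi2_factor i) (\<Prod>i<Suc k. cphi2_factor i)"
      by (rule fps_cong_prod_extend) (use that in \<open>auto simp: fps_cong_def cphi2_factor_nth\<close>)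
    then show ?thesis by (simp add: fps_cong_def lessThan_Suc_atMost)
  qed
  then show ?thesis unfolding eq by (simp add: fps_cong_def)
qed

lemma fps_const_minus_1: "fps_const (- 1 :: int) = - 1"
  by (simp flip: fps_const_neg)

abbreviation odd_product :: "nat \<Rightarrow> int \<Rightarrow> int fps" where
  "odd_product N c \<equiv> \<Prod>i<N. 1 + fps_const c * fps_X ^ (2 * i + 1)"

lemma cphi2_denominator_cong:
  "fps_cong N (Abs_fps cphi2 * (odd_product N (- 1) ^ 4 * euler_product 4 N)) (odd_product N 1 * odd_product N (- 1))"
proof -
  have "(\<Prod>i<N. cphi2_factor i) * (\<Prod>i<N. cphi2_denom i) = (\<Prod>i<N. cphi2_numer i)"
    by (simp add: prod.distrib[symmetric] cphi2_factor_mult_denom)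
  moreover have "(\<Prod>i<N. cphi2_denom i) = odd_product N (- 1) ^ 4 * euler_product 4 N"
  proof -
    have "cphi2_denom i = (1 + fps_const (- 1) * fps_X ^ (2 * i + 1)) ^ 4 * (1 - fps_X ^ (4 * Suc i))" for i
    proof -
      have "4 * i + 4 = 4 * Suc i" by simp
      then show ?thesis unfolding cphi2_denom_def fps_const_minus_1 by (simp only:) simp
    qed
    then show ?thesis by (simp only: euler_product_def prod.distrib prod_power_distrib)
  qed
  moreover have "(\<Prod>i<N. cphi2_numer i) = odd_product N 1 * odd_product N (- 1)"
  proof -
    have "cphi2_numer i = (1 + fps_const 1 * fps_X ^ (2 * i + 1)) * (1 + fps_const (- 1) * fps_X ^ (2 * i + 1))" for i
    proof -
      have "(fps_X :: int fps) ^ (4 * i + 2) = fps_X ^ (2 * i + 1) * fps_X ^ (2 * i + 1)"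
        by (simp flip: power_add)
      then show ?thesis by (simp add: cphi2_numer_def algebra_simps del: power_Suc)
    qed
    then show ?thesis by (simp add: prod.distrib)
  qed
  ultimately show ?thesis
    using fps_cong_mult[OF cphi2_product_cong fps_cong_refl, of N "odd_product N (- 1) ^ 4 * euler_product 4 N"] by simp
qed

lemma euler_product_2_split:
  "fps_cong N (euler_product 2 N) (euler_product 4 N * (odd_product N 1 * odd_product N (- 1)))"
proof -
  have "euler_product 2 (2 * M) = euler_product 4 M * (odd_product M 1 * odd_product M (- 1))" for M
  proof (induction M)
    case (Suc M)
    have x: "(fps_X :: int fps) ^ (2 * Suc (2 * M)) = fps_X ^ (2 * M + 1) * fps_X ^ (2 * M + 1)"
      by (simp flip: power_add)
    have y: "(fps_X :: int fps) ^ (2 * Suc (Suc (2 * M))) = fps_X ^ (4 * Suc M)"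
      by (rule arg_cong[of _ _ "\<lambda>k. fps_X ^ k"]) simp
    have "euler_product 2 (2 * Suc M) = euler_product 2 (2 * M) * ((1 - fps_X ^ (2 * Suc (2 * M))) * (1 - (fps_X :: int fps) ^ (2 * Suc (Suc (2 * M)))))"
      by (simp add: euler_product_def mult.assoc)
    also have "(1 - fps_X ^ (2 * Suc (2 * M))) = (1 + fps_const 1 * fps_X ^ (2 * M + 1)) * (1 + fps_const (- 1) * (fps_X :: int fps) ^ (2 * M + 1))"
      unfolding x by (simp add: algebra_simps del: power_Suc)
    finally show ?case unfolding Suc y by (simp add: euler_product_def mult_ac del: power_Suc)
  qed (simp add: euler_product_def)
  from this[of N] show ?thesis
    using fps_cong_sym[OF euler_product_extend[of 2 N "2 * N", where ?'a = int]] by simp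
qed

text \<open>The triple product at a = b = c q. The sign has exponent k^2, which is the degree
  \<open>n\<close>, so c = 1 and c = -1 give Jacobi's theta series at q and at -q.\<close>

lemma theta3_cong:
  assumes c: "c * c = (1 :: int)"
  shows "fps_cong N (odd_product N c ^ 2 * euler_product 2 N) (Abs_fps (\<lambda>n. \<Sum>k | triangle_weight 1 1 k = n. c ^ n))"
proof -
  let ?a = "fps_const c * fps_X ^ 1 :: int fps"
  have pw: "(1 + ?a * (fps_X ^ (1 + 1)) ^ i) * (1 + ?a * (fps_X ^ (1 + 1)) ^ i) = (1 + fps_const c * fps_X ^ (2 * i + 1)) ^ 2" for i
  proof -
    have "(fps_X :: int fps) ^ 1 * (fps_X ^ (1 + 1)) ^ i = fps_X ^ (1 + (1 + 1) * i)"
      by (simp only: power_mult[symmetric] power_add[symmetric])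
    also have "1 + (1 + 1) * i = 2 * i + 1" by simp
    finally show ?thesis unfolding mult.assoc power2_eq_square by (simp only:)
  qed
  then have "odd_product N c ^ 2 * euler_product 2 N =
      (\<Prod>i<N. (1 + ?a * (fps_X ^ (1 + 1)) ^ i) * (1 + ?a * (fps_X ^ (1 + 1)) ^ i)) * euler_product (1 + 1) N"
    unfolding pw by (simp only: prod_power_distrib one_add_one)
  also have "fps_cong N \<dots> (\<Sum>k\<in>{- int N..int N}. triangle_term ?a ?a k)"
    by (rule jacobi_triple_product_cong[OF c]) simp
  also have "fps_cong N \<dots> (Abs_fps (\<lambda>n. \<Sum>k | triangle_weight 1 1 k = n. c ^ (nat (k * (k + 1) div 2) + nat (k * (k - 1) div 2))))"
    by (rule sum_triangle_term_cong) simp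
  also have "\<dots> = Abs_fps (\<lambda>n. \<Sum>k | triangle_weight 1 1 k = n. c ^ n)"
    by (intro fps_ext) (auto simp: triangle_weight_def intro!: sum.cong)
  finally show ?thesis .
qed

lemma int_triangle_weight:
  "2 * int (triangle_weight \<alpha> \<beta> k) = int \<alpha> * (k * (k + 1)) + int \<beta> * (k * (k - 1))"
proof -
  define A B where "A = k * (k + 1) div 2" "B = k * (k - 1) div 2"
  have AB: "2 * A = k * (k + 1)" "2 * B = k * (k - 1)" "0 \<le> A" "0 \<le> B"
    using triangle_half[of k] triangle_nonneg[of k] unfolding A_B_def by blast+
  have "2 * int (triangle_weight \<alpha> \<beta> k) = int \<alpha> * (2 * A) + int \<beta> * (2 * B)"
    using AB(3,4) unfolding triangle_weight_def A_B_def[symmetric] by simp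
  then show ?thesis unfolding AB .
qed

lemma triangle_weight_1_1: "triangle_weight 1 1 k = nat (k ^ 2)"
proof -
  have "int (triangle_weight 1 1 k) = k ^ 2"
    using int_triangle_weight[of 1 1 k] by (simp add: power2_eq_square algebra_simps)
  then show ?thesis by simp
qed

lemma int_triangle_weight_1_3: "int (triangle_weight 1 3 k) = 2 * k ^ 2 - k"
  using int_triangle_weight[of 1 3 k] by (simp add: power2_eq_square algebra_simps)

lemma int_triangle_weight_1_2: "2 * int (triangle_weight 1 2 k) = 3 * k ^ 2 - k"
  using int_triangle_weight[of 1 2 k] by (simp add: power2_eq_square algebra_simps)

text \<open>An odd integer is \<open>1 - 4 * k\<close> or \<open>4 * k - 1\<close> for exactly one
  \<open>k\<close>, and either square is 1 plus 8 times the triangular number 2 k^2 - k.\<close>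

lemma card_odd_squares:
  assumes "odd n"
  shows "card {k :: int. nat (k ^ 2) = n} = 2 * card {k. 1 + 8 * triangle_weight 1 3 k = n}"
proof -
  have w: "int (1 + 8 * triangle_weight 1 3 k) = (1 - 4 * k) ^ 2" for k
    using int_triangle_weight_1_3[of k] by (simp add: power2_eq_square algebra_simps del: One_nat_def)
  have w': "1 + 8 * triangle_weight 1 3 k = n \<longleftrightarrow> (1 - 4 * k) ^ 2 = int n" for k
    unfolding w[symmetric] by (simp only: of_nat_eq_iff)
  have sq: "nat (k ^ 2) = n \<longleftrightarrow> k ^ 2 = int n" for k :: int by auto
  let ?W = "{k. (1 - 4 * k) ^ 2 = int n}"
  have "{k :: int. k ^ 2 = int n} = (\<lambda>k. 1 - 4 * k) ` ?W \<union> (\<lambda>k. 4 * k - 1) ` ?W"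
  proof (rule subset_antisym; rule subsetI)
    fix x assume "x \<in> {k :: int. k ^ 2 = int n}"
    then have x: "x ^ 2 = int n" by simp
    then have "odd x" using assms by (metis even_of_nat even_power pos2)
    then obtain l where "x = 2 * l + 1" by (elim oddE)
    then have "x = 1 - 4 * (- (l div 2)) \<or> x = 4 * (l div 2 + 1) - 1" by presburger
    then show "x \<in> (\<lambda>k. 1 - 4 * k) ` ?W \<union> (\<lambda>k. 4 * k - 1) ` ?W"
    proof
      assume e: "x = 1 - 4 * (- (l div 2))"
      then have "- (l div 2) \<in> ?W" using x by simp
      then show ?thesis using e by blast
    next
      assume e: "x = 4 * (l div 2 + 1) - 1"
      have "(1 - 4 * (l div 2 + 1)) ^ 2 = x ^ 2" unfolding e by (simp add: power2_eq_square algebra_simps)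
      then have "(1 - 4 * (l div 2 + 1)) ^ 2 = int n" unfolding x .
      then show ?thesis using e by blast
    qed
  qed (auto simp: power2_commute)
  moreover have "finite ?W"
  proof -
    have "finite {k. triangle_weight 1 3 k = (n - 1) div 8}" by (rule finite_triangle_weight) simp
    moreover have "?W \<subseteq> {k. triangle_weight 1 3 k = (n - 1) div 8}" unfolding w'[symmetric] by auto
    ultimately show ?thesis by (rule finite_subset[rotated])
  qed
  moreover have "(\<lambda>k. 1 - 4 * k) ` ?W \<inter> (\<lambda>k. 4 * k - 1) ` ?W = {}"
  proof -
    have "1 - 4 * k \<noteq> 4 * l - (1 :: int)" for k l by presburger
    then show ?thesis by blast
  qed
  ultimately have "card {k :: int. k ^ 2 = int n} = card ((\<lambda>k. 1 - 4 * k) ` ?W) + card ((\<lambda>k. 4 * k - 1) ` ?W)"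
    by (simp add: card_Un_disjoint)
  also have "card ((\<lambda>k. 1 - 4 * k) ` ?W) = card ?W" by (rule card_image) (auto simp: inj_on_def)
  also have "card ((\<lambda>k. 4 * k - 1) ` ?W) = card ?W" by (rule card_image) (auto simp: inj_on_def)
  finally show ?thesis unfolding w' sq by simp
qed

definition odd_square_series :: "int fps" where
  "odd_square_series = count_series (\<lambda>k. 1 + 8 * triangle_weight 1 3 k)"

text \<open>Even squares cancel and odd ones double; a second factor 2 comes from the two signs of
  the root. This is the source of the divisibility by 4.\<close>

lemma theta3_difference:
  "Abs_fps (\<lambda>n. \<Sum>k | triangle_weight 1 1 k = n. 1 ^ n) - Abs_fps (\<lambda>n. \<Sum>k | triangle_weight 1 1 k = n. (- 1) ^ n)
    = fps_const 4 * odd_square_series"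
proof (rule fps_ext)
  fix n
  show "fps_nth (Abs_fps (\<lambda>n. \<Sum>k | triangle_weight 1 1 k = n. 1 ^ n) - Abs_fps (\<lambda>n. \<Sum>k | triangle_weight 1 1 k = n. (- 1) ^ n)) n
    = fps_nth (fps_const 4 * odd_square_series) n"
  proof (cases "even n")
    case True
    have "{k. 1 + 8 * triangle_weight 1 3 k = n} = {}" using True by auto
    then show ?thesis using True by (simp add: odd_square_series_def count_series_nth)
  next
    case False
    then show ?thesis
      using card_odd_squares[OF False] by (simp add: odd_square_series_def count_series_nth triangle_weight_1_1[unfolded One_nat_def])
  qed
qed

lemma odd_product_nth_0: "fps_nth (odd_product N c) 0 = 1"
  by (induction N) (simp_all add: fps_X_power_nth)

text \<open>The eta quotient for \<open>cphi2_bar\<close> with denominators cleared: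
  \<open>odd_product N (- 1) * euler_product 2 N\<close> is the full Euler product, and q times the
  triangular series in q^8 is the numerator.\<close>

theorem cphi2_bar_series_cong:
  "fps_cong N (Abs_fps cphi2_bar * (euler_product 2 N * (odd_product N (- 1) ^ 2 * euler_product 2 N))) (fps_const 4 * odd_square_series)"
proof -
  define a where "a = odd_product N (- 1)"
  define a' where "a' = odd_product N 1"
  define b where "b = (euler_product 2 N :: int fps)"
  define b4 where "b4 = (euler_product 4 N :: int fps)"
  define C where "C = Abs_fps cphi2"
  define p where "p = (Abs_fps (\<lambda>n. if even n then of_nat (partition_number (n div 2)) else 0) :: int fps)"
  have D: "Abs_fps cphi2_bar = C - p"
    by (rule fps_ext) (simp add: cphi2_bar_def C_def p_def)
  have 1: "fps_cong N (C * (a ^ 4 * b4)) (a' * a)"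
    using cphi2_denominator_cong[of N] by (simp only: C_def a_def a'_def b4_def)
  have 2: "fps_cong N b (b4 * (a' * a))"
    using euler_product_2_split[of N] by (simp only: a_def a'_def b_def b4_def)
  have 3: "fps_cong N (p * b) 1"
    using half_partition_series_cong[of N] by (simp only: p_def b_def)
  have "fps_cong N (C * (a ^ 4 * b)) (C * (a ^ 4 * (b4 * (a' * a))))"
    by (intro fps_cong_mult fps_cong_refl 2)
  also have "C * (a ^ 4 * (b4 * (a' * a))) = C * (a ^ 4 * b4) * (a' * a)" by (simp only: mult_ac)
  also have "fps_cong N \<dots> (a' * a * (a' * a))" by (intro fps_cong_mult fps_cong_refl 1)
  finally have 4: "fps_cong N (C * (a ^ 4 * b)) (a' * a * (a' * a))" .
  have "fps_cong N (p * b * a ^ 4) (1 * a ^ 4)" by (intro fps_cong_mult fps_cong_refl 3)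
  \<comment> \<open>With \<open>C * a ^ 4 * b\<close> equal to the square of \<open>a' * a\<close>,
    and \<open>p * b\<close> equal to 1, subtracting the partition series leaves a common factor
    \<open>a ^ 2\<close>. After its cancellation, multiplying by \<open>b\<close> produces the two
    theta series.\<close>
  from fps_cong_diff[OF 4 this] have 5: "fps_cong N ((C - p) * (a ^ 2 * b) * a ^ 2) ((a' ^ 2 - a ^ 2) * a ^ 2)"
    by (simp add: algebra_simps eval_nat_numeral)
  have "fps_nth (a ^ 2) 0 = 1" unfolding a_def fps_power_zeroth odd_product_nth_0 by simp
  from fps_cong_cancel[OF 5 this] have "fps_cong N ((C - p) * (a ^ 2 * b)) (a' ^ 2 - a ^ 2)" .
  from fps_cong_mult[OF this fps_cong_refl, of b]
  have "fps_cong N ((C - p) * (b * (a ^ 2 * b))) (a' ^ 2 * b - a ^ 2 * b)"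
    by (simp add: algebra_simps)
  also have "fps_cong N \<dots> (Abs_fps (\<lambda>n. \<Sum>k | triangle_weight 1 1 k = n. 1 ^ n) - Abs_fps (\<lambda>n. \<Sum>k | triangle_weight 1 1 k = n. (- 1) ^ n))"
    unfolding a_def a'_def b_def by (intro fps_cong_diff theta3_cong) simp_all
  also have "\<dots> = fps_const 4 * odd_square_series" by (rule theta3_difference)
  finally show ?thesis unfolding D a_def b_def .
qed

lemma bit_square [simp]: "(x :: bit) ^ 2 = x"
  by (cases x) simp_all

text \<open>The products at \<open>i\<close> and \<open>n - i\<close> cancel in pairs, which leaves
  the middle one when \<open>n\<close> is even.\<close>

lemma bit_fps_frobenius: "(F :: bit fps) ^ 2 = F oo fps_X ^ 2"
proof (rule fps_ext)
  fix n
  define h where "h i = fps_nth F i * fps_nth F (n - i)" for i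
  have "fps_nth (F ^ 2) n = (\<Sum>i\<in>{0..n}. h i)"
    by (simp add: power2_eq_square fps_mult_nth h_def)
  also have "\<dots> = (\<Sum>i\<in>{i\<in>{0..n}. 2 * i < n}. h i) + (\<Sum>i\<in>{i\<in>{0..n}. n < 2 * i}. h i) + (\<Sum>i\<in>{i\<in>{0..n}. 2 * i = n}. h i)"
  proof -
    have "{0..n} = ({i\<in>{0..n}. 2 * i < n} \<union> {i\<in>{0..n}. n < 2 * i}) \<union> {i\<in>{0..n}. 2 * i = n}" by auto
    then have "(\<Sum>i\<in>{0..n}. h i) = (\<Sum>i\<in>({i\<in>{0..n}. 2 * i < n} \<union> {i\<in>{0..n}. n < 2 * i}) \<union> {i\<in>{0..n}. 2 * i = n}. h i)"
      by (rule arg_cong)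
    also have "\<dots> = (\<Sum>i\<in>{i\<in>{0..n}. 2 * i < n} \<union> {i\<in>{0..n}. n < 2 * i}. h i) + (\<Sum>i\<in>{i\<in>{0..n}. 2 * i = n}. h i)"
      by (rule sum.union_disjoint) auto
    also have "(\<Sum>i\<in>{i\<in>{0..n}. 2 * i < n} \<union> {i\<in>{0..n}. n < 2 * i}. h i) = (\<Sum>i\<in>{i\<in>{0..n}. 2 * i < n}. h i) + (\<Sum>i\<in>{i\<in>{0..n}. n < 2 * i}. h i)"
      by (rule sum.union_disjoint) auto
    finally show ?thesis .
  qed
  also have "(\<Sum>i\<in>{i\<in>{0..n}. n < 2 * i}. h i) = (\<Sum>i\<in>{i\<in>{0..n}. 2 * i < n}. h i)"
    by (rule sum.reindex_bij_witness[of _ "\<lambda>i. n - i" "\<lambda>i. n - i"]) (auto simp: h_def mult.commute)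
  also have "(\<Sum>i\<in>{i\<in>{0..n}. 2 * i < n}. h i) + (\<Sum>i\<in>{i\<in>{0..n}. 2 * i < n}. h i) = 0"
    using mult_2[of "\<Sum>i\<in>{i\<in>{0..n}. 2 * i < n}. h i"] by simp
  also have "(\<Sum>i\<in>{i\<in>{0..n}. 2 * i = n}. h i) = fps_nth (F oo fps_X ^ 2) n"
  proof (cases "even n")
    case True
    then have "{i\<in>{0..n}. 2 * i = n} = {n div 2}" by auto
    moreover have "n - n div 2 = n div 2" using True by presburger
    moreover have "fps_nth F (n div 2) * fps_nth F (n div 2) = fps_nth F (n div 2)"
      using bit_square[of "fps_nth F (n div 2)"] by (simp only: power2_eq_square)
    ultimately show ?thesis using True
      by (simp only: h_def sum.insert sum.empty finite.emptyI empty_iff) (simp add: fps_compose_X_power_nth)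
  next
    case False
    then have "{i\<in>{0..n}. 2 * i = n} = {}" by auto
    then show ?thesis using False by (simp only: sum.empty) (simp add: fps_compose_X_power_nth)
  qed
  finally show "fps_nth (F ^ 2) n = fps_nth (F oo fps_X ^ 2) n" by simp
qed

abbreviation eulerb :: "nat \<Rightarrow> nat \<Rightarrow> bit fps" where
  "eulerb \<equiv> euler_product"

lemma eulerb_double: "eulerb (2 * m) N = eulerb m N ^ 2"
  using euler_product_dilate[of 2 m N, where ?'a = bit] bit_fps_frobenius[of "eulerb m N"] by simp

lemma fps_int_count_series: "fps_int (count_series f) = count_series f"
  by (rule fps_ext) (simp add: count_series_nth)

lemma fps_int_X: "fps_int fps_X = fps_X"
  by (rule fps_ext) (simp add: fps_X_nth)

lemma fps_int_euler_product: "fps_int (euler_product m N) = euler_product m N"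
  by (simp add: euler_product_def fps_int_prod fps_int_diff fps_int_1 fps_int_power fps_int_X)

lemma bit_fps_neg: "(- F :: bit fps) = F"
  by (rule fps_ext) simp

lemma odd_part_eulerb: "(\<Prod>i<N. 1 + fps_X ^ (2 * i + 1)) * eulerb 2 N = eulerb 1 (2 * N)"
proof (induction N)
  case (Suc N)
  have m: "1 + F = 1 - F" for F :: "bit fps" using bit_fps_neg[of F] by (metis diff_conv_add_uminus)
  have "(\<Prod>i<Suc N. 1 + fps_X ^ (2 * i + 1)) * eulerb 2 (Suc N) =
     ((\<Prod>i<N. 1 + fps_X ^ (2 * i + 1)) * eulerb 2 N) * ((1 - fps_X ^ (2 * N + 1)) * (1 - fps_X ^ (2 * Suc N)))"
  proof -
    have "eulerb 2 (Suc N) = eulerb 2 N * (1 - fps_X ^ (2 * Suc N))" by (simp add: euler_product_def del: power_Suc)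
    moreover have "(\<Prod>i<Suc N. 1 + fps_X ^ (2 * i + 1)) = (\<Prod>i<N. 1 + fps_X ^ (2 * i + 1)) * (1 - (fps_X :: bit fps) ^ (2 * N + 1))"
      unfolding m[symmetric] by (rule prod.lessThan_Suc)
    ultimately show ?thesis by (simp only: mult_ac)
  qed
  also have "\<dots> = eulerb 1 (2 * Suc N)"
    unfolding Suc by (simp add: euler_product_def mult.assoc del: power_Suc)
  finally show ?case .
qed (simp add: euler_product_def)

text \<open>Modulo 2 signs disappear, so the odd factors and the even ones together fill the Euler
  product; by Frobenius the even ones form its square. Thus the odd product is inverse to the Euler
  product.\<close>

lemma odd_part_eulerb_cong:
  assumes "N \<le> M"
  shows "fps_cong N ((\<Prod>i<M. 1 + fps_X ^ (2 * i + 1)) * eulerb 1 N ^ 2) (eulerb 1 N)"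
proof -
  have ext: "fps_cong N (eulerb 1 L) (eulerb 1 N)" if "L \<ge> N" for L
    using euler_product_extend[of 1 N L] that by simp
  have "fps_cong N ((\<Prod>i<M. 1 + fps_X ^ (2 * i + 1)) * eulerb 1 N ^ 2) ((\<Prod>i<M. 1 + fps_X ^ (2 * i + 1)) * eulerb 1 M ^ 2)"
    by (intro fps_cong_mult fps_cong_refl fps_cong_power fps_cong_sym[OF ext] assms)
  also have "(\<Prod>i<M. 1 + fps_X ^ (2 * i + 1)) * eulerb 1 M ^ 2 = eulerb 1 (2 * M)"
    using odd_part_eulerb[of M] eulerb_double[of 1 M] by simp
  also have "fps_cong N \<dots> (eulerb 1 N)" using assms by (intro ext) simp
  finally show ?thesis .
qed

text \<open>In the triple product with weights 1 and 3 the exponents 1 and 3 modulo 4 give all odd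
  factors, and \<open>eulerb 4 N\<close> is the fourth power of the Euler product; the odd factors
  cancel one of the four.\<close>

lemma psi_eulerb: "fps_cong N (eulerb 1 N ^ 3) (count_series (triangle_weight 1 3))"
proof -
  have "fps_cong N ((\<Prod>i<N. (1 + fps_X ^ (1 + (1 + 3) * i)) * (1 + fps_X ^ (3 + (1 + 3) * i))) * eulerb (1 + 3) N)
      (count_series (triangle_weight 1 3))"
    by (rule jacobi_triple_product_count) simp
  moreover have "(\<Prod>i<N. (1 + fps_X ^ (1 + (1 + 3) * i)) * (1 + (fps_X :: bit fps) ^ (3 + (1 + 3) * i))) = (\<Prod>i<2 * N. 1 + fps_X ^ (2 * i + 1))"
  proof (induction N)
    case (Suc N)
    have "2 * (2 * N) + 1 = 1 + (1 + 3) * N" "2 * Suc (2 * N) + 1 = 3 + (1 + 3) * N" by simp_all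
    then show ?case using Suc by (simp add: mult.assoc del: power_Suc)
  qed simp
  ultimately have A: "fps_cong N ((\<Prod>i<2 * N. 1 + fps_X ^ (2 * i + 1)) * eulerb 4 N) (count_series (triangle_weight 1 3))"
    by simp
  have e4: "eulerb 4 N = eulerb 1 N ^ 4"
    using eulerb_double[of 2 N] eulerb_double[of 1 N] by (simp flip: power_mult)
  have "fps_cong N ((\<Prod>i<2 * N. 1 + fps_X ^ (2 * i + 1)) * eulerb 1 N ^ 2) (eulerb 1 N)"
    using odd_part_eulerb_cong[of N "2 * N"] by simp
  from fps_cong_mult[OF this fps_cong_refl, of "eulerb 1 N ^ 2"]
  have "fps_cong N ((\<Prod>i<2 * N. 1 + fps_X ^ (2 * i + 1)) * eulerb 4 N) (eulerb 1 N ^ 3)"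
    unfolding e4 by (simp add: eval_nat_numeral mult_ac)
  from fps_cong_trans[OF fps_cong_sym[OF this] A] show ?thesis .
qed

text \<open>Euler's pentagonal number theorem with the signs lost modulo 2: exponents in the classes
  1, 2 and 0 modulo 3 exhaust all factors.\<close>

lemma pentagonal_eulerb: "fps_cong N (eulerb 1 N) (count_series (triangle_weight 1 2))"
proof -
  have m: "1 + F = 1 - F" for F :: "bit fps" using bit_fps_neg[of F] by (metis diff_conv_add_uminus)
  have "fps_cong N ((\<Prod>i<N. (1 + fps_X ^ (1 + (1 + 2) * i)) * (1 + fps_X ^ (2 + (1 + 2) * i))) * eulerb (1 + 2) N)
      (count_series (triangle_weight 1 2))"
    by (rule jacobi_triple_product_count) simp
  moreover have "(\<Prod>i<N. (1 + fps_X ^ (1 + (1 + 2) * i)) * (1 + (fps_X :: bit fps) ^ (2 + (1 + 2) * i))) * eulerb (1 + 2) N = eulerb 1 (3 * N)"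
  proof (induction N)
    case (Suc N)
    let ?p = "\<Prod>i<N. (1 + fps_X ^ (1 + (1 + 2) * i)) * (1 + (fps_X :: bit fps) ^ (2 + (1 + 2) * i))"
    have e: "1 * Suc (3 * N) = 1 + (1 + 2) * N" "1 * Suc (Suc (3 * N)) = 2 + (1 + 2) * N" "1 * Suc (Suc (Suc (3 * N))) = (1 + 2) * Suc N" by simp_all
    have t: "3 * Suc N = Suc (Suc (Suc (3 * N)))" by simp
    have "eulerb 1 (3 * Suc N) = eulerb 1 (3 * N) * (1 - fps_X ^ (1 + (1 + 2) * N)) * (1 - fps_X ^ (2 + (1 + 2) * N)) * (1 - fps_X ^ ((1 + 2) * Suc N))"
      unfolding t e[symmetric] by (simp add: euler_product_def del: power_Suc)
    also have "\<dots> = (?p * ((1 + fps_X ^ (1 + (1 + 2) * N)) * (1 + fps_X ^ (2 + (1 + 2) * N)))) * (eulerb (1 + 2) N * (1 - fps_X ^ ((1 + 2) * Suc N)))"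
      unfolding Suc[symmetric] m by (simp only: mult_ac)
    also have "\<dots> = (\<Prod>i<Suc N. (1 + fps_X ^ (1 + (1 + 2) * i)) * (1 + (fps_X :: bit fps) ^ (2 + (1 + 2) * i))) * eulerb (1 + 2) (Suc N)"
      by (simp add: euler_product_def del: power_Suc)
    finally show ?case by simp
  qed (simp add: euler_product_def)
  ultimately have "fps_cong N (eulerb 1 (3 * N)) (count_series (triangle_weight 1 2))" by simp
  moreover have "fps_cong N (eulerb 1 (3 * N)) (eulerb 1 N)" by (rule euler_product_extend) simp_all
  ultimately show ?thesis using fps_cong_trans fps_cong_sym by blast
qed

lemma fps_int_odd_product: "(fps_int (odd_product N (- 1)) :: bit fps) = (\<Prod>i<N. 1 + fps_X ^ (2 * i + 1))"
proof -
  have "fps_const (- 1 :: bit) = 1" by (rule fps_ext) simp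
  then show ?thesis
    by (simp add: fps_int_prod fps_int_add fps_int_1 fps_int_mult fps_int_power fps_int_X fps_int_const del: power_Suc)
qed

lemma triangle_series_dilate_cong:
  "fps_cong N (count_series (\<lambda>k. 8 * triangle_weight 1 3 k)) (eulerb 1 N ^ 24)"
  "fps_cong N (count_series (\<lambda>k. 2 * triangle_weight 1 3 k)) (eulerb 1 N ^ 6)"
  "fps_cong N (count_series (\<lambda>k. 16 * triangle_weight 1 2 k)) (eulerb 1 N ^ 16)"
proof -
  have e: "eulerb 2 N = eulerb 1 N ^ 2" "eulerb 8 N = eulerb 1 N ^ 8" "eulerb 16 N = eulerb 1 N ^ 16"
    using eulerb_double[of 1 N] eulerb_double[of 2 N] eulerb_double[of 4 N] eulerb_double[of 8 N]
    by (simp_all flip: power_mult)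
  have c0: "fps_nth (fps_X ^ m :: bit fps) 0 = 0" if "m > 0" for m
    using that by (rule fps_X_power_nth_0)
  have p: "(eulerb 1 N ^ 3) oo fps_X ^ m = eulerb m N ^ 3" if "m > 0" for m
    unfolding fps_compose_power[OF c0[OF that], symmetric] euler_product_dilate[OF that] by simp
  have q: "fps_cong N (count_series (\<lambda>k. m * triangle_weight 1 3 k)) (eulerb m N ^ 3)" if "m > 0" for m
    using fps_cong_dilate[OF fps_cong_sym[OF psi_eulerb[of N]] that]
    unfolding count_series_dilate[OF that] p[OF that] .
  show "fps_cong N (count_series (\<lambda>k. 8 * triangle_weight 1 3 k)) (eulerb 1 N ^ 24)"
    using q[of 8] unfolding e by (simp flip: power_mult)
  show "fps_cong N (count_series (\<lambda>k. 2 * triangle_weight 1 3 k)) (eulerb 1 N ^ 6)"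
    using q[of 2] unfolding e by (simp flip: power_mult)
  have "fps_cong N (count_series (triangle_weight 1 2) oo fps_X ^ 16) (eulerb 1 N oo fps_X ^ 16)"
    by (rule fps_cong_dilate[OF fps_cong_sym[OF pentagonal_eulerb]]) simp
  then show "fps_cong N (count_series (\<lambda>k. 16 * triangle_weight 1 2 k)) (eulerb 1 N ^ 16)"
    unfolding count_series_dilate[of 16, OF zero_less_numeral] euler_product_dilate[of 16, OF zero_less_numeral]
    by (simp add: e)
qed

text \<open>Modulo 2 the denominator \<open>V\<close> collapses to \<open>e ^ 2\<close> and the
  numerator is \<open>fps_X\<close> times \<open>e ^ 24\<close>. The quotient contains
  \<open>e ^ 22\<close>, split as \<open>e ^ 6 * e ^ 16\<close>, that is, as dilated triangular and
  pentagonal series.\<close>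

theorem cphi2_bar_parity_weights:
  "odd (cphi2_bar M div 4) \<longleftrightarrow> odd (card {p. 1 + (2 * triangle_weight 1 3 (fst p) + 16 * triangle_weight 1 2 (snd p)) = M})"
proof -
  define N where "N = Suc M"
  define e where "e = eulerb 1 N"
  define V where "V = (euler_product 2 N * (odd_product N (- 1) ^ 2 * euler_product 2 N) :: int fps)"
  define W where "W = odd_square_series * fps_right_inverse V 1"
  have e0: "fps_nth e 0 = 1" unfolding e_def by (rule euler_product_nth_0) simp
  have V0: "fps_nth V 0 = 1"
    unfolding V_def fps_mult_nth_0 fps_power_zeroth odd_product_nth_0 using euler_product_nth_0[of 2 N, where ?'a = int] by simp
  have "V * fps_right_inverse V 1 = 1" by (rule fps_right_inverse) (simp add: V0)
  then have WV: "W * V = odd_square_series" by (simp add: W_def mult.assoc mult.commute[of V])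
  have "fps_cong N (Abs_fps cphi2_bar * V) ((fps_const 4 * W) * V)"
    unfolding mult.assoc WV unfolding V_def by (rule cphi2_bar_series_cong)
  from fps_cong_cancel[OF this V0] have "cphi2_bar M = 4 * fps_nth W M"
    by (simp add: fps_cong_def N_def)
  then have W: "cphi2_bar M div 4 = fps_nth W M" by simp
  have e2: "eulerb 2 N = e ^ 2" unfolding e_def using eulerb_double[of 1 N] by simp
  define O1 where "O1 = (\<Prod>i<N. 1 + (fps_X :: bit fps) ^ (2 * i + 1))"
  have "fps_cong N (O1 * e ^ 2) e" unfolding O1_def e_def by (rule odd_part_eulerb_cong) simp
  then have "fps_cong N (O1 * e * e) (1 * e)" by (simp add: power2_eq_square mult.assoc)
  from fps_cong_cancel[OF this e0] have "fps_cong N ((O1 * e) ^ 2) (1 ^ 2)" by (rule fps_cong_power)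
  then have O1: "fps_cong N (O1 ^ 2 * e ^ 2) 1" by (simp add: power_mult_distrib)
  have Vb: "fps_int V = e ^ 2 * (O1 ^ 2 * e ^ 2)"
    unfolding V_def fps_int_mult fps_int_power fps_int_euler_product fps_int_odd_product e2 O1_def ..
  have "fps_cong N (fps_int W * e ^ 2) (fps_int W * (e ^ 2 * (O1 ^ 2 * e ^ 2)))"
    using fps_cong_mult[OF fps_cong_refl fps_cong_sym[OF O1], of "fps_int W * e ^ 2"] by (simp add: mult.assoc)
  also have "fps_int W * (e ^ 2 * (O1 ^ 2 * e ^ 2)) = fps_int odd_square_series"
    unfolding Vb[symmetric] fps_int_mult[symmetric] WV ..
  also have "\<dots> = fps_X ^ 1 * count_series (\<lambda>k. 8 * triangle_weight 1 3 k)"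
    unfolding odd_square_series_def fps_int_count_series count_series_shift ..
  also have "fps_cong N \<dots> (fps_X ^ 1 * e ^ 24)"
    unfolding e_def by (intro fps_cong_mult fps_cong_refl triangle_series_dilate_cong)
  also have "fps_X ^ 1 * e ^ 24 = fps_X ^ 1 * (e ^ 6 * e ^ 16) * e ^ 2" by (simp flip: power_add)
  finally have "fps_cong N (fps_int W * e ^ 2) (fps_X ^ 1 * (e ^ 6 * e ^ 16) * e ^ 2)" .
  moreover have "fps_nth (e ^ 2) 0 = 1" by (simp add: fps_power_zeroth e0)
  ultimately have "fps_cong N (fps_int W) (fps_X ^ 1 * (e ^ 6 * e ^ 16))" by (rule fps_cong_cancel)
  also have "fps_cong N \<dots> (fps_X ^ 1 * (count_series (\<lambda>k. 2 * triangle_weight 1 3 k) * count_series (\<lambda>k. 16 * triangle_weight 1 2 k)))"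
    unfolding e_def by (intro fps_cong_mult fps_cong_refl fps_cong_sym[OF triangle_series_dilate_cong(2)] fps_cong_sym[OF triangle_series_dilate_cong(3)])
  also have "\<dots> = count_series (\<lambda>p. 1 + (2 * triangle_weight 1 3 (fst p) + 16 * triangle_weight 1 2 (snd p)))"
  proof -
    have fin: "finite {k. c * triangle_weight \<alpha> \<beta> k = n}" if "c > 0" "\<alpha> + \<beta> > 0" for c \<alpha> \<beta> n
      by (rule finite_subset[OF _ finite_triangle_weight[OF that(2), of "n div c"]]) (use that in auto)
    show ?thesis by (subst count_series_mult) (auto intro!: fin simp: count_series_shift[of 1, simplified] simp flip: count_series_shift)
  qed
  finally have "fps_nth (fps_int W :: bit fps) M =
      fps_nth (count_series (\<lambda>p. 1 + (2 * triangle_weight 1 3 (fst p) + 16 * triangle_weight 1 2 (snd p)))) M"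
    by (simp add: fps_cong_def N_def)
  then have "(of_int (fps_nth W M) :: bit) = of_int (int (card {p. 1 + (2 * triangle_weight 1 3 (fst p) + 16 * triangle_weight 1 2 (snd p)) = M}))"
    by (simp add: count_series_nth del: of_int_of_nat_eq) simp
  then show ?thesis unfolding W of_int_bit by (simp add: of_bool_eq_iff)
qed

text \<open>The congruences select one of x and -x for odd x, and one of y and -y for y prime to 6,
  which corresponds to one integer index for each triangular and each pentagonal number.\<close>

definition represent :: "int \<Rightarrow> (int \<times> int) set" where
  "represent N = {(x, y). [x = 1] (mod 4) \<and> [y = 1] (mod 6) \<and> 3 * x ^ 2 + 8 * y ^ 2 = N}"

text \<open>The substitution \<open>x = 1 - 4 * k\<close>, \<open>y = 1 - 6 * m\<close> completes
  the squares in both weights.\<close>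

theorem cphi2_bar_parity: "odd (cphi2_bar M div 4) \<longleftrightarrow> odd (card (represent (12 * int M - 1)))"
proof -
  let ?S = "{p. 1 + (2 * triangle_weight 1 3 (fst p) + 16 * triangle_weight 1 2 (snd p)) = M}"
  have eq: "3 * (1 - 4 * k) ^ 2 + 8 * (1 - 6 * m) ^ 2 = 12 * int (1 + (2 * triangle_weight 1 3 k + 16 * triangle_weight 1 2 m)) - 1" for k m :: int
    using int_triangle_weight_1_3[of k] int_triangle_weight_1_2[of m] by (simp add: power2_eq_square algebra_simps del: One_nat_def)
  have mem: "(1 - 4 * k, 1 - 6 * m) \<in> represent (12 * int M - 1) \<longleftrightarrow> (k, m) \<in> ?S" for k m
  proof -
    have "(1 - 4 * k, 1 - 6 * m) \<in> represent (12 * int M - 1) \<longleftrightarrow> 3 * (1 - 4 * k) ^ 2 + 8 * (1 - 6 * m) ^ 2 = 12 * int M - 1"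
      by (simp add: represent_def cong_iff_dvd_diff)
    also have "\<dots> \<longleftrightarrow> int (1 + (2 * triangle_weight 1 3 k + 16 * triangle_weight 1 2 m)) = int M"
    proof -
      have "12 * a - 1 = 12 * b - 1 \<longleftrightarrow> a = b" for a b :: int by auto
      then show ?thesis unfolding eq .
    qed
    finally show ?thesis unfolding of_nat_eq_iff by simp
  qed
  have "bij_betw (\<lambda>p. (1 - 4 * fst p, 1 - 6 * snd p)) ?S (represent (12 * int M - 1))"
  proof (rule bij_betw_imageI)
    show "inj_on (\<lambda>p. (1 - 4 * fst p, 1 - 6 * snd p)) ?S" by (auto simp: inj_on_def prod_eq_iff)
    show "(\<lambda>p. (1 - 4 * fst p, 1 - 6 * snd p)) ` ?S = represent (12 * int M - 1)"
    proof (rule subset_antisym; rule subsetI)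
      fix q assume "q \<in> (\<lambda>p. (1 - 4 * fst p, 1 - 6 * snd p)) ` ?S"
      then obtain p where "p \<in> ?S" "q = (1 - 4 * fst p, 1 - 6 * snd p)" by blast
      then show "q \<in> represent (12 * int M - 1)" using mem[of "fst p" "snd p"] by simp
    next
      fix q assume q: "q \<in> represent (12 * int M - 1)"
      obtain x y where xy: "q = (x, y)" by (cases q)
      then have "[x = 1] (mod 4)" "[y = 1] (mod 6)" using q by (auto simp: represent_def)
      then have "4 dvd 1 - x" "6 dvd 1 - y" by (simp_all add: cong_iff_dvd_diff dvd_diff_commute)
      then obtain k m where km: "1 - x = 4 * k" "1 - y = 6 * m" by blast
      then have q': "q = (1 - 4 * k, 1 - 6 * m)" unfolding xy by simp
      then have "(k, m) \<in> ?S" using mem[of k m] q by simp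
      then show "q \<in> (\<lambda>p. (1 - 4 * fst p, 1 - 6 * snd p)) ` ?S" unfolding q' by (intro image_eqI[of _ _ "(k, m)"]) simp_all
    qed
  qed
  then have "card ?S = card (represent (12 * int M - 1))" by (rule bij_betw_same_card)
  then show ?thesis unfolding cphi2_bar_parity_weights by simp
qed

subsection \<open>An inert prime\<close>

lemma square_mod_24: "(x :: int) ^ 2 mod 24 \<in> {0, 1, 4, 9, 12, 16}"
proof -
  have "x mod 24 = 0 \<or> x mod 24 = 1 \<or> x mod 24 = 2 \<or> x mod 24 = 3 \<or> x mod 24 = 4 \<or> x mod 24 = 5
      \<or> x mod 24 = 6 \<or> x mod 24 = 7 \<or> x mod 24 = 8 \<or> x mod 24 = 9 \<or> x mod 24 = 10 \<or> x mod 24 = 11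
      \<or> x mod 24 = 12 \<or> x mod 24 = 13 \<or> x mod 24 = 14 \<or> x mod 24 = 15 \<or> x mod 24 = 16 \<or> x mod 24 = 17
      \<or> x mod 24 = 18 \<or> x mod 24 = 19 \<or> x mod 24 = 20 \<or> x mod 24 = 21 \<or> x mod 24 = 22 \<or> x mod 24 = 23"
    by presburger
  then have "(x mod 24) ^ 2 mod 24 \<in> {0, 1, 4, 9, 12, 16}"
    by (elim disjE) simp_all
  then show ?thesis by (simp add: power_mod)
qed

text \<open>The forms a^2 + 6 b^2 and 2 a^2 + 3 b^2 represent the two classes of discriminant -24,
  one in each genus, so their values prime to 6 are told apart modulo 24.\<close>

lemma form_1_6_mod_24:
  assumes "l = a ^ 2 + 6 * b ^ 2" "odd l" "\<not> 3 dvd (l :: int)"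
  shows "l mod 24 \<in> {1, 7}"
proof -
  define A B where "A = a ^ 2 mod 24" "B = b ^ 2 mod 24"
  have AB: "A \<in> {0, 1, 4, 9, 12, 16}" "B \<in> {0, 1, 4, 9, 12, 16}"
    unfolding A_B_def by (rule square_mod_24)+
  have l: "l mod 24 = (A + 6 * B) mod 24" unfolding assms(1) A_B_def
    by (intro mod_add_cong mod_mult_cong) simp_all
  have "odd (l mod 24)" using assms(2) by presburger
  moreover have "\<not> 3 dvd l mod 24" using assms(3) by presburger
  ultimately show ?thesis unfolding l using AB by (elim insertE emptyE; simp)
qed

lemma form_2_3_mod_24:
  assumes "l = 2 * a ^ 2 + 3 * b ^ 2" "odd l" "\<not> 3 dvd (l :: int)"
  shows "l mod 24 \<in> {5, 11}"
proof -
  define A B where "A = a ^ 2 mod 24" "B = b ^ 2 mod 24"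
  have AB: "A \<in> {0, 1, 4, 9, 12, 16}" "B \<in> {0, 1, 4, 9, 12, 16}"
    unfolding A_B_def by (rule square_mod_24)+
  have l: "l mod 24 = (2 * A + 3 * B) mod 24" unfolding assms(1) A_B_def
    by (intro mod_add_cong mod_mult_cong) simp_all
  have "odd (l mod 24)" using assms(2) by presburger
  moreover have "\<not> 3 dvd l mod 24" using assms(3) by presburger
  ultimately show ?thesis unfolding l using AB by (elim insertE emptyE; simp)
qed

text \<open>Thue's lemma by the pigeonhole principle: more than \<open>l\<close> pairs have entries
  between 0 and the integer part of the square root of \<open>l\<close>. The inequalities are strict
  because a prime is not a square.\<close>

lemma thue:
  fixes l :: nat and s :: int
  assumes "prime l"
  obtains u v :: int where "(u, v) \<noteq> (0, 0)" "u ^ 2 < int l" "v ^ 2 < int l" "int l dvd u - s * v"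
proof -
  define k where "k = nat \<lfloor>sqrt (real l)\<rfloor>"
  have rk: "real k \<le> sqrt (real l)" "sqrt (real l) < real (Suc k)"
    unfolding k_def by (simp_all, linarith)
  have "real k ^ 2 \<le> (sqrt (real l)) ^ 2" "(sqrt (real l)) ^ 2 < real (Suc k) ^ 2"
    using rk by (auto intro!: power_mono power_strict_mono simp del: real_sqrt_pow2 of_nat_Suc)
  then have "real (k ^ 2) \<le> real l" "real l < real ((Suc k) ^ 2)"
    by (simp_all del: of_nat_Suc)
  then have k: "k ^ 2 \<le> l" "l < (Suc k) ^ 2"
    by (simp_all only: of_nat_le_iff of_nat_less_iff)
  have "k ^ 2 \<noteq> l"
  proof
    assume kl: "k ^ 2 = l"
    then have "k dvd l" by (auto simp: power2_eq_square)
    then have "k = 1 \<or> k = l" using assms by (auto simp: prime_nat_iff)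
    then show False
    proof
      assume "k = 1"
      then show False using kl prime_gt_1_nat[OF assms] by simp
    next
      assume "k = l"
      then have "l * l = l * 1" using kl by (simp add: power2_eq_square)
      then show False using prime_gt_1_nat[OF assms] by (simp only: mult_cancel_left) simp
    qed
  qed
  then have k2: "int k ^ 2 < int l" using k(1) by (metis le_neq_implies_less of_nat_less_iff of_nat_power)
  define f where "f p = (fst p - s * snd p) mod int l" for p
  have l0: "l > 0" using assms prime_gt_0_nat by blast
  have "\<not> inj_on f ({0..int k} \<times> {0..int k})"
  proof
    assume "inj_on f ({0..int k} \<times> {0..int k})"
    then have "card (f ` ({0..int k} \<times> {0..int k})) = Suc k * Suc k" by (simp add: card_image card_cartesian_product nat_add_distrib)
    moreover have "card (f ` ({0..int k} \<times> {0..int k})) \<le> card {0..<int l}"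
      using l0 by (intro card_mono) (auto simp: f_def)
    ultimately show False using k(2) by (simp add: power2_eq_square)
  qed
  then obtain p q where pq: "p \<in> {0..int k} \<times> {0..int k}" "q \<in> {0..int k} \<times> {0..int k}" "f p = f q" "p \<noteq> q"
    by (auto simp: inj_on_def)
  have bd: "u ^ 2 < int l" if "\<bar>u\<bar> \<le> int k" for u
  proof -
    have "u ^ 2 \<le> int k ^ 2" using that by (simp add: abs_le_square_iff[symmetric])
    then show ?thesis using k2 by linarith
  qed
  show ?thesis
  proof (rule that[of "fst p - fst q" "snd p - snd q"])
    show "(fst p - fst q, snd p - snd q) \<noteq> (0, 0)" using pq(4) by (auto simp: prod_eq_iff)
    show "(fst p - fst q) ^ 2 < int l" "(snd p - snd q) ^ 2 < int l" using pq(1,2) by (auto intro!: bd)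
    have "int l dvd (fst p - s * snd p) - (fst q - s * snd q)"
      using pq(3) unfolding f_def mod_eq_dvd_iff .
    then show "int l dvd fst p - fst q - s * (snd p - snd q)" by (simp add: algebra_simps)
  qed
qed

text \<open>If -6 is a square modulo \<open>l\<close>, Thue's lemma gives u^2 + 6 v^2 = c l with 0 <
  c < 7. For c other than 5, removing common factors exhibits \<open>l\<close> as a value of a form
  of discriminant -24; for c = 5 residues modulo 24 decide.\<close>

lemma prime_mod_24_of_residue:
  fixes l :: nat and s :: int
  assumes l: "prime l" "\<not> l dvd 6" and s: "int l dvd s ^ 2 + 6"
  shows "int l mod 24 \<in> {1, 5, 7, 11}"
proof -
  obtain u v where uv: "(u, v) \<noteq> (0, 0)" "u ^ 2 < int l" "v ^ 2 < int l" "int l dvd u - s * v"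
    using thue[OF l(1)] by blast
  have odd: "odd (int l)" "\<not> 3 dvd int l"
  proof -
    have "l \<noteq> 2" "l \<noteq> 3" using l(2) by auto
    then have "\<not> 2 dvd l" "\<not> 3 dvd l"
      using primes_dvd_imp_eq[of 2 l] primes_dvd_imp_eq[of 3 l] l(1) by auto
    then show "odd (int l)" "\<not> 3 dvd int l"
      using int_dvd_int_iff[of 3 l] by simp_all
  qed
  have "int l dvd u ^ 2 + 6 * v ^ 2"
  proof -
    have "u ^ 2 + 6 * v ^ 2 = (u - s * v) * (u + s * v) + v ^ 2 * (s ^ 2 + 6)"
      by (simp add: power2_eq_square algebra_simps)
    then show ?thesis using uv(4) s by simp
  qed
  then obtain c where c: "u ^ 2 + 6 * v ^ 2 = int l * c" by blast
  have "0 < u ^ 2 + 6 * v ^ 2" using uv(1) by (auto simp: add_pos_nonneg add_nonneg_pos)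
  then have "c > 0" using c by (simp add: zero_less_mult_iff)
  moreover have "int l * c < int l * 7" using uv(2,3) unfolding c[symmetric] by linarith
  then have "c < 7" using prime_gt_0_nat[OF l(1)] by simp
  ultimately have "c = 1 \<or> c = 2 \<or> c = 3 \<or> c = 4 \<or> c = 5 \<or> c = 6" by linarith
  then show ?thesis
  proof (elim disjE)
    assume "c = 1"
    then show ?thesis using form_1_6_mod_24[of "int l" u v] odd c by auto
  next
    assume c2: "c = 2"
    have "u ^ 2 = 2 * (int l - 3 * v ^ 2)" using c c2 by simp
    then have "even (u ^ 2)" by (metis dvd_triv_left)
    then obtain a where "u = 2 * a" by auto
    then have "int l = 2 * a ^ 2 + 3 * v ^ 2" using c c2 by (simp add: power2_eq_square)
    then show ?thesis using form_2_3_mod_24[of "int l" a v] odd by auto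
  next
    assume c3: "c = 3"
    have "u ^ 2 = 3 * (int l - 2 * v ^ 2)" using c c3 by simp
    then have "3 dvd u ^ 2" by (metis dvd_triv_left)
    then have "3 dvd u" using prime_dvd_power[of 3 u 2] by simp
    then obtain a where "u = 3 * a" by auto
    then have "int l = 2 * v ^ 2 + 3 * a ^ 2" using c c3 by (simp add: power2_eq_square)
    then show ?thesis using form_2_3_mod_24[of "int l" v a] odd by auto
  next
    assume c4: "c = 4"
    have "u ^ 2 = 2 * (2 * int l - 3 * v ^ 2)" using c c4 by simp
    then have "even (u ^ 2)" by (metis dvd_triv_left)
    then obtain a where a: "u = 2 * a" by auto
    then have "2 * a ^ 2 + 3 * v ^ 2 = 2 * int l" using c c4 by (simp add: power2_eq_square)
    then have "v ^ 2 = 2 * (int l - a ^ 2 - v ^ 2)" by simp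
    then have "even (v ^ 2)" by (metis dvd_triv_left)
    then obtain b where "v = 2 * b" by auto
    then have "int l = a ^ 2 + 6 * b ^ 2" using c c4 a by (simp add: power2_eq_square)
    then show ?thesis using form_1_6_mod_24[of "int l" a b] odd by auto
  next
    \<comment> \<open>5 is its own inverse modulo 24 and carries the residues 1 and 7 to 5 and
      11.\<close>
    assume c5: "c = 5"
    have "odd (5 * int l)" "\<not> 3 dvd 5 * int l" using odd by presburger+
    then have "5 * int l mod 24 \<in> {1, 7}" using form_1_6_mod_24[of "5 * int l" u v] c c5 by simp
    moreover have "int l mod 24 = 5 * (5 * int l mod 24) mod 24"
    proof -
      have "5 * (5 * int l mod 24) mod 24 = (int l + 24 * int l) mod 24" unfolding mod_mult_right_eq by simp
      then show ?thesis by (simp only: mod_mult_self2)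
    qed
    ultimately show ?thesis by (elim insertE emptyE) (simp_all only:, simp_all)
  next
    assume c6: "c = 6"
    have "u ^ 2 = 3 * (2 * (int l - v ^ 2))" "u ^ 2 = 2 * (3 * (int l - v ^ 2))" using c c6 by simp_all
    then have "3 dvd u ^ 2" "2 dvd u ^ 2" by (metis dvd_triv_left)+
    then have "3 dvd u" "2 dvd u" using prime_dvd_power[of 3 u 2] by simp_all
    then have "6 dvd u" by presburger
    then obtain a where "u = 6 * a" by auto
    then have "int l = v ^ 2 + 6 * a ^ 2" using c c6 by (simp add: power2_eq_square)
    then show ?thesis using form_1_6_mod_24[of "int l" v a] odd by auto
  qed
qed

text \<open>The four residues form a subgroup of the units modulo 24, the kernel of the quadratic
  character of discriminant -24.\<close>

lemma mod_24_of_prime_factors: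
  fixes n :: nat
  assumes "n > 0" "\<And>p. prime p \<Longrightarrow> p dvd n \<Longrightarrow> int p mod 24 \<in> {1, 5, 7, 11}"
  shows "int n mod 24 \<in> {1, 5, 7, 11}"
  using assms
proof (induction n rule: less_induct)
  case (less n)
  show ?case
  proof (cases "n = 1")
    case False
    then obtain p where p: "prime p" "p dvd n" using prime_factor_nat by blast
    then obtain m where m: "n = p * m" by blast
    have "m < n" "m > 0" using m p(1) less.prems(1) prime_gt_1_nat[of p] by auto
    moreover have "int q mod 24 \<in> {1, 5, 7, 11}" if "prime q" "q dvd m" for q
      using that(1) by (rule less.prems(2)) (use that(2) m in simp)
    ultimately have "int m mod 24 \<in> {1, 5, 7, 11}" by (rule less.IH)
    moreover have "int p mod 24 \<in> {1, 5, 7, 11}" by (rule less.prems(2)[OF p])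
    moreover have "int n mod 24 = (int p mod 24) * (int m mod 24) mod 24"
      unfolding m of_nat_mult by (simp only: mod_mult_eq)
    ultimately show ?thesis by (elim insertE emptyE; simp)
  qed simp
qed

text \<open>\<open>24 * t - 1\<close> is 23 modulo 24 and hence outside that subgroup, so some prime
  factor \<open>l\<close> is outside as well, and it is automatically prime to
  \<open>24 * t\<close>. Then -6 is not a square modulo \<open>l\<close>, which leaves the form only
  the trivial zero there.\<close>

lemma inert_prime_exists:
  fixes t :: nat
  assumes "t > 0"
  obtains l :: nat where "prime l" "coprime l (12 * t)"
    "\<And>x y :: int. int l dvd 3 * x ^ 2 + 8 * y ^ 2 \<Longrightarrow> int l dvd x \<and> int l dvd y"
proof -
  have "int (24 * t - 1) mod 24 = 23"
    using assms by (simp add: of_nat_diff) presburger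
  then have "int (24 * t - 1) mod 24 \<notin> {1, 5, 7, 11}" by (simp only:) simp
  moreover have "24 * t - 1 > 0" using assms by simp
  ultimately obtain l where l: "prime l" "l dvd 24 * t - 1" "int l mod 24 \<notin> {1, 5, 7, 11}"
    using mod_24_of_prime_factors[of "24 * t - 1"] by blast
  have cop6: "\<not> l dvd c" if "c dvd 24 * t" for c
  proof
    assume "l dvd c"
    then have "l dvd 24 * t" using that dvd_trans by blast
    then have "l dvd 24 * t - (24 * t - 1)" using l(2) by (rule dvd_diff_nat)
    then show False using assms l(1) by simp
  qed
  have cop12: "coprime l (12 * t)"
    using l(1) cop6[of "12 * t"] by (intro prime_imp_coprime) simp_all
  have nd: "\<not> int l dvd 3" "\<not> int l dvd 2" "\<not> l dvd 6" "\<not> int l dvd 8"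
    using cop6[of 3] cop6[of 2] cop6[of 6] cop6[of 8] using int_dvd_int_iff[of l 3] int_dvd_int_iff[of l 2] int_dvd_int_iff[of l 8] by simp_all
  have pl: "prime (int l)" using l(1) by simp
  have "int l dvd x \<and> int l dvd y" if d: "int l dvd 3 * x ^ 2 + 8 * y ^ 2" for x y
  proof (cases "int l dvd y")
    case True
    then have "int l dvd 8 * y ^ 2" by (simp add: power2_eq_square)
    then have "int l dvd 3 * x ^ 2" using d by (simp only: dvd_add_left_iff)
    then have "int l dvd x" using nd(1) prime_dvd_mult_iff[OF pl] prime_dvd_power[OF pl] by blast
    then show ?thesis using True by simp
  next
    case False
    then have "coprime (2 * y) (int l)" using nd(2) prime_dvd_mult_iff[OF pl] prime_imp_coprime[OF pl]
      by (subst coprime_commute) blast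
    then obtain z where z: "[2 * y * z = 1] (mod int l)" using cong_solve_coprime_int by blast
    \<comment> \<open>Modulo \<open>l\<close> this is 3 x / (2 y), and its square is -6 because 3
      x^2 = -8 y^2.\<close>
    define s where "s = 3 * x * z"
    have "[s ^ 2 + 6 = 0] (mod int l)"
    proof -
      have s: "s ^ 2 + 6 = 3 * z ^ 2 * (3 * x ^ 2 + 8 * y ^ 2) + 6 * (1 - (2 * y * z) ^ 2)"
        by (simp add: s_def power2_eq_square algebra_simps)
      have "int l dvd 1 - (2 * y * z) ^ 2"
        using cong_pow[OF z, of 2] by (simp add: cong_iff_dvd_diff dvd_diff_commute)
      then show ?thesis unfolding cong_0_iff s by (rule dvd_add[OF dvd_mult[OF d] dvd_mult])
    qed
    then have "int l mod 24 \<in> {1, 5, 7, 11}"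
      using prime_mod_24_of_residue[OF l(1) nd(3)] by (simp add: cong_0_iff)
    then show ?thesis using l(3) by simp
  qed
  then show ?thesis using that l(1) cop12 by blast
qed

text \<open>Inertness, used \<open>a\<close> times, shows that every representation of the larger
  number is divisible by \<open>int l ^ a\<close>, so scaling is a bijection. The condition modulo
  12 preserves the classes modulo 4 and modulo 6.\<close>

lemma card_represent_scale:
  fixes l a :: nat and N :: int
  assumes l: "\<And>x y :: int. int l dvd 3 * x ^ 2 + 8 * y ^ 2 \<Longrightarrow> int l dvd x \<and> int l dvd y"
    and pos: "l > 0" and one: "[int l ^ a = 1] (mod 12)"
  shows "card (represent (N * (int l ^ a) ^ 2)) = card (represent N)"
proof -
  let ?m = "int l ^ a"
  have m: "?m \<noteq> 0" using pos by simp
  have div: "int l ^ b dvd x \<and> int l ^ b dvd y" if "(int l ^ b) ^ 2 dvd 3 * x ^ 2 + 8 * y ^ 2" for b x y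
    using that
  proof (induction b arbitrary: x y)
    case (Suc b)
    have "int l dvd (int l ^ Suc b) ^ 2" by (simp add: power2_eq_square)
    then have "int l dvd 3 * x ^ 2 + 8 * y ^ 2" using Suc.prems dvd_trans by blast
    then obtain x' y' where xy: "x = int l * x'" "y = int l * y'" using l by blast
    have "int l ^ 2 * (int l ^ b) ^ 2 dvd int l ^ 2 * (3 * x' ^ 2 + 8 * y' ^ 2)"
      using Suc.prems unfolding xy by (simp add: power_mult_distrib algebra_simps)
    then have "(int l ^ b) ^ 2 dvd 3 * x' ^ 2 + 8 * y' ^ 2" using pos by simp
    from Suc.IH[OF this] show ?case unfolding xy by (simp add: mult_dvd_mono)
  qed simp
  have mod: "[?m * x = 1] (mod 4) \<longleftrightarrow> [x = 1] (mod 4)" "[?m * x = 1] (mod 6) \<longleftrightarrow> [x = 1] (mod 6)" for x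
  proof -
    have "[?m = 1] (mod 4)" "[?m = 1] (mod 6)"
      using cong_dvd_modulus[OF one, of 4] cong_dvd_modulus[OF one, of 6] by simp_all
    then have "[?m * x = 1 * x] (mod 4)" "[?m * x = 1 * x] (mod 6)" by (blast intro: cong_mult cong_refl)+
    then show "[?m * x = 1] (mod 4) \<longleftrightarrow> [x = 1] (mod 4)" "[?m * x = 1] (mod 6) \<longleftrightarrow> [x = 1] (mod 6)"
      by (simp_all add: cong_def)
  qed
  have form: "3 * (?m * x) ^ 2 + 8 * (?m * y) ^ 2 = ?m ^ 2 * (3 * x ^ 2 + 8 * y ^ 2)" for x y
    by (simp add: power_mult_distrib algebra_simps)
  have mem: "(?m * x, ?m * y) \<in> represent (N * ?m ^ 2) \<longleftrightarrow> (x, y) \<in> represent N" for x y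
    using m by (simp only: represent_def mod form mult.commute[of N] mem_Collect_eq prod.case mult_cancel_left power_eq_0_iff) blast
  have "bij_betw (\<lambda>p. (?m * fst p, ?m * snd p)) (represent N) (represent (N * ?m ^ 2))"
  proof (rule bij_betw_imageI)
    show "inj_on (\<lambda>p. (?m * fst p, ?m * snd p)) (represent N)"
      using m by (intro inj_onI) (simp only: prod_eq_iff fst_conv snd_conv mult_cancel_left, blast)
    show "(\<lambda>p. (?m * fst p, ?m * snd p)) ` represent N = represent (N * ?m ^ 2)"
    proof (rule subset_antisym; rule subsetI)
      fix q assume "q \<in> (\<lambda>p. (?m * fst p, ?m * snd p)) ` represent N"
      then obtain p where "p \<in> represent N" "q = (?m * fst p, ?m * snd p)" by blast
      then show "q \<in> represent (N * ?m ^ 2)" using mem[of "fst p" "snd p"] by simp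
    next
      fix q assume q: "q \<in> represent (N * ?m ^ 2)"
      obtain x y where xy: "q = (x, y)" by (cases q)
      have "?m ^ 2 dvd 3 * x ^ 2 + 8 * y ^ 2" using q xy by (auto simp: represent_def)
      then obtain x' y' where "x = ?m * x'" "y = ?m * y'" using div by blast
      then have q': "q = (?m * x', ?m * y')" using xy by simp
      then have "(x', y') \<in> represent N" using mem[of x' y'] q by simp
      then show "q \<in> (\<lambda>p. (?m * fst p, ?m * snd p)) ` represent N"
        unfolding q' by (intro image_eqI[of _ _ "(x', y')"]) simp_all
    qed
  qed
  then show ?thesis by (simp add: bij_betw_same_card)
qed

theorem infinite_odd_cphi2_bar:
  fixes r t :: int
  assumes t: "t \<ge> 1" and M: "[int M = r] (mod t)" "odd (cphi2_bar M div 4)"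
  shows "infinite {M :: nat. [int M = r] (mod t) \<and> odd (cphi2_bar M div 4)}"
proof -
  obtain l where l: "prime l" "coprime l (12 * nat t)"
    "\<And>x y :: int. int l dvd 3 * x ^ 2 + 8 * y ^ 2 \<Longrightarrow> int l dvd x \<and> int l dvd y"
    using inert_prime_exists[of "nat t"] t by auto
  have l1: "l > 1" using l(1) prime_gt_1_nat by blast
  \<comment> \<open>By Euler's theorem the powers of \<open>l ^ e\<close> are 1 modulo
    \<open>12 * t\<close>: the factor 12 serves the congruences in \<open>represent\<close>, the
    factor \<open>t\<close> the residue class of \<open>M\<close>.\<close>
  define e where "e = totient (12 * nat t)"
  have e: "e > 0" using t by (simp add: e_def)
  \<comment> \<open>\<open>M = 0\<close> would require representations of -1. Positivity of
    \<open>12 * M - 1\<close> is what makes the sequence \<open>g\<close> below strictly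
    increasing.\<close>
  have M0: "M > 0"
  proof (rule ccontr)
    assume "\<not> M > 0"
    then have "represent (12 * int M - 1) = {}"
      unfolding represent_def by (auto simp: add_nonneg_eq_0_iff) (smt (verit) zero_le_power2)
    then show False using M(2) unfolding cphi2_bar_parity by simp
  qed
  define m where "m k = int l ^ (e * k)" for k
  have one: "[m k = 1] (mod (12 * t))" for k
  proof -
    have "[l ^ e = 1] (mod (12 * nat t))" unfolding e_def by (rule euler_theorem[OF l(2)])
    then have "[int l ^ e = 1] (mod (12 * t))" using t by (simp flip: cong_int_iff)
    from cong_pow[OF this, of k] show ?thesis by (simp add: m_def power_mult)
  qed
  \<comment> \<open>Solves \<open>12 * g k - 1 = (12 * M - 1) * m k ^ 2\<close>; the division by 12
    is exact because \<open>m k ^ 2\<close> is 1 modulo 12.\<close>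
  define g where "g k = nat (((12 * int M - 1) * m k ^ 2 + 1) div 12)" for k
  have g: "12 * int (g k) - 1 = (12 * int M - 1) * m k ^ 2" for k
  proof -
    have "[m k ^ 2 = 1 ^ 2] (mod (12 * t))" by (intro cong_pow one)
    then have "12 dvd m k ^ 2 - 1" by (simp add: cong_iff_dvd_diff) (meson dvd_mult_left)
    moreover have "(12 * int M - 1) * m k ^ 2 + 1 = 12 * (int M * m k ^ 2) - (m k ^ 2 - 1)" by (simp add: algebra_simps)
    ultimately have "12 dvd (12 * int M - 1) * m k ^ 2 + 1" by (simp only: dvd_diff dvd_triv_left)
    then obtain q where q: "(12 * int M - 1) * m k ^ 2 + 1 = 12 * q" by blast
    moreover have "0 \<le> (12 * int M - 1) * m k ^ 2 + 1" using M0 by simp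
    ultimately have "0 \<le> q" by simp
    then show ?thesis unfolding g_def q using q by simp
  qed
  have gr: "[int (g k) = r] (mod t)" for k
  proof -
    have "[(12 * int M - 1) * m k ^ 2 = (12 * int M - 1) * 1 ^ 2] (mod (12 * t))"
      by (intro cong_mult cong_pow one cong_refl)
    then have "12 * t dvd 12 * int (g k) - 1 - (12 * int M - 1)" unfolding g[symmetric] by (simp add: cong_iff_dvd_diff)
    also have "12 * int (g k) - 1 - (12 * int M - 1) = 12 * (int (g k) - int M)" by simp
    finally have "12 * t dvd 12 * (int (g k) - int M)" .
    then have "t dvd int (g k) - int M" by (subst (asm) dvd_mult_cancel_left) simp
    then show ?thesis using M(1) by (meson cong_iff_dvd_diff cong_trans)
  qed
  have go: "odd (cphi2_bar (g k) div 4)" for k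
  proof -
    have "[int l ^ (e * k) = 1] (mod 12)"
      using one[of k] unfolding m_def by (rule cong_dvd_modulus) simp
    then have "card (represent ((12 * int M - 1) * m k ^ 2)) = card (represent (12 * int M - 1))"
      unfolding m_def using l1 by (intro card_represent_scale l(3)) simp_all
    then show ?thesis using M(2) unfolding cphi2_bar_parity g by simp
  qed
  have "inj g"
  proof (rule strict_mono_imp_inj_on)
    show "strict_mono g"
    proof (rule strict_monoI_Suc)
      fix k
      have "m k < m (Suc k)" unfolding m_def using l1 e by (intro power_strict_increasing) auto
      moreover have "0 \<le> m k" by (simp add: m_def)
      ultimately have "m k ^ 2 < m (Suc k) ^ 2" by (intro power_strict_mono) auto
      then have "(12 * int M - 1) * m k ^ 2 < (12 * int M - 1) * m (Suc k) ^ 2"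
        using M0 by (intro mult_strict_left_mono) auto
      then show "g k < g (Suc k)" unfolding g[symmetric] by simp
    qed
  qed
  then have "infinite (range g)" by (rule range_inj_infinite)
  moreover have "range g \<subseteq> {M :: nat. [int M = r] (mod t) \<and> odd (cphi2_bar M div 4)}" using gr go by auto
  ultimately show ?thesis using infinite_super by blast
qed

subsection \<open>The least odd value\<close>

context binary_theta
begin

definition indicator_series :: "(int \<Rightarrow> int \<Rightarrow> bool) \<Rightarrow> int fps" where
  "indicator_series Q = Abs_fps (\<lambda>n. int (card {p. qform p = n \<and> Q (fst p) (snd p)}))"

lemma theta_indicator: "theta (\<lambda>x y. of_bool (Q x y)) = fps_int (indicator_series Q)"
proof (rule fps_ext)
  fix n
  have "(\<Sum>p | qform p = n. of_bool (Q (fst p) (snd p)) :: complex)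
      = of_nat (card ({p. qform p = n} \<inter> {p. Q (fst p) (snd p)}))"
    by (subst sum_of_bool_eq) (simp_all add: finite_qform)
  then show "fps_nth (theta (\<lambda>x y. of_bool (Q x y))) n = fps_nth (fps_int (indicator_series Q)) n"
    by (simp add: theta_def indicator_series_def Collect_conj_eq)
qed

lemma bit_indicator_series_nth:
  "fps_nth (fps_int (indicator_series Q) :: bit fps) n
    = of_bool (odd (card {p. qform p = n \<and> Q (fst p) (snd p)}))"
  by (simp only: fps_map_nth indicator_series_def fps_nth_Abs_fps of_int_bit even_of_nat)

end

lemma even_card_involution:
  assumes "finite A" "\<And>x. x \<in> A \<Longrightarrow> f x \<in> A" "\<And>x. x \<in> A \<Longrightarrow> f (f x) = x" "\<And>x. x \<in> A \<Longrightarrow> f x \<noteq> x"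
  shows "even (card A)"
  using assms
proof (induction A rule: finite_psubset_induct)
  case (psubset A)
  show ?case
  proof (cases "A = {}")
    case False
    then obtain x where x: "x \<in> A" by blast
    let ?B = "A - {x, f x}"
    have "even (card ?B)"
    proof (rule psubset.IH)
      show "f y \<in> ?B" if "y \<in> ?B" for y
      proof -
        have "f y \<noteq> x" "f y \<noteq> f x" using that x psubset.prems(2)[of y] psubset.prems(2)[of x] by auto
        then show ?thesis using that psubset.prems(1)[of y] by blast
      qed
    qed (use x psubset.prems in auto)
    moreover have "card ?B + card {x, f x} = card A"
      using x psubset.prems(1)[OF x] psubset.hyps(1) card_mono[of A "{x, f x}"] by (simp add: card_Diff_subset)
    moreover have "card {x, f x} = 2" using psubset.prems(3)[OF x] by simp
    ultimately show ?thesis by presburger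
  qed simp
qed

theorem odd_cphi2_bar_small:
  fixes r :: int and t M0 :: nat
  assumes t: "t > 0" and M0: "[int M0 = r] (mod int t)" "odd (cphi2_bar M0 div 4)"
  obtains M :: nat where "[int M = r] (mod int t)" "odd (cphi2_bar M div 4)" "M \<le> 811009 * t ^ 3"
proof -
  \<comment> \<open>The periods \<open>16 * t\<close> and \<open>6 * t\<close> respect the classes
    modulo 4 and 6 and change 3 x^2 + 8 y^2 by multiples of \<open>12 * t\<close>; they share the
    level 3 * 16 t = 8 * 6 t = 48 t.\<close>
  interpret binary_theta 3 8 "16 * t" "6 * t" "48 * t"
    by unfold_locales (use t in simp_all)
  define B where "B x y \<longleftrightarrow> [x = 1] (mod 4) \<and> [y = 1] (mod 6)" for x y :: int
  define F where "F x y \<longleftrightarrow> B x y \<and> [3 * x ^ 2 + 8 * y ^ 2 = 12 * r - 1] (mod (12 * int t))" for x y :: int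
  define H where "H x y \<longleftrightarrow> int (16 * t) dvd x \<and> int (6 * t) dvd y" for x y :: int
  have perB: "B (x + int (16 * t)) y = B x y" "B x (y + int (6 * t)) = B x y" for x y
  proof -
    have "[x + int (16 * t) = x] (mod 4)" "[y + int (6 * t) = y] (mod 6)" by (simp_all add: cong_iff_dvd_diff)
    then show "B (x + int (16 * t)) y = B x y" "B x (y + int (6 * t)) = B x y"
      unfolding B_def by (auto simp: cong_def)
  qed
  have perF: "F (x + int (16 * t)) y = F x y" "F x (y + int (6 * t)) = F x y" for x y
  proof -
    have "3 * (x + int (16 * t)) ^ 2 + 8 * y ^ 2 = 3 * x ^ 2 + 8 * y ^ 2 + 12 * int t * (8 * x + 64 * int t)"
      "3 * x ^ 2 + 8 * (y + int (6 * t)) ^ 2 = 3 * x ^ 2 + 8 * y ^ 2 + 12 * int t * (8 * y + 24 * int t)"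
      by (simp_all add: power2_eq_square algebra_simps)
    then have "[3 * (x + int (16 * t)) ^ 2 + 8 * y ^ 2 = 3 * x ^ 2 + 8 * y ^ 2] (mod (12 * int t))"
      "[3 * x ^ 2 + 8 * (y + int (6 * t)) ^ 2 = 3 * x ^ 2 + 8 * y ^ 2] (mod (12 * int t))"
      by (simp_all only: cong_iff_dvd_diff add_diff_cancel_left' dvd_triv_left)
    then show "F (x + int (16 * t)) y = F x y" "F x (y + int (6 * t)) = F x y"
      unfolding F_def perB by (simp_all only: cong_def)
  qed
  have perH: "H (x + int (16 * t)) y = H x y" "H x (y + int (6 * t)) = H x y" for x y
    unfolding H_def by (simp_all only: dvd_add_triv_right_iff)
  have per: "per (\<lambda>x y. of_bool (B x y))" "per (\<lambda>x y. of_bool (F x y))" "per (\<lambda>x y. of_bool (H x y))"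
    unfolding per_def perB perF perH by simp_all
  have q: "qform p = n \<longleftrightarrow> 3 * fst p ^ 2 + 8 * snd p ^ 2 = int n" for p n
    using int_qform[of p] unfolding of_nat_eq_iff[where 'a = int, symmetric] by simp
  have Bset: "{p. qform p = n \<and> B (fst p) (snd p)} = represent (int n)" for n
    unfolding q represent_def B_def by auto
  have Fset: "{p. qform p = n \<and> F (fst p) (snd p)} = (if [int n = 12 * r - 1] (mod (12 * int t)) then represent (int n) else {})" for n
    unfolding q represent_def F_def B_def by auto
  \<comment> \<open>Negation pairs off the points of the sublattice, and the origin alone survives
    modulo 2.\<close>
  have H: "(fps_int (indicator_series H) :: bit fps) = 1"
  proof (rule fps_ext)
    fix n
    let ?S = "{p. qform p = n \<and> H (fst p) (snd p)}"
    have "odd (card ?S) \<longleftrightarrow> n = 0"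
    proof (cases "n = 0")
      case True
      have "?S = {(0, 0)}" unfolding q H_def True by (auto simp add: add_nonneg_eq_0_iff simp del: of_nat_mult)
      then show ?thesis using True by simp
    next
      case False
      have "even (card ?S)"
      proof (rule even_card_involution[where f = "\<lambda>p. (- fst p, - snd p)"])
        show "finite ?S" using finite_qform[of n] by (rule rev_finite_subset) auto
      qed (use False in \<open>auto simp: q H_def prod_eq_iff\<close>)
      then show ?thesis using False by simp
    qed
    then show "fps_nth (fps_int (indicator_series H) :: bit fps) n = fps_nth 1 n"
      unfolding bit_indicator_series_nth by simp
  qed
  have ge: "N \<ge> 11" if "p \<in> represent N" for p N
  proof -
    obtain x y where p: "p = (x, y)" by (cases p)
    have "x \<noteq> 0" "y \<noteq> 0" "N = 3 * x ^ 2 + 8 * y ^ 2" using that by (auto simp: represent_def p cong_def)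
    moreover from this have "x ^ 2 \<ge> 1" "y ^ 2 \<ge> 1" by (simp_all add: int_one_le_iff_zero_less)
    ultimately show ?thesis by linarith
  qed
  have eleven: "represent 11 = {(1, 1)}"
  proof (rule subset_antisym; rule subsetI)
    fix p :: "int \<times> int" assume p: "p \<in> represent 11"
    obtain x y where xy: "p = (x, y)" by (cases p)
    have e: "x \<noteq> 0" "y \<noteq> 0" "3 * x ^ 2 + 8 * y ^ 2 = 11" "[x = 1] (mod 4)" "[y = 1] (mod 6)"
      using p by (auto simp: represent_def xy cong_def)
    moreover from this have "x ^ 2 \<ge> 1" "y ^ 2 \<ge> 1" by (simp_all add: int_one_le_iff_zero_less)
    ultimately have "x ^ 2 = 1" "y ^ 2 = 1" by linarith+
    then have "x = 1 \<or> x = - 1" "y = 1 \<or> y = - 1" by (simp_all add: power2_eq_1_iff)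
    then show "p \<in> {(1, 1)}" using e(4,5) xy by (auto simp: cong_def)
  qed (auto simp: represent_def)
  \<comment> \<open>Exponent 11 belongs to \<open>M = 1\<close>, the first odd value.\<close>
  have G: "subdegree (fps_int (indicator_series B) :: bit fps) = 11"
  proof (rule subdegreeI)
    show "fps_nth (fps_int (indicator_series B) :: bit fps) 11 \<noteq> 0"
      unfolding bit_indicator_series_nth Bset using eleven by simp
    fix i :: nat assume "i < 11"
    then have "represent (int i) = {}" using ge[of _ "int i"] by fastforce
    then show "fps_nth (fps_int (indicator_series B) :: bit fps) i = 0"
      unfolding bit_indicator_series_nth Bset by simp
  qed
  have F: "(fps_int (indicator_series F) :: bit fps) \<noteq> 0"
  proof
    assume z: "(fps_int (indicator_series F) :: bit fps) = 0"
    have o: "odd (card (represent (12 * int M0 - 1)))" using M0(2) unfolding cphi2_bar_parity .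
    then have "represent (12 * int M0 - 1) \<noteq> {}" by (metis card.empty even_zero)
    then obtain p where "p \<in> represent (12 * int M0 - 1)" by blast
    \<comment> \<open>Excludes \<open>M0 = 0\<close>, so that the natural subtraction in
      \<open>12 * M0 - 1\<close> gives the intended exponent.\<close>
    then have "12 * int M0 - 1 \<ge> 11" by (rule ge)
    then have n: "int (12 * M0 - 1) = 12 * int M0 - 1" by simp
    have "[12 * int M0 = 12 * r] (mod (12 * int t))" using M0(1) by (rule cong_cmult_leftI)
    then have "[12 * int M0 - 1 = 12 * r - 1] (mod (12 * int t))" by (intro cong_diff cong_refl)
    then have "fps_nth (fps_int (indicator_series F) :: bit fps) (12 * M0 - 1) = 1"
      unfolding bit_indicator_series_nth Fset n using o by simp
    then show False unfolding z by simp
  qed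
  define n where "n = subdegree (fps_int (indicator_series F) :: bit fps)"
  \<comment> \<open>The bound \<open>8 * E ^ 3 * subdegree G\<close> at \<open>E = 48 * t\<close>
    and order 11; numerically 8 * 48^3 * 11 = 9732096.\<close>
  have "n \<le> 8 * (48 * t) ^ 3 * 11"
    using theta_parity_order[OF per(2,1,3) theta_indicator theta_indicator theta_indicator H F] unfolding G n_def by simp
  then have n: "n \<le> 9732096 * t ^ 3" by (simp add: power_mult_distrib)
  have "fps_nth (fps_int (indicator_series F) :: bit fps) n \<noteq> 0"
    unfolding n_def using F by (rule nth_subdegree_nonzero)
  then have "odd (card {p. qform p = n \<and> F (fst p) (snd p)})" unfolding bit_indicator_series_nth by auto
  then have nr: "[int n = 12 * r - 1] (mod (12 * int t))" "odd (card (represent (int n)))"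
    unfolding Fset by (auto split: if_splits)
  from nr(1) have "12 * int t dvd int n - (12 * r - 1)" by (simp only: cong_iff_dvd_diff)
  then obtain k where k: "int n - (12 * r - 1) = 12 * int t * k" by blast
  define M where "M = nat (r + int t * k)"
  have nk: "int n = 12 * (r + int t * k) - 1" using k by (simp add: algebra_simps)
  have "0 \<le> r + int t * k"
  proof (rule ccontr)
    assume "\<not> 0 \<le> r + int t * k"
    then have "12 * (r + int t * k) \<le> 0" by simp
    then show False using nk of_nat_0_le_iff[of n, where 'a = int] by linarith
  qed
  then have iM: "int M = r + int t * k" by (simp add: M_def)
  from iM have "[int M = r] (mod int t)" by (simp add: cong_iff_dvd_diff)
  moreover have "odd (cphi2_bar M div 4)" unfolding cphi2_bar_parity iM using nr(2) nk by simp
  \<comment> \<open>9732096 / 12 = 811008, and one further \<open>t ^ 3\<close> absorbs the 1 in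
    \<open>n + 1 = 12 * M\<close>.\<close>
  moreover have "M \<le> 811009 * t ^ 3"
  proof -
    have "t ^ 3 \<ge> 1" using t by simp
    moreover have "int (n + 1) = int (12 * M)" using nk iM by simp
    then have "n + 1 = 12 * M" by (simp only: of_nat_eq_iff)
    ultimately show ?thesis using n by linarith
  qed
  ultimately show ?thesis using that by blast
qed

section \<open>Comparison with the claimed bound\<close>

lemma prod_one_minus_inverse_square_ge:
  "finite A \<Longrightarrow> A \<subseteq> {2 :: int..} \<Longrightarrow> (\<Prod>p\<in>A. 1 - 1 / real_of_int p ^ 2) \<ge> 1 / 2"
proof -
  assume A: "finite A" "A \<subseteq> {2 :: int..}"
  have "1 - 1 / real_of_int p ^ 2 \<in> {0..1}" if "p \<ge> 2" for p
  proof -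
    have "1 \<le> real_of_int p ^ 2" using that by (intro one_le_power) simp
    then show ?thesis by (simp add: divide_le_eq_1)
  qed
  note range = this
  obtain m :: nat where m: "A \<subseteq> {2..int m + 1}"
  proof
    show "A \<subseteq> {2..int (nat (Max (insert 0 A))) + 1}"
    proof
      fix p assume p: "p \<in> A"
      then have "p \<le> Max (insert 0 A)" using A(1) by simp
      then show "p \<in> {2..int (nat (Max (insert 0 A))) + 1}" using p A(2) by auto
    qed
  qed
  \<comment> \<open>The product over all integers in an initial range telescopes and stays above
    1/2. All factors lie between 0 and 1, so the product over the subset \<open>A\<close> is at
    least as large.\<close>
  have tel: "(\<Prod>p\<in>{2..int k + 1}. 1 - 1 / real_of_int p ^ 2) = (real k + 2) / (2 * (real k + 1))" for k
  proof (induction k)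
    case (Suc k)
    have s: "{2..int (Suc k) + 1} = insert (int k + 2) {2..int k + 1}" by auto
    have "(\<Prod>p\<in>{2..int (Suc k) + 1}. 1 - 1 / real_of_int p ^ 2)
        = (1 - 1 / (real k + 2) ^ 2) * ((real k + 2) / (2 * (real k + 1)))"
      unfolding s by (subst prod.insert) (simp_all only: Suc.IH, simp_all)
    also have "\<dots> = (real (Suc k) + 2) / (2 * (real (Suc k) + 1))"
    proof -
      define K L where "K = real k + 1" "L = real k + 2"
      have K: "K \<noteq> 0" "L \<noteq> 0" unfolding K_L_def by linarith+
      have "1 - 1 / L ^ 2 = (L ^ 2 - 1) / L ^ 2" using K by (simp add: diff_divide_distrib)
      also have "L ^ 2 - 1 = K * (L + 1)" by (simp add: K_L_def power2_eq_square algebra_simps)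
      finally have "(1 - 1 / L ^ 2) * (L / (2 * K)) = (L + 1) / (2 * L)" using K by (simp add: power2_eq_square)
      then show ?thesis by (simp add: K_L_def add.commute)
    qed
    finally show ?case .
  qed simp
  have "1 / 2 \<le> (real m + 2) / (2 * (real m + 1))" by (simp add: field_simps)
  also have "\<dots> = (\<Prod>p\<in>{2..int m + 1}. 1 - 1 / real_of_int p ^ 2)" by (simp only: tel)
  also have "\<dots> = (\<Prod>p\<in>{2..int m + 1} - A. 1 - 1 / real_of_int p ^ 2) * (\<Prod>p\<in>A. 1 - 1 / real_of_int p ^ 2)"
    by (rule prod.subset_diff[OF m]) simp
  also have "\<dots> \<le> 1 * (\<Prod>p\<in>A. 1 - 1 / real_of_int p ^ 2)"
    using range A(2) by (intro mult_right_mono prod_le_1 prod_nonneg) (auto dest!: range[unfolded atLeastAtMost_iff])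
  finally show ?thesis by simp
qed

text \<open>Since the gcd is at most \<open>t\<close> and the product over primes at least 1/2, the
  main term is of order \<open>t ^ 4\<close> times \<open>2 powi j\<close>; the condition on
  \<open>j\<close> adds another factor \<open>t\<close>, and order \<open>t ^ 5\<close> outweighs
  \<open>t ^ 3\<close>.\<close>

lemma parity_bound_gt:
  fixes r t j :: int
  assumes t: "t \<ge> 1" and j: "2 powi j > real_of_int t / 12"
  shows "811009 * real_of_int t ^ 3 < parity_bound r t j"
proof -
  define T where "T = real_of_int t"
  define D where "D = real_of_int (gcd (12 * r - 1) t)"
  define Q where "Q = (\<Prod>p | prime p \<and> p dvd 6 * t. 1 - 1 / real_of_int p ^ 2)"
  have T: "T \<ge> 1" using t by (simp add: T_def)
  have D: "1 \<le> D" "D \<le> T"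
  proof -
    have "gcd (12 * r - 1) t > 0" using t by (simp add: gcd_pos_int)
    then show "1 \<le> D" unfolding D_def by linarith
    have "gcd (12 * r - 1) t \<le> t" using t by (intro gcd_le2_int) simp
    then show "D \<le> T" by (simp add: D_def T_def)
  qed
  have "finite {p. prime p \<and> p dvd 6 * t}"
    using t finite_divisors_int[of "6 * t"] by (rule_tac rev_finite_subset[of "{p. p dvd 6 * t}"]) auto
  then have Q: "Q \<ge> 1 / 2" unfolding Q_def
    by (rule prod_one_minus_inverse_square_ge) (auto simp: prime_ge_2_int)
  have "T ^ 4 * D ^ 2 \<le> T ^ 4 * T ^ 2" using T D by (intro mult_left_mono power_mono) auto
  then have TD: "T ^ 4 \<le> T ^ 6 / D ^ 2" using D by (simp add: pos_le_divide_eq flip: power_add)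
  have "T ^ 4 * (1 / 2) \<le> T ^ 6 / D ^ 2 * Q"
    using TD Q T by (intro mult_mono) (auto intro: order_trans[OF _ TD])
  then have "573308928 * T ^ 4 * (1 / 2) \<le> 573308928 * (T ^ 6 / D ^ 2 * Q)" by simp
  moreover have T4: "T ^ 4 \<ge> 1" "T ^ 5 \<ge> T ^ 3" using T by (simp_all add: power_increasing)
  \<comment> \<open>573308928 is 2^18 * 3^7, and 286654463 is half of it less 1; as
    \<open>T ^ 4\<close> is at least 1, this unit pays for the subtracted
    \<open>2 powi j\<close>.\<close>
  ultimately have X: "286654463 * T ^ 4 \<le> 573308928 * (T ^ 6 / D ^ 2 * Q) - 1" by linarith
  have "811009 * T ^ 3 < 286654463 * (T ^ 5 / 12)" using T4 T zero_less_power[of T 3] by linarith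
  also have "\<dots> = T / 12 * (286654463 * T ^ 4)" by (simp add: eval_nat_numeral)
  also have "\<dots> \<le> 2 powi j * (573308928 * (T ^ 6 / D ^ 2 * Q) - 1)"
    using j T X by (intro mult_mono) (auto simp: T_def)
  also have "\<dots> = 2 powi (18 + j) * 3 ^ 7 * T ^ 6 / D ^ 2 * Q - 2 powi j"
    by (simp add: power_int_add algebra_simps)
  finally show ?thesis by (simp add: parity_bound_def T_def D_def Q_def)
qed

text \<open>\<open>M\<close> ranges over the natural numbers because the generating function has no
  negative exponents, while \<open>r\<close> may be any integer.\<close>

theorem theorem3:
  fixes r t :: int
  assumes "t \<ge> 1"
    and "\<exists>M :: nat. [int M = r] (mod t) \<and> odd (cphi2_bar M div 4)"
  shows "infinite {M :: nat. [int M = r] (mod t) \<and> odd (cphi2_bar M div 4)} \<and>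
    (\<forall>j :: int. 2 powi j > real_of_int t / 12 \<longrightarrow>
      real (LEAST M. [int M = r] (mod t) \<and> odd (cphi2_bar M div 4)) < parity_bound r t j)"
proof (intro conjI allI impI)
  obtain M0 :: nat where M0: "[int M0 = r] (mod t)" "odd (cphi2_bar M0 div 4)" using assms(2) by blast
  then show "infinite {M :: nat. [int M = r] (mod t) \<and> odd (cphi2_bar M div 4)}"
    by (rule infinite_odd_cphi2_bar[OF assms(1)])
  fix j :: int assume j: "2 powi j > real_of_int t / 12"
  have t: "nat t > 0" "int (nat t) = t" using assms(1) by simp_all
  obtain M :: nat where M: "[int M = r] (mod t)" "odd (cphi2_bar M div 4)" "M \<le> 811009 * nat t ^ 3"
    using odd_cphi2_bar_small[OF t(1), of M0 r] M0 unfolding t(2) by blast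
  have "(LEAST M. [int M = r] (mod t) \<and> odd (cphi2_bar M div 4)) \<le> M" using M by (intro Least_le) blast
  then have "real (LEAST M. [int M = r] (mod t) \<and> odd (cphi2_bar M div 4)) \<le> real (811009 * nat t ^ 3)"
    using M(3) by linarith
  also have "\<dots> = 811009 * real_of_int t ^ 3" using assms(1) by simp
  also have "\<dots> < parity_bound r t j" by (rule parity_bound_gt[OF assms(1) j])
  finally show "real (LEAST M. [int M = r] (mod t) \<and> odd (cphi2_bar M div 4)) < parity_bound r t j" .
qed

end
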